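(* Let $n,m\geq 0$ be integers, let $q:\mathbb{R}^n\times\mathbb{T}^m\to\mathbb{T}^{n+m}$ be the quotient map, and let $E\subseteq\mathbb{T}^{n+m}$ be a closed subset. Then $E$ is an $M_0$-set (in $\mathbb{T}^{n+m}$) if and only if $q^{-1}(E)$ is an $M_0$-set (in $\mathbb{R}^n\times\mathbb{T}^m$).
   Context: The quotient map $q$ is that of $\mathbb{R}^n\times\mathbb{T}^m$ by the closed subgroup $\mathbb{Z}^n\times\{1\}^m$, with $\mathbb{R}/\mathbb{Z}$ identified with $\mathbb{T}$. For a locally compact group $G$, $M(G)$ is the Banach algebra (under convolution) of complex Borel measures on $G$; for a closed set $E\subseteq G$, $M(E)\subseteq M(G)$ is the set of measures with support contained in $E$. $L^p(G)$ is taken with respect to Haar measure. For $\mu\in M(G)$ the operator $\lambda(\mu)$ on $L^2(G)$ is $\lambda(\mu)\xi(g)=\int_G\xi(s^{-1}g)\,d\mu(s)$; $L^1(G)$ is identified with a closed ideal of $M(G)$. The reduced group $C^*$-algebra is $C_r^*(G)=\overline{\{\lambda(f): f\in L^1(G)\}}^{\|\cdot\|}\subseteq\mathcal{L}(L^2(G))$. A closed set $E\subseteq G$ is a set of extended uniqueness if $\lambda(M(E))\cap C_r^*(G)=\{0\}$; otherwise it is called a set of restricted multiplicity, or an $M_0$-set. *)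

theory Defs
  imports "HOL-Analysis.Analysis" "HOL-Algebra.Product_Groups"
begin

text \<open>
  A locally compact group is presented by a group \<open>G\<close>, a topology \<open>T\<close> on its carrier and a Haar
  measure \<open>h\<close>. The groups of interest are second countable, so finite Borel measures on them are
  automatically regular and no regularity condition is imposed below.
\<close>

definition borel_of :: "'a topology \<Rightarrow> 'a measure" where
  "borel_of T = sigma (topspace T) {U. openin T U}"

definition haar_measure :: "('a, 'b) monoid_scheme \<Rightarrow> 'a topology \<Rightarrow> 'a measure \<Rightarrow> bool" where
  "haar_measure G T h \<longleftrightarrow>
     topspace T = carrier G \<and> sets h = sets (borel_of T) \<and>
     (\<forall>g\<in>carrier G. (\<lambda>x. g \<otimes>\<^bsub>G\<^esub> x) \<in> h \<rightarrow>\<^sub>M h \<and> distr h h (\<lambda>x. g \<otimes>\<^bsub>G\<^esub> x) = h) \<and>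
     (\<forall>K. compactin T K \<longrightarrow> emeasure h K < \<infinity>) \<and>
     emeasure h (space h) \<noteq> 0"


section \<open>Complex measures\<close>

text \<open>
  A complex measure is a countably additive complex-valued set function on the measurable sets;
  its values on other sets are irrelevant. Countable additivity forces the empty set to have
  measure 0.
\<close>

definition complex_measure :: "'a measure \<Rightarrow> ('a set \<Rightarrow> complex) \<Rightarrow> bool" where
  "complex_measure M \<mu> \<longleftrightarrow>
     (\<forall>A :: nat \<Rightarrow> 'a set. range A \<subseteq> sets M \<longrightarrow> disjoint_family A \<longrightarrow>
        (\<lambda>i. \<mu> (A i)) sums \<mu> (\<Union>i. A i))"

text \<open>
  The positive part of the Jordan decomposition of a finite signed measure \<open>\<nu>\<close>, that is,
  \<open>\<nu>\<^sup>+(A) = sup {\<nu>(B) | B \<subseteq> A}\<close>; the negative part is the positive part of \<open>-\<nu>\<close>.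
  The coercion \<open>ennreal\<close> truncates negative values at 0, which is harmless because \<open>\<nu>({}) = 0\<close>.
\<close>

definition positive_part :: "'a measure \<Rightarrow> ('a set \<Rightarrow> real) \<Rightarrow> 'a measure" where
  "positive_part M \<nu> =
     measure_of (space M) (sets M) (\<lambda>A. SUP B\<in>{B \<in> sets M. B \<subseteq> A}. ennreal (\<nu> B))"

definition complex_measure_integral ::
    "'a measure \<Rightarrow> ('a set \<Rightarrow> complex) \<Rightarrow> ('a \<Rightarrow> complex) \<Rightarrow> complex" where
  "complex_measure_integral M \<mu> f =
     (\<integral>x. f x \<partial>positive_part M (\<lambda>A. Re (\<mu> A))) - (\<integral>x. f x \<partial>positive_part M (\<lambda>A. - Re (\<mu> A)))
     + \<i> * ((\<integral>x. f x \<partial>positive_part M (\<lambda>A. Im (\<mu> A))) - (\<integral>x. f x \<partial>positive_part M (\<lambda>A. - Im (\<mu> A))))"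

definition measure_support :: "'a topology \<Rightarrow> ('a set \<Rightarrow> complex) \<Rightarrow> 'a set" where
  "measure_support T \<mu> =
     topspace T - \<Union>{U. openin T U \<and> (\<forall>A\<in>sets (borel_of T). A \<subseteq> U \<longrightarrow> \<mu> A = 0)}"

text \<open>\<open>M(E)\<close>; in particular \<open>M(G)\<close> is obtained for \<open>E = carrier G\<close>.\<close>

definition measures_on :: "'a topology \<Rightarrow> 'a set \<Rightarrow> ('a set \<Rightarrow> complex) set" where
  "measures_on T E = {\<mu>. complex_measure (borel_of T) \<mu> \<and> measure_support T \<mu> \<subseteq> E}"

text \<open>The element of \<open>M(G)\<close> with which \<open>f \<in> L\<^sup>1(G)\<close> is identified.\<close>

definition L1_measure :: "'a measure \<Rightarrow> ('a \<Rightarrow> complex) \<Rightarrow> 'a set \<Rightarrow> complex" where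
  "L1_measure h f = (\<lambda>A. LINT x:A|h. f x)"


section \<open>Operators on \<open>L\<^sup>2\<close>\<close>

text \<open>
  Elements of \<open>L\<^sup>2\<close> are represented by square-integrable functions, and operators on \<open>L\<^sup>2\<close> by maps
  between such functions; equality in \<open>L\<^sup>2\<close> is equality almost everywhere. A bounded operator in
  the sense below automatically respects it, by linearity and boundedness.
\<close>

definition L2 :: "'a measure \<Rightarrow> ('a \<Rightarrow> complex) set" where
  "L2 h = {\<xi> \<in> borel_measurable h. integrable h (\<lambda>x. (cmod (\<xi> x))\<^sup>2)}"

definition L2_norm :: "'a measure \<Rightarrow> ('a \<Rightarrow> complex) \<Rightarrow> real" where
  "L2_norm h \<xi> = sqrt (\<integral>x. (cmod (\<xi> x))\<^sup>2 \<partial>h)"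

definition bounded_operator :: "'a measure \<Rightarrow> (('a \<Rightarrow> complex) \<Rightarrow> 'a \<Rightarrow> complex) \<Rightarrow> bool" where
  "bounded_operator h A \<longleftrightarrow>
     (\<forall>\<xi>\<in>L2 h. A \<xi> \<in> L2 h) \<and>
     (\<forall>a b. \<forall>\<xi>\<in>L2 h. \<forall>\<eta>\<in>L2 h.
        AE x in h. A (\<lambda>y. a * \<xi> y + b * \<eta> y) x = a * A \<xi> x + b * A \<eta> x) \<and>
     (\<exists>C. \<forall>\<xi>\<in>L2 h. L2_norm h (A \<xi>) \<le> C * L2_norm h \<xi>)"

definition operator_norm :: "'a measure \<Rightarrow> (('a \<Rightarrow> complex) \<Rightarrow> 'a \<Rightarrow> complex) \<Rightarrow> real" where
  "operator_norm h A = (SUP \<xi>\<in>{\<xi> \<in> L2 h. L2_norm h \<xi> \<le> 1}. L2_norm h (A \<xi>))"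

definition zero_operator :: "'a measure \<Rightarrow> (('a \<Rightarrow> complex) \<Rightarrow> 'a \<Rightarrow> complex) \<Rightarrow> bool" where
  "zero_operator h A \<longleftrightarrow> (\<forall>\<xi>\<in>L2 h. AE x in h. A \<xi> x = 0)"

definition left_regular ::
    "('a, 'b) monoid_scheme \<Rightarrow> 'a topology \<Rightarrow> ('a set \<Rightarrow> complex) \<Rightarrow> ('a \<Rightarrow> complex) \<Rightarrow> 'a \<Rightarrow> complex" where
  "left_regular G T \<mu> \<xi> g =
     complex_measure_integral (borel_of T) \<mu> (\<lambda>s. \<xi> (inv\<^bsub>G\<^esub> s \<otimes>\<^bsub>G\<^esub> g))"

definition reduced_group_Cstar ::
    "('a, 'b) monoid_scheme \<Rightarrow> 'a topology \<Rightarrow> 'a measure \<Rightarrow> (('a \<Rightarrow> complex) \<Rightarrow> 'a \<Rightarrow> complex) set" where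
  "reduced_group_Cstar G T h =
     {A. bounded_operator h A \<and>
         (\<forall>\<epsilon>>0. \<exists>f. integrable h f \<and>
            operator_norm h (\<lambda>\<xi> x. A \<xi> x - left_regular G T (L1_measure h f) \<xi> x) < \<epsilon>)}"


section \<open>Sets of extended uniqueness and \<open>M\<^sub>0\<close>-sets\<close>

text \<open>
  The intersection always contains the zero operator, since \<open>M(E)\<close> contains the zero measure, so
  the inclusion expresses that it equals \<open>{0}\<close>.
\<close>

definition extended_uniqueness_set ::
    "('a, 'b) monoid_scheme \<Rightarrow> 'a topology \<Rightarrow> 'a measure \<Rightarrow> 'a set \<Rightarrow> bool" where
  "extended_uniqueness_set G T h E \<longleftrightarrow>
     closedin T E \<and>
     left_regular G T ` measures_on T E \<inter> reduced_group_Cstar G T h \<subseteq> {A. zero_operator h A}"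

definition M0_set ::
    "('a, 'b) monoid_scheme \<Rightarrow> 'a topology \<Rightarrow> 'a measure \<Rightarrow> 'a set \<Rightarrow> bool" where
  "M0_set G T h E \<longleftrightarrow> closedin T E \<and> \<not> extended_uniqueness_set G T h E"


section \<open>The groups \<open>\<real>\<^sup>n \<times> \<T>\<^sup>m\<close>\<close>

text \<open>
  Elements of \<open>\<real>\<^sup>n\<close> and \<open>\<T>\<^sup>m\<close> are extensional functions on \<open>{..<n}\<close> and \<open>{..<m}\<close>; for exponent 0
  this gives the trivial group.
\<close>

definition real_group :: "real monoid" where
  "real_group = \<lparr>carrier = UNIV, mult = (+), one = 0\<rparr>"

definition circle_group :: "complex monoid" where
  "circle_group = \<lparr>carrier = sphere 0 1, mult = (*), one = 1\<rparr>"

definition circle_topology :: "complex topology" where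
  "circle_topology = top_of_set (sphere 0 1)"

definition circle_haar :: "complex measure" where
  "circle_haar =
     distr (restrict_space lborel {0..<1}) (borel_of circle_topology) (\<lambda>t. cis (2 * pi * t))"

definition torus_group :: "nat \<Rightarrow> (nat \<Rightarrow> complex) monoid" where
  "torus_group k = product_group {..<k} (\<lambda>_. circle_group)"

definition torus_topology :: "nat \<Rightarrow> (nat \<Rightarrow> complex) topology" where
  "torus_topology k = product_topology (\<lambda>_. circle_topology) {..<k}"

definition torus_haar :: "nat \<Rightarrow> (nat \<Rightarrow> complex) measure" where
  "torus_haar k = PiM {..<k} (\<lambda>_. circle_haar)"

definition euclidean_torus_group :: "nat \<Rightarrow> nat \<Rightarrow> ((nat \<Rightarrow> real) \<times> (nat \<Rightarrow> complex)) monoid" where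
  "euclidean_torus_group n m = product_group {..<n} (\<lambda>_. real_group) \<times>\<times> torus_group m"

definition euclidean_torus_topology ::
    "nat \<Rightarrow> nat \<Rightarrow> ((nat \<Rightarrow> real) \<times> (nat \<Rightarrow> complex)) topology" where
  "euclidean_torus_topology n m =
     prod_topology (product_topology (\<lambda>_. euclideanreal) {..<n}) (torus_topology m)"

definition euclidean_torus_haar :: "nat \<Rightarrow> nat \<Rightarrow> ((nat \<Rightarrow> real) \<times> (nat \<Rightarrow> complex)) measure" where
  "euclidean_torus_haar n m = PiM {..<n} (\<lambda>_. lborel) \<Otimes>\<^sub>M torus_haar m"

definition torus_quotient_map :: "nat \<Rightarrow> nat \<Rightarrow> (nat \<Rightarrow> real) \<times> (nat \<Rightarrow> complex) \<Rightarrow> nat \<Rightarrow> complex" where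
  "torus_quotient_map n m = (\<lambda>(x, z). \<lambda>i\<in>{..<n + m}. if i < n then cis (2 * pi * x i) else z (i - n))"

section \<open>The measures above are Haar measures\<close>

lemma space_borel_of [simp]: "space (borel_of T) = topspace T"
  unfolding borel_of_def by (rule space_measure_of) (auto dest: openin_subset)

lemma sets_borel_of: "sets (borel_of T) = sigma_sets (topspace T) {U. openin T U}"
  unfolding borel_of_def by (rule sets_measure_of) (auto dest: openin_subset)

lemma openin_in_borel_of: "openin T U \<Longrightarrow> U \<in> sets (borel_of T)"
  by (simp add: sets_borel_of sigma_sets.Basic)

lemma closedin_in_borel_of: "closedin T C \<Longrightarrow> C \<in> sets (borel_of T)"
  using sets.compl_sets[OF openin_in_borel_of[of T "topspace T - C"]]
  by (auto simp: closedin_def double_diff)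

lemma continuous_map_measurable_borel_of:
  assumes "continuous_map S T f"
  shows "f \<in> borel_of S \<rightarrow>\<^sub>M borel_of T"
  unfolding borel_of_def[of T]
proof (rule measurable_measure_of)
  show "{U. openin T U} \<subseteq> Pow (topspace T)" by (auto dest: openin_subset)
  show "f \<in> space (borel_of S) \<rightarrow> topspace T"
    using continuous_map_image_subset_topspace[OF assms] by auto
  fix U assume "U \<in> {U. openin T U}"
  then have "openin S {x \<in> topspace S. f x \<in> U}"
    using assms by (auto simp: continuous_map_def)
  moreover have "{x \<in> topspace S. f x \<in> U} = f -` U \<inter> space (borel_of S)" by auto
  ultimately show "f -` U \<inter> space (borel_of S) \<in> sets (borel_of S)"
    using openin_in_borel_of[of S "{x \<in> topspace S. f x \<in> U}"] by simp
qed

lemma sets_borel_of_euclidean: "sets (borel_of euclidean) = sets borel"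
  by (simp add: sets_borel_of borel_def)

lemma second_countableE:
  assumes "second_countable X"
  obtains B where "countable B" "\<And>V. V \<in> B \<Longrightarrow> openin X V"
      "\<And>U x. openin X U \<Longrightarrow> x \<in> U \<Longrightarrow> \<exists>V\<in>B. x \<in> V \<and> V \<subseteq> U"
  using assms unfolding second_countable_def by auto

lemma openin_product_topologyE:
  assumes "openin (product_topology X I) U" "x \<in> U"
  obtains V where "\<And>i. i \<in> I \<Longrightarrow> openin (X i) (V i)" "x \<in> Pi\<^sub>E I V" "Pi\<^sub>E I V \<subseteq> U"
proof -
  have "\<exists>V. finite {i \<in> I. V i \<noteq> topspace (X i)} \<and> (\<forall>i\<in>I. openin (X i) (V i)) \<and> x \<in> Pi\<^sub>E I V \<and> Pi\<^sub>E I V \<subseteq> U"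
    using assms(1)[unfolded openin_product_topology_alt] assms(2) by (rule bspec)
  then show thesis using that by blast
qed

lemma sets_PiM_borel_of:
  assumes I: "finite I" and h: "sets h = sets (borel_of X)" and X: "second_countable X"
  shows "sets (PiM I (\<lambda>_. h)) = sets (borel_of (product_topology (\<lambda>_. X) I))" (is "_ = sets ?P")
proof
  have sp: "space h = topspace X" using sets_eq_imp_space_eq[OF h] by simp
  show "sets (PiM I (\<lambda>_. h)) \<subseteq> sets ?P"
  proof
    fix A assume A: "A \<in> sets (PiM I (\<lambda>_. h))"
    have "(\<lambda>\<omega> i. \<omega> i) \<in> ?P \<rightarrow>\<^sub>M PiM I (\<lambda>_. h)"
    proof (rule measurable_PiM_single')
      fix i assume "i \<in> I"
      then have "(\<lambda>\<omega>. \<omega> i) \<in> ?P \<rightarrow>\<^sub>M borel_of X"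
        by (intro continuous_map_measurable_borel_of continuous_map_product_projection)
      then show "(\<lambda>\<omega>. \<omega> i) \<in> ?P \<rightarrow>\<^sub>M h"
        by (simp add: measurable_cong_sets[OF refl h])
    qed (simp add: sp)
    from measurable_sets[OF this A] have "A \<inter> space ?P \<in> sets ?P" by simp
    moreover have "A \<subseteq> space ?P" using sets.sets_into_space[OF A] by (simp add: space_PiM sp)
    ultimately show "A \<in> sets ?P" by (simp add: Int_absorb2)
  qed
  obtain B where B: "countable B" "\<And>V. V \<in> B \<Longrightarrow> openin X V"
      "\<And>U x. openin X U \<Longrightarrow> x \<in> U \<Longrightarrow> \<exists>V\<in>B. x \<in> V \<and> V \<subseteq> U"
    by (rule second_countableE[OF X]) (rule that)
  have "U \<in> sets (PiM I (\<lambda>_. h))" if U: "openin (product_topology (\<lambda>_. X) I) U" for U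
  proof -
    define \<W> where "\<W> = {W \<in> I \<rightarrow>\<^sub>E B. Pi\<^sub>E I W \<subseteq> U}"
    have "countable (I \<rightarrow>\<^sub>E B)" using I B(1) by (intro countable_PiE) auto
    then have "countable \<W>" by (rule countable_subset[rotated]) (auto simp: \<W>_def)
    moreover have "Pi\<^sub>E I W \<in> sets (PiM I (\<lambda>_. h))" if "W \<in> \<W>" for W
      using that by (intro sets_PiM_I_finite[OF I]) (auto simp: \<W>_def h PiE_iff intro!: openin_in_borel_of B(2))
    ultimately have "(\<Union>W\<in>\<W>. Pi\<^sub>E I W) \<in> sets (PiM I (\<lambda>_. h))"
      by (intro sets.countable_UN') auto
    moreover have "U = (\<Union>W\<in>\<W>. Pi\<^sub>E I W)"
    proof
      show "U \<subseteq> (\<Union>W\<in>\<W>. Pi\<^sub>E I W)"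
      proof
        fix x assume "x \<in> U"
        then obtain V where V: "\<And>i. i \<in> I \<Longrightarrow> openin X (V i)" "x \<in> Pi\<^sub>E I V" "Pi\<^sub>E I V \<subseteq> U"
          using openin_product_topologyE[OF U] by blast
        then have "\<forall>i\<in>I. \<exists>W\<in>B. x i \<in> W \<and> W \<subseteq> V i" using B(3) by (simp add: PiE_iff)
        then have "\<forall>i\<in>I. \<exists>W. W \<in> B \<and> x i \<in> W \<and> W \<subseteq> V i" by blast
        then have "\<exists>W. \<forall>i\<in>I. W i \<in> B \<and> x i \<in> W i \<and> W i \<subseteq> V i" by (rule bchoice)
        then obtain W where W: "\<And>i. i \<in> I \<Longrightarrow> W i \<in> B \<and> x i \<in> W i \<and> W i \<subseteq> V i" by blast
        have "Pi\<^sub>E I (restrict W I) \<subseteq> Pi\<^sub>E I V" using W by (intro PiE_mono) auto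
        then have "restrict W I \<in> \<W>" using W V(3) by (auto simp: \<W>_def)
        moreover have "x \<in> Pi\<^sub>E I (restrict W I)" using V(2) W by (auto simp: PiE_iff)
        ultimately show "x \<in> (\<Union>W\<in>\<W>. Pi\<^sub>E I W)" by blast
      qed
    qed (auto simp: \<W>_def)
    ultimately show ?thesis by simp
  qed
  note * = this
  have "{U. openin (product_topology (\<lambda>_. X) I) U} \<subseteq> sets (PiM I (\<lambda>_. h))" using * by blast
  then show "sets ?P \<subseteq> sets (PiM I (\<lambda>_. h))"
    unfolding sets_borel_of by (rule sets.sigma_sets_subset'[OF _ *[OF openin_topspace]])
qed

lemma second_countable_power:
  assumes I: "finite I" and X: "second_countable X"
  shows "second_countable (product_topology (\<lambda>_. X) I)"
proof -
  obtain B where B: "countable B" "\<And>V. V \<in> B \<Longrightarrow> openin X V"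
      "\<And>U x. openin X U \<Longrightarrow> x \<in> U \<Longrightarrow> \<exists>V\<in>B. x \<in> V \<and> V \<subseteq> U"
    by (rule second_countableE[OF X]) (rule that)
  show ?thesis
    unfolding second_countable_def
  proof (intro exI[of _ "Pi\<^sub>E I ` (I \<rightarrow>\<^sub>E B)"] conjI ballI allI impI)
    show "countable (Pi\<^sub>E I ` (I \<rightarrow>\<^sub>E B))"
      using I B(1) by (intro countable_image countable_PiE) auto
    show "openin (product_topology (\<lambda>_. X) I) V" if Vm: "V \<in> Pi\<^sub>E I ` (I \<rightarrow>\<^sub>E B)" for V
    proof -
      obtain W where VW: "V = Pi\<^sub>E I W" and W: "W \<in> I \<rightarrow>\<^sub>E B" using Vm by (rule imageE)
      have "openin X (W i)" if "i \<in> I" for i using B(2)[OF PiE_mem[OF W that]] .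
      then show ?thesis unfolding VW openin_PiE[OF I] by blast
    qed
    fix U x assume U: "openin (product_topology (\<lambda>_. X) I) U \<and> x \<in> U"
    then obtain V where V: "\<And>i. i \<in> I \<Longrightarrow> openin X (V i)" "x \<in> Pi\<^sub>E I V" "Pi\<^sub>E I V \<subseteq> U"
      using openin_product_topologyE[OF conjunct1[OF U] conjunct2[OF U]] by blast
    then have "\<forall>i\<in>I. \<exists>W\<in>B. x i \<in> W \<and> W \<subseteq> V i" using B(3) by (simp add: PiE_iff)
    then have "\<forall>i\<in>I. \<exists>W. W \<in> B \<and> x i \<in> W \<and> W \<subseteq> V i" by blast
    then have "\<exists>W. \<forall>i\<in>I. W i \<in> B \<and> x i \<in> W i \<and> W i \<subseteq> V i" by (rule bchoice)
    then obtain W where W: "\<And>i. i \<in> I \<Longrightarrow> W i \<in> B \<and> x i \<in> W i \<and> W i \<subseteq> V i" by blast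
    have "Pi\<^sub>E I (restrict W I) \<subseteq> Pi\<^sub>E I V" using W by (intro PiE_mono) auto
    then have "Pi\<^sub>E I (restrict W I) \<subseteq> U" using V(3) by (rule subset_trans)
    moreover have "x \<in> Pi\<^sub>E I (restrict W I)" using V(2) W by (auto simp: PiE_iff)
    moreover have "restrict W I \<in> I \<rightarrow>\<^sub>E B" using W by auto
    ultimately show "\<exists>V\<in>Pi\<^sub>E I ` (I \<rightarrow>\<^sub>E B). x \<in> V \<and> V \<subseteq> U"
      by (intro bexI[of _ "Pi\<^sub>E I (restrict W I)"] conjI imageI)
  qed
qed

lemma sets_pair_borel_of:
  assumes h: "sets h = sets (borel_of X)" and k: "sets k = sets (borel_of Y)"
    and X: "second_countable X" and Y: "second_countable Y"
  shows "sets (h \<Otimes>\<^sub>M k) = sets (borel_of (prod_topology X Y))" (is "_ = sets ?P")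
proof
  have sp: "space h = topspace X" "space k = topspace Y"
    using sets_eq_imp_space_eq[OF h] sets_eq_imp_space_eq[OF k] by simp_all
  show "sets (h \<Otimes>\<^sub>M k) \<subseteq> sets ?P"
  proof
    fix A assume A: "A \<in> sets (h \<Otimes>\<^sub>M k)"
    have "fst \<in> ?P \<rightarrow>\<^sub>M h" "snd \<in> ?P \<rightarrow>\<^sub>M k"
      unfolding measurable_cong_sets[OF refl h] measurable_cong_sets[OF refl k]
      by (intro continuous_map_measurable_borel_of continuous_map_fst continuous_map_snd)+
    then have "(\<lambda>x. (fst x, snd x)) \<in> ?P \<rightarrow>\<^sub>M (h \<Otimes>\<^sub>M k)" by (rule measurable_Pair)
    from measurable_sets[OF this A] have "A \<inter> space ?P \<in> sets ?P" by simp
    moreover have "A \<subseteq> space ?P" using sets.sets_into_space[OF A] by (simp add: space_pair_measure sp)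
    ultimately show "A \<in> sets ?P" by (simp add: Int_absorb2)
  qed
  obtain B where B: "countable B" "\<And>V. V \<in> B \<Longrightarrow> openin X V"
      "\<And>U x. openin X U \<Longrightarrow> x \<in> U \<Longrightarrow> \<exists>V\<in>B. x \<in> V \<and> V \<subseteq> U"
    by (rule second_countableE[OF X]) (rule that)
  obtain C where C: "countable C" "\<And>V. V \<in> C \<Longrightarrow> openin Y V"
      "\<And>U x. openin Y U \<Longrightarrow> x \<in> U \<Longrightarrow> \<exists>V\<in>C. x \<in> V \<and> V \<subseteq> U"
    by (rule second_countableE[OF Y]) (rule that)
  have "U \<in> sets (h \<Otimes>\<^sub>M k)" if U: "openin (prod_topology X Y) U" for U
  proof -
    define \<W> where "\<W> = {W \<in> B \<times> C. fst W \<times> snd W \<subseteq> U}"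
    have "countable (B \<times> C)" using B(1) C(1) by simp
    then have "countable \<W>" by (rule countable_subset[rotated]) (auto simp: \<W>_def)
    moreover have "fst W \<times> snd W \<in> sets (h \<Otimes>\<^sub>M k)" if "W \<in> \<W>" for W
      using that by (intro pair_measureI) (auto simp: \<W>_def h k intro!: openin_in_borel_of B(2) C(2))
    ultimately have "(\<Union>W\<in>\<W>. fst W \<times> snd W) \<in> sets (h \<Otimes>\<^sub>M k)"
      by (intro sets.countable_UN') auto
    moreover have "U = (\<Union>W\<in>\<W>. fst W \<times> snd W)"
    proof
      show "U \<subseteq> (\<Union>W\<in>\<W>. fst W \<times> snd W)"
      proof
        fix z assume "z \<in> U"
        then have "(fst z, snd z) \<in> U" by simp
        then have "\<exists>V V'. openin X V \<and> openin Y V' \<and> fst z \<in> V \<and> snd z \<in> V' \<and> V \<times> V' \<subseteq> U"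
          by (rule U[unfolded openin_prod_topology_alt, rule_format])
        then obtain V V' where V: "openin X V" "openin Y V'" "fst z \<in> V" "snd z \<in> V'" "V \<times> V' \<subseteq> U"
          by blast
        then obtain W W' where W: "W \<in> B" "fst z \<in> W" "W \<subseteq> V" "W' \<in> C" "snd z \<in> W'" "W' \<subseteq> V'"
          using B(3)[OF V(1,3)] C(3)[OF V(2,4)] by blast
        then have "(W, W') \<in> \<W>" using V(5) by (auto simp: \<W>_def)
        moreover have "z \<in> fst (W, W') \<times> snd (W, W')" using W by (simp add: mem_Times_iff)
        ultimately show "z \<in> (\<Union>W\<in>\<W>. fst W \<times> snd W)" by blast
      qed
    qed (auto simp: \<W>_def)
    ultimately show ?thesis by simp
  qed
  note * = this
  have "{U. openin (prod_topology X Y) U} \<subseteq> sets (h \<Otimes>\<^sub>M k)" using * by blast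
  then show "sets ?P \<subseteq> sets (h \<Otimes>\<^sub>M k)"
    unfolding sets_borel_of by (rule sets.sigma_sets_subset'[OF _ *[OF openin_topspace]])
qed

lemma haar_measure_space:
  assumes "haar_measure G T h" shows "space h = carrier G" "space h = topspace T"
  using assms sets_eq_imp_space_eq[of h "borel_of T"] by (auto simp: haar_measure_def)

lemma haar_measure_PiM:
  assumes I: "finite I" and H: "haar_measure G X h" and sf: "sigma_finite_measure h"
    and X: "second_countable X" and T2: "Hausdorff_space X"
  shows "haar_measure (product_group I (\<lambda>_. G)) (product_topology (\<lambda>_. X) I) (PiM I (\<lambda>_. h))"
    (is "haar_measure ?G ?T ?h")
proof -
  interpret product_sigma_finite "\<lambda>_. h" by (simp add: product_sigma_finite_def sf)
  interpret sigma_finite_measure h by fact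
  note sp = haar_measure_space[OF H]
  have sh: "sets h = sets (borel_of X)" and tX: "topspace X = carrier G"
    using H by (auto simp: haar_measure_def)
  have inv: "(\<lambda>x. a \<otimes>\<^bsub>G\<^esub> x) \<in> h \<rightarrow>\<^sub>M h" "distr h h (\<lambda>x. a \<otimes>\<^bsub>G\<^esub> x) = h" if "a \<in> carrier G" for a
    using H that by (auto simp: haar_measure_def)
  show ?thesis
    unfolding haar_measure_def
  proof (intro conjI ballI allI impI)
    show "topspace ?T = carrier ?G" by (simp add: tX)
    show S: "sets ?h = sets (borel_of ?T)" by (rule sets_PiM_borel_of[OF I sh X])
    show m: "(\<lambda>x. g \<otimes>\<^bsub>?G\<^esub> x) \<in> ?h \<rightarrow>\<^sub>M ?h" if g: "g \<in> carrier ?G" for g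
      unfolding mult_product_group
    proof (rule measurable_restrict)
      fix i assume i: "i \<in> I"
      then have "g i \<in> carrier G" using g by auto
      from measurable_compose[OF measurable_component_singleton[OF i, of "\<lambda>_. h"] inv(1)[OF this]]
      show "(\<lambda>x. g i \<otimes>\<^bsub>G\<^esub> x i) \<in> ?h \<rightarrow>\<^sub>M h" .
    qed
    show "distr ?h ?h (\<lambda>x. g \<otimes>\<^bsub>?G\<^esub> x) = ?h" if g: "g \<in> carrier ?G" for g
    proof (rule PiM_eqI[OF I])
      fix A assume A: "\<And>i. i \<in> I \<Longrightarrow> A i \<in> sets h"
      let ?A = "\<lambda>i. (\<lambda>x. g i \<otimes>\<^bsub>G\<^esub> x) -` A i \<inter> space h"
      have gi: "g i \<in> carrier G" if "i \<in> I" for i using g that by auto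
      have "emeasure (distr ?h ?h (\<lambda>x. g \<otimes>\<^bsub>?G\<^esub> x)) (Pi\<^sub>E I A) =
            emeasure ?h ((\<lambda>x. g \<otimes>\<^bsub>?G\<^esub> x) -` Pi\<^sub>E I A \<inter> space ?h)"
        using A by (intro emeasure_distr[OF m[OF g]] sets_PiM_I_finite I) auto
      also have "(\<lambda>x. g \<otimes>\<^bsub>?G\<^esub> x) -` Pi\<^sub>E I A \<inter> space ?h = Pi\<^sub>E I ?A"
        by (auto simp: space_PiM PiE_iff extensional_def)
      also have "emeasure ?h (Pi\<^sub>E I ?A) = (\<Prod>i\<in>I. emeasure h (?A i))"
        using A by (intro emeasure_PiM I measurable_sets[OF inv(1)] gi) auto
      also have "\<dots> = (\<Prod>i\<in>I. emeasure h (A i))"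
      proof (rule prod.cong)
        fix i assume i: "i \<in> I"
        have "emeasure h (?A i) = emeasure (distr h h (\<lambda>x. g i \<otimes>\<^bsub>G\<^esub> x)) (A i)"
          using emeasure_distr[OF inv(1)[OF gi[OF i]] A[OF i]] by simp
        then show "emeasure h (?A i) = emeasure h (A i)" using inv(2)[OF gi[OF i]] by simp
      qed simp
      finally show "emeasure (distr ?h ?h (\<lambda>x. g \<otimes>\<^bsub>?G\<^esub> x)) (Pi\<^sub>E I A) = (\<Prod>i\<in>I. emeasure h (A i))" .
    qed simp
    show "emeasure ?h K < \<infinity>" if K: "compactin ?T K" for K
    proof -
      let ?K = "\<lambda>i. (\<lambda>x. x i) ` K"
      have c: "compactin X (?K i)" if "i \<in> I" for i
        by (rule image_compactin[OF K]) (use that in \<open>auto intro: continuous_map_product_projection\<close>)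
      then have s: "?K i \<in> sets h" if "i \<in> I" for i
        using that compactin_imp_closedin[OF T2] closedin_in_borel_of by (auto simp: sh)
      have "K \<subseteq> Pi\<^sub>E I ?K"
        using compactin_subset_topspace[OF K] by (auto simp: PiE_iff)
      then have "emeasure ?h K \<le> emeasure ?h (Pi\<^sub>E I ?K)"
        by (rule emeasure_mono) (rule sets_PiM_I_finite[OF I s])
      also have "\<dots> = (\<Prod>i\<in>I. emeasure h (?K i))" by (rule emeasure_PiM[OF I s])
      also have "\<dots> < \<infinity>"
        using H c by (simp add: haar_measure_def ennreal_prod_eq_top less_top[symmetric])
      finally show ?thesis .
    qed
    show "emeasure ?h (space ?h) \<noteq> 0"
    proof -
      have "emeasure ?h (space ?h) = (\<Prod>i\<in>I. emeasure h (space h))"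
        unfolding space_PiM by (rule emeasure_PiM[OF I]) auto
      then show ?thesis using H I by (simp add: haar_measure_def)
    qed
  qed
qed

lemma haar_measure_pair:
  assumes H: "haar_measure G X h" and L: "haar_measure G' Y k"
    and sfh: "sigma_finite_measure h" and sfk: "sigma_finite_measure k"
    and X: "second_countable X" "Hausdorff_space X" and Y: "second_countable Y" "Hausdorff_space Y"
  shows "haar_measure (G \<times>\<times> G') (prod_topology X Y) (h \<Otimes>\<^sub>M k)"
proof -
  interpret k: sigma_finite_measure k by fact
  note sp = haar_measure_space[OF H] haar_measure_space[OF L]
  have sh: "sets h = sets (borel_of X)" "topspace X = carrier G"
    and sk: "sets k = sets (borel_of Y)" "topspace Y = carrier G'"
    using H L by (auto simp: haar_measure_def)
  have inv: "(\<lambda>x. a \<otimes>\<^bsub>G\<^esub> x) \<in> h \<rightarrow>\<^sub>M h" "distr h h (\<lambda>x. a \<otimes>\<^bsub>G\<^esub> x) = h" if "a \<in> carrier G" for a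
    using H that by (auto simp: haar_measure_def)
  have inv': "(\<lambda>x. a \<otimes>\<^bsub>G'\<^esub> x) \<in> k \<rightarrow>\<^sub>M k" "distr k k (\<lambda>x. a \<otimes>\<^bsub>G'\<^esub> x) = k" if "a \<in> carrier G'" for a
    using L that by (auto simp: haar_measure_def)
  have mult: "(\<lambda>x. g \<otimes>\<^bsub>G \<times>\<times> G'\<^esub> x) = (\<lambda>(x, y). (fst g \<otimes>\<^bsub>G\<^esub> x, snd g \<otimes>\<^bsub>G'\<^esub> y))" for g
    by (auto simp: mult_DirProd' fun_eq_iff)
  show ?thesis
    unfolding haar_measure_def
  proof (intro conjI ballI allI impI)
    show "topspace (prod_topology X Y) = carrier (G \<times>\<times> G')" by (simp add: sh sk)
    show "sets (h \<Otimes>\<^sub>M k) = sets (borel_of (prod_topology X Y))"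
      by (rule sets_pair_borel_of) (use sh sk X Y in auto)
  next
    fix g assume "g \<in> carrier (G \<times>\<times> G')"
    then have g: "fst g \<in> carrier G" "snd g \<in> carrier G'" by auto
    note [measurable] = inv(1)[OF g(1)] inv'(1)[OF g(2)]
    show "(\<lambda>x. g \<otimes>\<^bsub>G \<times>\<times> G'\<^esub> x) \<in> h \<Otimes>\<^sub>M k \<rightarrow>\<^sub>M h \<Otimes>\<^sub>M k"
      unfolding mult by measurable
    show "distr (h \<Otimes>\<^sub>M k) (h \<Otimes>\<^sub>M k) (\<lambda>x. g \<otimes>\<^bsub>G \<times>\<times> G'\<^esub> x) = h \<Otimes>\<^sub>M k"
      using pair_measure_distr[OF inv(1)[OF g(1)] inv'(1)[OF g(2)]] sfk
      unfolding mult by (simp add: inv(2)[OF g(1)] inv'(2)[OF g(2)])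
  next
    fix K assume K: "compactin (prod_topology X Y) K"
    have c: "compactin X (fst ` K)" "compactin Y (snd ` K)"
      using image_compactin[OF K continuous_map_fst] image_compactin[OF K continuous_map_snd] by auto
    then have s: "fst ` K \<in> sets h" "snd ` K \<in> sets k"
      using c[THEN compactin_imp_closedin[rotated]] X(2) Y(2) by (auto simp: sh(1) sk(1) intro: closedin_in_borel_of)
    have "emeasure (h \<Otimes>\<^sub>M k) K \<le> emeasure (h \<Otimes>\<^sub>M k) (fst ` K \<times> snd ` K)"
      using s by (intro emeasure_mono) (auto simp: subset_fst_snd)
    also have "\<dots> = emeasure h (fst ` K) * emeasure k (snd ` K)"
      by (rule k.emeasure_pair_measure_Times[OF s])
    also have "\<dots> < \<infinity>"
      using H L c by (simp add: haar_measure_def ennreal_mult_less_top)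
    finally show "emeasure (h \<Otimes>\<^sub>M k) K < \<infinity>" .
  next
    have "emeasure (h \<Otimes>\<^sub>M k) (space (h \<Otimes>\<^sub>M k)) = emeasure h (space h) * emeasure k (space k)"
      unfolding space_pair_measure by (rule k.emeasure_pair_measure_Times) auto
    then show "emeasure (h \<Otimes>\<^sub>M k) (space (h \<Otimes>\<^sub>M k)) \<noteq> 0"
      using H L by (simp add: haar_measure_def)
  qed
qed

lemma second_countable_euclidean: "second_countable (euclidean :: 'a::second_countable_topology topology)"
proof -
  obtain B :: "'a set set" where "countable B" "topological_basis B"
    using ex_countable_basis by blast
  note B = this
  have "\<exists>V\<in>B. x \<in> V \<and> V \<subseteq> U" if "open U" "x \<in> U" for U x
    by (rule topological_basisE[OF B(2) that]) blast
  then show ?thesis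
    unfolding second_countable_def using B(1) topological_basis_open[OF B(2)]
    by (intro exI[of _ B]) simp
qed

lemma haar_measure_lborel: "haar_measure real_group euclideanreal lborel"
  unfolding haar_measure_def
proof (intro conjI ballI allI impI)
  show "distr lborel lborel (\<lambda>x. g \<otimes>\<^bsub>real_group\<^esub> x) = lborel" for g
    using lborel_distr_plus[of g] by (simp add: real_group_def cong: distr_cong)
  show "emeasure lborel K < \<infinity>" if "compactin euclideanreal K" for K
    using that emeasure_compact_finite by (simp add: less_top[symmetric])
qed (auto simp: real_group_def sets_borel_of_euclidean)

lemma circle_topology_props:
  "topspace circle_topology = sphere 0 1" "second_countable circle_topology" "Hausdorff_space circle_topology"
  unfolding circle_topology_def
  by (auto intro: second_countable_subtopology second_countable_euclidean Hausdorff_space_subtopology)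

lemma measurable_cis_circle [measurable]: "(\<lambda>t. cis (2 * pi * t)) \<in> borel \<rightarrow>\<^sub>M borel_of circle_topology"
proof -
  have "continuous_map euclideanreal circle_topology (\<lambda>t. cis (2 * pi * t))"
    unfolding circle_topology_def
    by (auto simp: continuous_map_in_subtopology intro!: continuous_intros)
  from continuous_map_measurable_borel_of[OF this] show ?thesis
    by (simp add: measurable_cong_sets[OF sets_borel_of_euclidean refl])
qed

lemma emeasure_circle_haar:
  assumes "A \<in> sets (borel_of circle_topology)"
  shows "emeasure circle_haar A = (\<integral>\<^sup>+t. indicator A (cis (2 * pi * t)) * indicator {0..<1} t \<partial>lborel)"
proof -
  have "emeasure circle_haar A = (\<integral>\<^sup>+z. indicator A z \<partial>circle_haar)"
    using assms by (subst nn_integral_indicator) (simp_all add: circle_haar_def)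
  also have "\<dots> = (\<integral>\<^sup>+t. indicator A (cis (2 * pi * t)) \<partial>restrict_space lborel {0..<1})"
    unfolding circle_haar_def using assms
    by (intro nn_integral_distr) (auto intro!: measurable_restrict_space1)
  finally show ?thesis by (simp add: nn_integral_restrict_space)
qed

lemma haar_measure_circle: "haar_measure circle_group circle_topology circle_haar"
    and sigma_finite_circle_haar: "sigma_finite_measure circle_haar"
proof -
  have S: "sets circle_haar = sets (borel_of circle_topology)" by (simp add: circle_haar_def)
  have sp: "space circle_haar = sphere 0 1" by (simp add: circle_haar_def circle_topology_props)
  have total: "emeasure circle_haar (space circle_haar) = 1"
  proof -
    have "indicator (sphere 0 1) (cis (2 * pi * t)) = (1::ennreal)" for t by simp
    moreover have "sphere 0 1 \<in> sets (borel_of circle_topology)"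
      using sets.top[of circle_haar] sp S by simp
    ultimately show ?thesis by (simp add: sp emeasure_circle_haar)
  qed
  interpret finite_measure circle_haar by standard (simp add: total)
  show "sigma_finite_measure circle_haar" by unfold_locales
  have mult: "(\<lambda>z. g * z) \<in> circle_haar \<rightarrow>\<^sub>M circle_haar" if "g \<in> sphere 0 1" for g
  proof -
    have "continuous_map circle_topology circle_topology (\<lambda>z. g * z)"
      using that unfolding circle_topology_def
      by (auto simp: continuous_map_in_subtopology norm_mult intro!: continuous_intros continuous_map_from_subtopology)
    from continuous_map_measurable_borel_of[OF this] show ?thesis
      by (simp add: measurable_cong_sets[OF S S])
  qed
  have inv: "distr circle_haar circle_haar (\<lambda>z. g * z) = circle_haar" if g: "g \<in> sphere 0 1" for g
  proof (rule measure_eqI)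
    fix A assume "A \<in> sets (distr circle_haar circle_haar (\<lambda>z. g * z))"
    then have A: "A \<in> sets circle_haar" by simp
    then have A': "A \<in> sets (borel_of circle_topology)" by (simp add: S)
    have gn: "cmod g = 1" using g by simp
    define \<theta> where "\<theta> = frac (Arg g / (2 * pi))"
    have \<theta>: "0 \<le> \<theta>" "\<theta> < 1" unfolding \<theta>_def by (simp_all add: frac_lt_1)
    have g\<theta>: "g = cis (2 * pi * \<theta>)"
    proof -
      have "2 * pi * \<theta> = Arg g - 2 * pi * of_int \<lfloor>Arg g / (2 * pi)\<rfloor>"
        by (simp add: \<theta>_def frac_def right_diff_distrib)
      then have "cis (2 * pi * \<theta>) = cis (Arg g) / cis (2 * pi * of_int \<lfloor>Arg g / (2 * pi)\<rfloor>)"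
        by (simp only: cis_divide)
      also have "\<dots> = cis (Arg g)" by (subst cis_multiple_2pi) auto
      also have "\<dots> = g" using g by (subst cis_Arg) (auto simp: sgn_div_norm)
      finally show ?thesis by simp
    qed
    define f :: "real \<Rightarrow> ennreal" where "f t = indicator A (cis (2 * pi * t))" for t
    have f [measurable]: "f \<in> borel_measurable borel"
      unfolding f_def using A' by measurable
    have period: "f (t + 1) = f t" for t
    proof -
      have "cis (2 * pi * (t + 1)) = cis (2 * pi * t) * cis (2 * pi)"
        by (simp only: cis_mult) (simp add: algebra_simps)
      then show ?thesis by (simp add: f_def)
    qed
    have rot: "cis (2 * pi * (\<theta> + t)) = g * cis (2 * pi * t)" for t
      unfolding g\<theta> by (simp only: cis_mult) (simp add: algebra_simps)
    have "emeasure (distr circle_haar circle_haar (\<lambda>z. g * z)) A =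
          emeasure circle_haar ((\<lambda>z. g * z) -` A \<inter> space circle_haar)"
      by (rule emeasure_distr[OF mult[OF g] A])
    also have "\<dots> = (\<integral>\<^sup>+t. indicator ((\<lambda>z. g * z) -` A \<inter> space circle_haar) (cis (2 * pi * t)) * indicator {0..<1} t \<partial>lborel)"
      using measurable_sets[OF mult[OF g] A] by (intro emeasure_circle_haar) (simp add: S)
    also have "\<dots> = (\<integral>\<^sup>+t. f (\<theta> + t) * indicator {0..<1} t \<partial>lborel)"
      by (intro nn_integral_cong) (simp add: f_def rot sp norm_mult gn indicator_def)
    also have "\<dots> = (\<integral>\<^sup>+t. f (\<theta> + t) * indicator {\<theta>..<\<theta> + 1} (\<theta> + t) \<partial>lborel)"
      by (intro nn_integral_cong) (auto simp: indicator_def)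
    also have "\<dots> = (\<integral>\<^sup>+t. f t * indicator {\<theta>..<\<theta> + 1} t \<partial>distr lborel borel ((+) \<theta>))"
      by (subst nn_integral_distr) auto
    also have "\<dots> = (\<integral>\<^sup>+t. f t * indicator {\<theta>..<1} t + f t * indicator {1..<1 + \<theta>} t \<partial>lborel)"
      unfolding lborel_distr_plus using \<theta> by (intro nn_integral_cong) (auto simp: indicator_def)
    also have "\<dots> = (\<integral>\<^sup>+t. f t * indicator {\<theta>..<1} t \<partial>lborel) + (\<integral>\<^sup>+t. f t * indicator {1..<1 + \<theta>} t \<partial>lborel)"
      by (intro nn_integral_add) auto
    also have "(\<integral>\<^sup>+t. f t * indicator {1..<1 + \<theta>} t \<partial>lborel) =
               (\<integral>\<^sup>+t. f t * indicator {1..<1 + \<theta>} t \<partial>distr lborel borel ((+) 1))"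
      unfolding lborel_distr_plus ..
    also have "\<dots> = (\<integral>\<^sup>+t. f (1 + t) * indicator {1..<1 + \<theta>} (1 + t) \<partial>lborel)"
      by (subst nn_integral_distr) auto
    also have "\<dots> = (\<integral>\<^sup>+t. f t * indicator {0..<\<theta>} t \<partial>lborel)"
    proof (intro nn_integral_cong)
      fix t :: real
      have "f (1 + t) = f t" using period[of t] by (simp only: add.commute)
      then show "f (1 + t) * indicator {1..<1 + \<theta>} (1 + t) = f t * indicator {0..<\<theta>} t"
        by (simp add: indicator_def)
    qed
    also have "(\<integral>\<^sup>+t. f t * indicator {\<theta>..<1} t \<partial>lborel) + (\<integral>\<^sup>+t. f t * indicator {0..<\<theta>} t \<partial>lborel) =
               (\<integral>\<^sup>+t. f t * indicator {\<theta>..<1} t + f t * indicator {0..<\<theta>} t \<partial>lborel)"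
      by (intro nn_integral_add[symmetric]) auto
    also have "\<dots> = (\<integral>\<^sup>+t. f t * indicator {0..<1} t \<partial>lborel)"
      using \<theta> by (intro nn_integral_cong) (auto simp: indicator_def)
    also have "\<dots> = emeasure circle_haar A"
      by (simp add: emeasure_circle_haar[OF A'] f_def)
    finally show "emeasure (distr circle_haar circle_haar (\<lambda>z. g * z)) A = emeasure circle_haar A" .
  qed simp
  show "haar_measure circle_group circle_topology circle_haar"
    unfolding haar_measure_def
    using mult inv S total emeasure_finite
    by (auto simp: circle_group_def circle_topology_props less_top[symmetric])
qed

theorem haar_measure_torus: "haar_measure (torus_group k) (torus_topology k) (torus_haar k)"
  unfolding torus_group_def torus_topology_def torus_haar_def
  by (intro haar_measure_PiM haar_measure_circle sigma_finite_circle_haar circle_topology_props finite_lessThan)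

theorem haar_measure_euclidean_torus:
  "haar_measure (euclidean_torus_group n m) (euclidean_torus_topology n m) (euclidean_torus_haar n m)"
proof -
  interpret R: product_sigma_finite "\<lambda>_::nat. lborel :: real measure" by (simp add: product_sigma_finite_def sigma_finite_lborel)
  interpret C: product_sigma_finite "\<lambda>_::nat. circle_haar" by (simp add: product_sigma_finite_def sigma_finite_circle_haar)
  show ?thesis
    unfolding euclidean_torus_group_def euclidean_torus_topology_def euclidean_torus_haar_def
    by (intro haar_measure_pair haar_measure_torus haar_measure_PiM haar_measure_lborel
          sigma_finite_lborel second_countable_power second_countable_euclidean
          R.sigma_finite finite_lessThan)
       (auto simp: torus_topology_def torus_haar_def Hausdorff_space_product_topology
          intro: C.sigma_finite second_countable_power circle_topology_props)
qed


section \<open>The quotient map\<close>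

lemma torus_quotient_map_hom:
  "torus_quotient_map n m \<in> hom (euclidean_torus_group n m) (torus_group (n + m))"
proof (rule homI)
  fix p assume "p \<in> carrier (euclidean_torus_group n m)"
  then have "cmod (snd p i) = 1" if "i < m" for i
    using that by (auto simp: euclidean_torus_group_def torus_group_def circle_group_def)
  then show "torus_quotient_map n m p \<in> carrier (torus_group (n + m))"
    by (auto simp: torus_quotient_map_def torus_group_def circle_group_def split: prod.split)
next
  fix p p'
  have "cis (2 * pi * (s + t)) = cis (2 * pi * s) * cis (2 * pi * t)" for s t
    by (simp only: cis_mult distrib_left)
  moreover have "i - n < m" if "i < n + m" "\<not> i < n" for i
    using that by arith
  ultimately show "torus_quotient_map n m (p \<otimes>\<^bsub>euclidean_torus_group n m\<^esub> p') =
      torus_quotient_map n m p \<otimes>\<^bsub>torus_group (n + m)\<^esub> torus_quotient_map n m p'"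
    by (cases p; cases p')
       (simp add: torus_quotient_map_def euclidean_torus_group_def torus_group_def
          real_group_def circle_group_def fun_eq_iff)
qed

lemma torus_quotient_map_surj:
  "torus_quotient_map n m ` carrier (euclidean_torus_group n m) = carrier (torus_group (n + m))"
proof
  show "torus_quotient_map n m ` carrier (euclidean_torus_group n m) \<subseteq> carrier (torus_group (n + m))"
    using torus_quotient_map_hom by (auto simp: hom_def)
  show "carrier (torus_group (n + m)) \<subseteq> torus_quotient_map n m ` carrier (euclidean_torus_group n m)"
  proof
    fix w assume w: "w \<in> carrier (torus_group (n + m))"
    let ?x = "\<lambda>i\<in>{..<n}. Arg (w i) / (2 * pi)" and ?z = "\<lambda>i\<in>{..<m}. w (n + i)"
    have nw: "cmod (w i) = 1" if "i < n + m" for i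
      using w that by (auto simp: torus_group_def circle_group_def PiE_iff)
    have "cis (Arg (w i)) = w i" if "i < n" for i
      using nw[of i] that by (subst cis_Arg) (auto simp: sgn_div_norm)
    then have "torus_quotient_map n m (?x, ?z) = w"
      using w by (auto simp: torus_quotient_map_def fun_eq_iff torus_group_def PiE_iff extensional_def)
    moreover have "(?x, ?z) \<in> carrier (euclidean_torus_group n m)"
      using nw by (auto simp: euclidean_torus_group_def torus_group_def real_group_def circle_group_def)
    ultimately show "w \<in> torus_quotient_map n m ` carrier (euclidean_torus_group n m)" by force
  qed
qed

lemma torus_quotient_map_kernel:
  "kernel (euclidean_torus_group n m) (torus_group (n + m)) (torus_quotient_map n m) =
     ({..<n} \<rightarrow>\<^sub>E \<int>) \<times> {\<lambda>i\<in>{..<m}. 1}"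
proof -
  have c: "cis (2 * pi * t) = 1 \<longleftrightarrow> t \<in> \<int>" for t
  proof
    assume "cis (2 * pi * t) = 1"
    then have "cos (2 * pi * t) = 1" by (simp add: complex_eq_iff)
    then obtain k :: int where "2 * pi * t = of_int k * 2 * pi" by (auto simp: cos_one_2pi_int)
    then have "t = of_int k" by simp
    then show "t \<in> \<int>" by simp
  qed (auto elim!: Ints_cases simp: cis_multiple_2pi)
  have "torus_quotient_map n m (x, z) = (\<lambda>i\<in>{..<n + m}. 1) \<longleftrightarrow> (\<forall>i<n. x i \<in> \<int>) \<and> (\<forall>i<m. z i = 1)" for x z
  proof
    assume *: "torus_quotient_map n m (x, z) = (\<lambda>i\<in>{..<n + m}. 1)"
    have "x i \<in> \<int>" if "i < n" for i
      using fun_cong[OF *, of i] that by (simp add: torus_quotient_map_def c)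
    moreover have "z i = 1" if "i < m" for i
      using fun_cong[OF *, of "n + i"] that by (simp add: torus_quotient_map_def)
    ultimately show "(\<forall>i<n. x i \<in> \<int>) \<and> (\<forall>i<m. z i = 1)" by blast
  qed (auto simp: torus_quotient_map_def fun_eq_iff c)
  then have *: "(x, z) \<in> kernel (euclidean_torus_group n m) (torus_group (n + m)) (torus_quotient_map n m) \<longleftrightarrow>
      x \<in> extensional {..<n} \<and> z \<in> {..<m} \<rightarrow>\<^sub>E sphere 0 1 \<and> (\<forall>i<n. x i \<in> \<int>) \<and> (\<forall>i<m. z i = 1)" for x z
    by (simp add: kernel_def torus_group_def euclidean_torus_group_def circle_group_def real_group_def PiE_iff)
  have **: "z \<in> {..<m} \<rightarrow>\<^sub>E sphere 0 1 \<and> (\<forall>i<m. z i = 1) \<longleftrightarrow> z = (\<lambda>i\<in>{..<m}. 1)" for z :: "nat \<Rightarrow> complex"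
    by (auto simp: PiE_iff fun_eq_iff extensional_def)
  show ?thesis
  proof (rule Set.set_eqI)
    fix p :: "(nat \<Rightarrow> real) \<times> (nat \<Rightarrow> complex)"
    obtain x z where p: "p = (x, z)" by (cases p)
    show "p \<in> kernel (euclidean_torus_group n m) (torus_group (n + m)) (torus_quotient_map n m) \<longleftrightarrow>
        p \<in> ({..<n} \<rightarrow>\<^sub>E \<int>) \<times> {\<lambda>i\<in>{..<m}. 1}"
      unfolding p * mem_Sigma_iff singleton_iff **[symmetric] by (auto simp: PiE_iff)
  qed
qed

end

theory Submission
  imports Defs
begin

text \<open>
  Let \<open>q: G \<rightarrow> H\<close> be the quotient map and \<open>s: H \<rightarrow> G\<close> a Borel section of it. Fourier transforms are avoided:
  measures are transported in both directions by linear maps that do not increase the norm of the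
  convolution operator on \<open>L\<^sup>2\<close>. A measure \<open>\<sigma>\<close> on \<open>H\<close> is lifted to the image of \<open>\<sigma> \<otimes> haar\<close> under
  \<open>\<tau> x k = s k \<cdot> (s (x\<inverse> k))\<inverse>\<close>, which lies over \<open>x\<close>; convolution with the lift is an average over \<open>k\<close> of
  convolutions with \<open>\<sigma>\<close> applied to the slices \<open>x \<mapsto> \<xi> (s x \<cdot> u)\<close>, so the Cauchy-Schwarz inequality and
  Fubini's theorem bound its norm. A measure \<open>\<mu>\<close> on \<open>G\<close> is multiplied by the matrix coefficient
  \<open>\<phi> a\<close> of the regular representation given by a small cube \<open>W\<close> and its translate, and then pushed
  forward to \<open>H\<close>; the same argument, a form of Fell's absorption principle, bounds the norm. Both maps
  send absolutely continuous measures to absolutely continuous ones and respect supports, so they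
  preserve membership of the convolution operator in the reduced group C*-algebra. Nothing is lost
  because the average of \<open>\<phi> a\<close> over \<open>a\<close> is a positive constant and \<open>q\<close> is injective on the set where
  \<open>\<phi> a\<close> does not vanish.
\<close>


section \<open>Complex measures and their densities\<close>

text \<open>The two obvious ways to move a measure fail. Push-forward along \<open>q\<close> loses
  information: on the line, the difference of the unit masses at 0 and 1 goes to 0. Push-forward
  along \<open>s\<close> is injective, but it cuts the periodic extension of the measure with the
  indicator of a fundamental domain, and such a sharp cut does not control the norm of the
  convolution operator. The remedy is the same in both directions, a weight that is a matrix
  coefficient. For the lift it is |Q \<inter> y Q| at the point y, where \<open>Q\<close> is the
  range of \<open>s\<close>; these weights sum to 1 along every fibre of \<open>q\<close>. A matrix
  coefficient is an average of products of two indicator functions, and one of the two can be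
  absorbed into the function on which the operator acts; hence the norm does not grow. Non-vanishing
  is followed on the level of operators: a transported operator that is 0 (for all \<open>a\<close>,
  in the second direction) forces the original operator to be 0.\<close>

locale signed_measure =
  fixes M :: "'a measure" and \<nu> :: "'a set \<Rightarrow> real"
  assumes sums: "\<And>A :: nat \<Rightarrow> 'a set. range A \<subseteq> sets M \<Longrightarrow> disjoint_family A \<Longrightarrow>
    (\<lambda>i. \<nu> (A i)) sums \<nu> (\<Union>i. A i)"
begin

lemma empty: "\<nu> {} = 0"
proof -
  have "summable (\<lambda>i::nat. \<nu> {})"
    using sums[of "\<lambda>_. {}"] by (auto simp: disjoint_family_on_def sums_iff)
  then have "(\<lambda>i::nat. \<nu> {}) \<longlonglongrightarrow> 0" by (rule summable_LIMSEQ_zero)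
  then show ?thesis by (simp add: LIMSEQ_const_iff)
qed

lemma Un:
  assumes "A \<in> sets M" "B \<in> sets M" "A \<inter> B = {}"
  shows "\<nu> (A \<union> B) = \<nu> A + \<nu> B"
proof -
  have "(\<lambda>i. \<nu> (binaryset A B i)) sums \<nu> (\<Union>i. binaryset A B i)"
    using assms by (intro sums) (auto simp: binaryset_def disjoint_family_on_def)
  moreover have "(\<lambda>i. \<nu> (binaryset A B i)) sums (\<nu> A + \<nu> B)"
    by (rule binaryset_sums) (rule empty)
  ultimately show ?thesis by (simp add: UN_binaryset_eq sums_iff)
qed

lemma Diff:
  assumes "A \<in> sets M" "B \<in> sets M" "B \<subseteq> A"
  shows "\<nu> (A - B) = \<nu> A - \<nu> B"
  using Un[of "A - B" B] assms by (simp add: Un_absorb2 Diff_Int_distrib2 Int_commute)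

text \<open>The set function inside \<open>positive_part\<close>. It is studied by itself first,
  because \<open>measure_of\<close> returns the intended values only once countable additivity is
  known.\<close>

definition sup_mass :: "'a set \<Rightarrow> ennreal" where
  "sup_mass A = (SUP B\<in>{B \<in> sets M. B \<subseteq> A}. ennreal (\<nu> B))"

lemma sup_mass_upper: "B \<in> sets M \<Longrightarrow> B \<subseteq> A \<Longrightarrow> ennreal (\<nu> B) \<le> sup_mass A"
  unfolding sup_mass_def by (rule SUP_upper) auto

lemma sup_mass_mono: "A \<subseteq> B \<Longrightarrow> sup_mass A \<le> sup_mass B"
  unfolding sup_mass_def by (rule SUP_subset_mono) auto

lemma sup_mass_Un:
  assumes A: "A \<in> sets M" and B: "B \<in> sets M" and AB: "A \<inter> B = {}"
  shows "sup_mass (A \<union> B) = sup_mass A + sup_mass B"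
proof (rule antisym)
  show "sup_mass (A \<union> B) \<le> sup_mass A + sup_mass B"
    unfolding sup_mass_def[of "A \<union> B"]
  proof (rule SUP_least, clarify)
    fix C assume C: "C \<in> sets M" "C \<subseteq> A \<union> B"
    have "C = (C \<inter> A) \<union> (C \<inter> B)" using C by auto
    then have "\<nu> C = \<nu> (C \<inter> A) + \<nu> (C \<inter> B)"
      using Un[of "C \<inter> A" "C \<inter> B"] A B C AB by auto
    \<comment> \<open>\<open>ennreal\<close> truncates at 0, so it is only subadditive on sums of
      mixed sign; hence the case distinction.\<close>
    then have "ennreal (\<nu> C) \<le> ennreal (\<nu> (C \<inter> A)) + ennreal (\<nu> (C \<inter> B))"
      by (cases "\<nu> (C \<inter> A) \<ge> 0"; cases "\<nu> (C \<inter> B) \<ge> 0")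
         (auto simp: ennreal_plus[symmetric] ennreal_neg ennreal_leI simp del: ennreal_plus)
    also have "\<dots> \<le> sup_mass A + sup_mass B"
      using A B C by (intro add_mono sup_mass_upper) auto
    finally show "ennreal (\<nu> C) \<le> sup_mass A + sup_mass B" .
  qed
  show "sup_mass A + sup_mass B \<le> sup_mass (A \<union> B)"
  proof -
    have *: "ennreal (\<nu> C) + ennreal (\<nu> D) \<le> sup_mass (A \<union> B)"
      if "C \<in> sets M" "C \<subseteq> A" "D \<in> sets M" "D \<subseteq> B" for C D
    proof -
      have "\<nu> (C \<union> D) = \<nu> C + \<nu> D" using that AB by (intro Un) auto
      \<comment> \<open>If one of the two values is negative, its truncation is 0 and the other set
        alone is the competitor.\<close>
      moreover have "ennreal (\<nu> (C \<union> D)) \<le> sup_mass (A \<union> B)"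
        "ennreal (\<nu> C) \<le> sup_mass (A \<union> B)" "ennreal (\<nu> D) \<le> sup_mass (A \<union> B)"
        using that by (auto intro!: sup_mass_upper)
      ultimately show ?thesis
        by (cases "\<nu> C \<ge> 0"; cases "\<nu> D \<ge> 0") (auto simp: ennreal_plus[symmetric] ennreal_neg simp del: ennreal_plus)
    qed
    have ne: "{C \<in> sets M. C \<subseteq> X} \<noteq> {}" for X by auto
    have "ennreal (\<nu> C) + sup_mass B \<le> sup_mass (A \<union> B)" if "C \<in> sets M" "C \<subseteq> A" for C
      unfolding sup_mass_def[of B] ennreal_SUP_add_right[OF ne]
      by (rule SUP_least) (use that * in auto)
    then show ?thesis
      unfolding sup_mass_def[of A] ennreal_SUP_add_left[OF ne, symmetric]
      by (intro SUP_least) auto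
  qed
qed

lemma sup_mass_UN:
  assumes A: "range A \<subseteq> sets M" "disjoint_family (A :: nat \<Rightarrow> 'a set)"
  shows "(\<Sum>i. sup_mass (A i)) = sup_mass (\<Union>i. A i)"
proof (rule antisym)
  have fin: "(\<Sum>i<n. sup_mass (A i)) = sup_mass (\<Union>i<n. A i)" for n
  proof (induction n)
    case 0 show ?case by (simp add: sup_mass_def empty)
  next
    case (Suc n)
    have "A i \<inter> A n = {}" if "i < n" for i
      using disjoint_family_onD[OF A(2), of i n] that by simp
    then have d: "(\<Union>i<n. A i) \<inter> A n = {}" by blast
    have m: "(\<Union>i<n. A i) \<in> sets M" "A n \<in> sets M" using A(1) by auto
    have "(\<Union>i<Suc n. A i) = (\<Union>i<n. A i) \<union> A n" by (auto simp: less_Suc_eq)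
    then show ?case using sup_mass_Un[OF m d] Suc by simp
  qed
  show "(\<Sum>i. sup_mass (A i)) \<le> sup_mass (\<Union>i. A i)"
    by (rule suminf_le_const) (auto simp: fin intro!: sup_mass_mono)
  show "sup_mass (\<Union>i. A i) \<le> (\<Sum>i. sup_mass (A i))"
    unfolding sup_mass_def[of "\<Union>i. A i"]
  proof (rule SUP_least, clarify)
    fix B assume B: "B \<in> sets M" "B \<subseteq> (\<Union>i. A i)"
    have Beq: "(\<Union>i. B \<inter> A i) = B" using B by auto
    have "(\<lambda>i. \<nu> (B \<inter> A i)) sums \<nu> (\<Union>i. B \<inter> A i)"
      using A B by (intro sums) (auto simp: disjoint_family_on_def)
    then have s: "(\<lambda>n. \<Sum>i<n. \<nu> (B \<inter> A i)) \<longlonglongrightarrow> \<nu> B" by (simp only: Beq sums_def)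
    have "ennreal (\<Sum>i<n. \<nu> (B \<inter> A i)) \<le> (\<Sum>i. sup_mass (A i))" for n
    proof -
      have "ennreal (\<Sum>i<n. \<nu> (B \<inter> A i)) \<le> ennreal (\<Sum>i<n. max 0 (\<nu> (B \<inter> A i)))"
        by (intro ennreal_leI sum_mono) auto
      also have "\<dots> = (\<Sum>i<n. ennreal (max 0 (\<nu> (B \<inter> A i))))" by (subst sum_ennreal) auto
      also have "\<dots> \<le> (\<Sum>i<n. sup_mass (A i))"
      proof (rule sum_mono)
        fix i
        show "ennreal (max 0 (\<nu> (B \<inter> A i))) \<le> sup_mass (A i)"
          using sup_mass_upper[of "B \<inter> A i" "A i"] A B by (auto simp: max_def range_subsetD)
      qed
      also have "\<dots> \<le> (\<Sum>i. sup_mass (A i))" by (rule sum_le_suminf) auto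
      finally show ?thesis .
    qed
    moreover have "(\<lambda>n. ennreal (\<Sum>i<n. \<nu> (B \<inter> A i))) \<longlonglongrightarrow> ennreal (\<nu> B)"
      using s by (rule tendsto_ennrealI)
    ultimately show "ennreal (\<nu> B) \<le> (\<Sum>i. sup_mass (A i))"
      by (intro LIMSEQ_le_const2) auto
  qed
qed

text \<open>Otherwise one could split off infinitely many disjoint sets of mass at least 1 in absolute
  value while keeping a remainder of infinite positive mass.\<close>

lemma sup_mass_finite: "sup_mass (space M) \<noteq> \<infinity>"
proof
  assume inf: "sup_mass (space M) = \<infinity>"
  have step: "\<exists>A'. A' \<in> sets M \<and> sup_mass A' = \<infinity> \<and> A' \<subseteq> A \<and> \<bar>\<nu> (A - A')\<bar> \<ge> 1"
    if A: "A \<in> sets M" "sup_mass A = \<infinity>" for A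
  proof -
    \<comment> \<open>The bound \<bar>\<nu> A\<bar> + 1 gives both \<open>B\<close> and
      \<open>A - B\<close> a value of modulus at least 1. So whichever of the two keeps infinite
      mass, the other one can be split off.\<close>
    have "ennreal (\<bar>\<nu> A\<bar> + 1) < sup_mass A" using A by simp
    then obtain B where B: "B \<in> sets M" "B \<subseteq> A" "ennreal (\<bar>\<nu> A\<bar> + 1) < ennreal (\<nu> B)"
      unfolding sup_mass_def less_SUP_iff by auto
    have nB: "\<nu> B > \<bar>\<nu> A\<bar> + 1" using B(3) by (subst (asm) ennreal_less_iff) auto
    have d: "\<nu> (A - B) = \<nu> A - \<nu> B" using A B by (intro Diff) auto
    have "sup_mass A = sup_mass B + sup_mass (A - B)"
      using sup_mass_Un[of B "A - B"] A B by (simp add: Un_absorb1)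
    then have "sup_mass B + sup_mass (A - B) = \<infinity>" using A(2) by simp
    then consider "sup_mass B = \<infinity>" | "sup_mass (A - B) = \<infinity>" by auto
    then show ?thesis
    proof cases
      case 1 then show ?thesis using A B nB d by (intro exI[of _ B]) auto
    next
      case 2
      have "A - (A - B) = B" using B by auto
      then show ?thesis using 2 A B nB by (intro exI[of _ "A - B"]) auto
    qed
  qed
  have "\<exists>A. \<forall>n. (A n \<in> sets M \<and> sup_mass (A n) = \<infinity>) \<and> (A (Suc n) \<subseteq> A n \<and> \<bar>\<nu> (A n - A (Suc n))\<bar> \<ge> 1)"
    by (rule dependent_nat_choice) (use inf step in auto)
  then obtain A where A: "\<And>n. A n \<in> sets M" "\<And>n. A (Suc n) \<subseteq> A n" "\<And>n. \<bar>\<nu> (A n - A (Suc n))\<bar> \<ge> 1"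
    by auto
  have "decseq A" using A(2) by (rule decseq_SucI)
  have "disjoint_family (\<lambda>n. A n - A (Suc n))"
  proof -
    have "(A i - A (Suc i)) \<inter> (A j - A (Suc j)) = {}" if "i < j" for i j
      using decseqD[OF \<open>decseq A\<close>, of "Suc i" j] that by auto
    then show ?thesis unfolding disjoint_family_on_def by (metis Int_commute linorder_neqE_nat)
  qed
  then have "(\<lambda>n. \<nu> (A n - A (Suc n))) sums \<nu> (\<Union>n. A n - A (Suc n))"
    using A(1) by (intro sums) auto
  then have "(\<lambda>n. \<nu> (A n - A (Suc n))) \<longlonglongrightarrow> 0" by (intro summable_LIMSEQ_zero) (auto simp: sums_iff)
  then have "eventually (\<lambda>n. dist (\<nu> (A n - A (Suc n))) 0 < 1) sequentially" by (rule tendstoD) simp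
  then show False using A(3) by (auto simp: eventually_sequentially not_less[symmetric])
qed

lemma emeasure_positive_part:
  assumes "A \<in> sets M" shows "emeasure (positive_part M \<nu>) A = sup_mass A"
  unfolding positive_part_def sup_mass_def[symmetric]
proof (rule emeasure_measure_of_sigma)
  show "sigma_algebra (space M) (sets M)" ..
  show "positive (sets M) sup_mass" by (simp add: positive_def sup_mass_def empty)
  show "countably_additive (sets M) sup_mass" by (auto simp: countably_additive_def sup_mass_UN)
qed (rule assms)

lemma sets_positive_part [simp]: "sets (positive_part M \<nu>) = sets M"
  and space_positive_part [simp]: "space (positive_part M \<nu>) = space M"
  by (simp_all add: positive_part_def)

lemma finite_positive_part: "finite_measure (positive_part M \<nu>)"
  by standard (use sup_mass_finite in \<open>simp add: emeasure_positive_part\<close>)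

lemma absolutely_continuous_positive_part:
  assumes "sets h = sets M" "\<And>A. A \<in> null_sets h \<Longrightarrow> \<nu> A = 0"
  shows "absolutely_continuous h (positive_part M \<nu>)"
  unfolding absolutely_continuous_def
proof
  fix A assume A: "A \<in> null_sets h"
  have "\<nu> B = 0" if "B \<in> sets M" "B \<subseteq> A" for B
    using assms that A by (intro assms(2)) (auto intro: null_sets_subset)
  then have "sup_mass A = 0" unfolding sup_mass_def by (auto intro!: antisym SUP_least)
  then show "A \<in> null_sets (positive_part M \<nu>)"
    using A assms by (auto simp: null_sets_def emeasure_positive_part)
qed

end

lemma signed_measure_uminus: "signed_measure M \<nu> \<Longrightarrow> signed_measure M (\<lambda>A. - \<nu> A)"
  by (auto simp: signed_measure_def intro: sums_minus)

text \<open>For B \<subseteq> A, \<nu> B = \<nu> A - \<nu> (A - B), and - \<nu> (A - B) is at most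
  the mass of the negative part on A. The supremum over B gives one half of the Jordan
  decomposition; exchanging \<nu> and - \<nu> gives the other half.\<close>

lemma (in signed_measure) le_measure_negative_part:
  assumes A: "A \<in> sets M"
  shows "measure (positive_part M \<nu>) A \<le> \<nu> A + measure (positive_part M (\<lambda>A. - \<nu> A)) A"
proof -
  interpret neg: signed_measure M "\<lambda>A. - \<nu> A" by (rule signed_measure_uminus) unfold_locales
  interpret P: finite_measure "positive_part M \<nu>" by (rule finite_positive_part)
  interpret N: finite_measure "positive_part M (\<lambda>A. - \<nu> A)" by (rule neg.finite_positive_part)
  have b: "\<nu> B \<le> \<nu> A + measure (positive_part M (\<lambda>A. - \<nu> A)) A" if B: "B \<in> sets M" "B \<subseteq> A" for B
  proof -
    have "ennreal (- \<nu> (A - B)) \<le> ennreal (measure (positive_part M (\<lambda>A. - \<nu> A)) A)"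
      using A B neg.sup_mass_upper[of "A - B" A]
      by (simp add: N.emeasure_eq_measure[symmetric] neg.emeasure_positive_part)
    then have "- \<nu> (A - B) \<le> measure (positive_part M (\<lambda>A. - \<nu> A)) A"
      by (subst (asm) ennreal_le_iff) simp_all
    then show ?thesis using Diff[OF A B] by simp
  qed
  \<comment> \<open>Nonnegativity of the bound allows the \<open>ennreal\<close> inequality below to
    be read as one between reals.\<close>
  from b[of "{}"] have nn: "0 \<le> \<nu> A + measure (positive_part M (\<lambda>A. - \<nu> A)) A" by (simp add: empty)
  have "sup_mass A \<le> ennreal (\<nu> A + measure (positive_part M (\<lambda>A. - \<nu> A)) A)"
    unfolding sup_mass_def by (rule SUP_least) (use b in \<open>auto intro!: ennreal_leI\<close>)
  then show ?thesis
    using A nn by (simp add: emeasure_positive_part[symmetric] P.emeasure_eq_measure del: ennreal_plus)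
qed

lemma (in signed_measure) Jordan_decomposition:
  assumes A: "A \<in> sets M"
  shows "\<nu> A = measure (positive_part M \<nu>) A - measure (positive_part M (\<lambda>A. - \<nu> A)) A"
  using le_measure_negative_part[OF A]
    signed_measure.le_measure_negative_part[OF signed_measure_uminus[OF signed_measure_axioms] A]
  by simp

section \<open>Radon-Nikodym densities of signed and complex measures\<close>

lemma (in signed_measure) ex_density_positive_part:
  assumes h: "sigma_finite_measure h" "sets h = sets M" and ac: "\<And>A. A \<in> null_sets h \<Longrightarrow> \<nu> A = 0"
  shows "\<exists>f :: 'a \<Rightarrow> real. integrable h f \<and>
    (\<forall>A\<in>sets M. measure (positive_part M \<nu>) A = (LINT x:A|h. f x))"
proof -
  interpret h: sigma_finite_measure h by fact
  interpret P: finite_measure "positive_part M \<nu>" by (rule finite_positive_part)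
  obtain f where f [measurable]: "f \<in> borel_measurable h" and d: "density h f = positive_part M \<nu>"
    using h.Radon_Nikodym[OF absolutely_continuous_positive_part] assms by auto
  have "(\<integral>\<^sup>+x. f x \<partial>h) = emeasure (positive_part M \<nu>) (space M)"
    unfolding d[symmetric] sets_eq_imp_space_eq[OF h(2), symmetric]
    by (subst emeasure_density) (auto intro!: nn_integral_cong)
  \<comment> \<open>The positive part has finite mass, so its \<open>ennreal\<close>-valued density
    is finite almost everywhere and \<open>enn2real\<close> loses nothing.\<close>
  then have fin: "(\<integral>\<^sup>+x. f x \<partial>h) \<noteq> \<infinity>" by (simp add: P.emeasure_eq_measure)
  then have "AE x in h. f x \<noteq> \<infinity>" by (intro nn_integral_PInf_AE) auto
  then have ae: "AE x in h. ennreal (enn2real (f x)) = f x" by eventually_elim (simp add: less_top)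
  have int: "integrable h (\<lambda>x. enn2real (f x))"
    by (rule integrableI_nonneg) (use fin nn_integral_cong_AE[OF ae] in \<open>auto simp: less_top\<close>)
  moreover have "measure (positive_part M \<nu>) A = (LINT x:A|h. enn2real (f x))" if A: "A \<in> sets M" for A
  proof -
    have "ennreal (LINT x:A|h. enn2real (f x)) = (\<integral>\<^sup>+x. ennreal (indicator A x * enn2real (f x)) \<partial>h)"
      unfolding set_lebesgue_integral_def real_scaleR_def
      using A h(2) integrable_mult_indicator[OF _ int, of A]
      by (intro nn_integral_eq_integral[symmetric]) auto
    also have "\<dots> = (\<integral>\<^sup>+x. f x * indicator A x \<partial>h)"
      using ae by (intro nn_integral_cong_AE) (auto elim!: eventually_mono simp: indicator_def)
    also have "\<dots> = emeasure (positive_part M \<nu>) A"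
      unfolding d[symmetric] using A h(2) by (subst emeasure_density) auto
    finally have "ennreal (LINT x:A|h. enn2real (f x)) = ennreal (measure (positive_part M \<nu>) A)"
      by (simp add: P.emeasure_eq_measure)
    then show ?thesis
      by (subst (asm) ennreal_inj) (auto simp: set_lebesgue_integral_def intro!: integral_nonneg_AE)
  qed
  ultimately show ?thesis by blast
qed

lemma (in signed_measure) ex_density:
  assumes h: "sigma_finite_measure h" "sets h = sets M" and ac: "\<And>A. A \<in> null_sets h \<Longrightarrow> \<nu> A = 0"
  obtains f :: "'a \<Rightarrow> real" where "integrable h f" "\<And>A. A \<in> sets M \<Longrightarrow> \<nu> A = (LINT x:A|h. f x)"
proof -
  obtain f g :: "'a \<Rightarrow> real"
    where f: "integrable h f" "\<And>A. A \<in> sets M \<Longrightarrow> measure (positive_part M \<nu>) A = (LINT x:A|h. f x)"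
    and g: "integrable h g" "\<And>A. A \<in> sets M \<Longrightarrow> measure (positive_part M (\<lambda>A. - \<nu> A)) A = (LINT x:A|h. g x)"
    using ex_density_positive_part[OF h]
      signed_measure.ex_density_positive_part[OF signed_measure_uminus[OF signed_measure_axioms] h] ac
    by auto
  show thesis
  proof (rule that[of "\<lambda>x. f x - g x"])
    show "integrable h (\<lambda>x. f x - g x)" using f g by simp
    fix A assume A: "A \<in> sets M"
    then have "set_integrable h A f" "set_integrable h A g"
      using f(1) g(1) h(2) unfolding set_integrable_def by (auto intro!: integrable_mult_indicator simp del: real_scaleR_def)
    then show "\<nu> A = (LINT x:A|h. f x - g x)"
      using f(2) g(2) A by (subst set_integral_diff) (auto simp: Jordan_decomposition[OF A])
  qed
qed

lemma complex_measure_signed: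
  assumes "complex_measure M \<mu>"
  shows "signed_measure M (\<lambda>A. Re (\<mu> A))" "signed_measure M (\<lambda>A. Im (\<mu> A))"
    "signed_measure M (\<lambda>A. - Re (\<mu> A))" "signed_measure M (\<lambda>A. - Im (\<mu> A))"
  using assms by (auto simp: signed_measure_def complex_measure_def sums_complex_iff intro!: sums_minus)

lemma complex_measure_Radon_Nikodym:
  assumes \<mu>: "complex_measure M \<mu>" and h: "sigma_finite_measure h" "sets h = sets M"
    and ac: "\<And>A. A \<in> null_sets h \<Longrightarrow> \<mu> A = 0"
  obtains f where "integrable h f" "\<And>A. A \<in> sets M \<Longrightarrow> \<mu> A = L1_measure h f A"
proof -
  interpret R: signed_measure M "\<lambda>A. Re (\<mu> A)" using complex_measure_signed[OF \<mu>] by simp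
  interpret I: signed_measure M "\<lambda>A. Im (\<mu> A)" using complex_measure_signed[OF \<mu>] by simp
  obtain f where f: "integrable h f" "\<And>A. A \<in> sets M \<Longrightarrow> Re (\<mu> A) = (LINT x:A|h. f x)"
    using R.ex_density[OF h] ac by auto
  obtain g where g: "integrable h g" "\<And>A. A \<in> sets M \<Longrightarrow> Im (\<mu> A) = (LINT x:A|h. g x)"
    using I.ex_density[OF h] ac by auto
  let ?F = "\<lambda>x. complex_of_real (f x) + \<i> * complex_of_real (g x)"
  have F: "integrable h ?F" using f g by simp
  show thesis
  proof (rule that[OF F])
    fix A assume A: "A \<in> sets M"
    have FA: "integrable h (\<lambda>x. indicator A x *\<^sub>R ?F x)"
      using A F h by (intro integrable_mult_indicator) auto
    show "\<mu> A = L1_measure h ?F A"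
      unfolding L1_measure_def set_lebesgue_integral_def
      using f(2)[OF A] g(2)[OF A]
      by (intro complex_eqI) (simp_all add: integral_Re[OF FA, symmetric] integral_Im[OF FA, symmetric] set_lebesgue_integral_def del: integral_Re integral_Im)
  qed
qed

lemma complex_measure_diff:
  "complex_measure M \<mu> \<Longrightarrow> complex_measure M \<nu> \<Longrightarrow> complex_measure M (\<lambda>A. \<mu> A - \<nu> A)"
  by (simp add: complex_measure_def sums_diff)

lemma complex_measure_L1_measure:
  assumes "sets h = sets M" and f: "integrable h f"
  shows "complex_measure M (L1_measure h f)"
  unfolding complex_measure_def L1_measure_def
proof (intro allI impI)
  fix A :: "nat \<Rightarrow> 'a set" assume "range A \<subseteq> sets M" and disj: "disjoint_family A"
  then have A [measurable]: "A i \<in> sets h" for i using assms by auto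
  have "(\<lambda>n. LINT x|h. indicator (\<Union>i<n. A i) x *\<^sub>R f x) \<longlonglongrightarrow> (LINT x|h. indicator (\<Union>i. A i) x *\<^sub>R f x)"
  proof (rule integral_dominated_convergence[where w = "\<lambda>x. norm (f x)"])
    have "(\<lambda>n. indicator (\<Union>i<n. A i) x :: real) \<longlonglongrightarrow> indicator (\<Union>i. A i) x" for x
      by (rule LIMSEQ_indicator_UN)
    then show "AE x in h. (\<lambda>n. indicator (\<Union>i<n. A i) x *\<^sub>R f x) \<longlonglongrightarrow> indicator (\<Union>i. A i) x *\<^sub>R f x"
      by (intro AE_I2 tendsto_scaleR tendsto_const)
  qed (use f in \<open>auto simp: indicator_def\<close>)
  moreover have "(LINT x|h. indicator (\<Union>i<n. A i) x *\<^sub>R f x) = (\<Sum>i<n. LINT x:A i|h. f x)" for n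
  proof -
    have "set_integrable h (A i) f" for i
      using f by (simp add: set_integrable_def integrable_mult_indicator del: real_scaleR_def)
    then show ?thesis
      unfolding set_lebesgue_integral_def[symmetric] using disj
      by (intro set_integral_finite_Union) (auto simp: disjoint_family_on_def)
  qed
  ultimately show "(\<lambda>i. LINT x:A i|h. f x) sums (LINT x:(\<Union>i. A i)|h. f x)"
    by (simp add: sums_def set_lebesgue_integral_def)
qed

text \<open>The supremum over subsets of A is attained at the set where \<open>f\<close> is
  nonnegative. Since \<open>ennreal\<close> truncates at 0, the density on the right is the positive
  part of \<open>f\<close>.\<close>

lemma positive_part_density:
  assumes h: "sets h = sets M" and f: "integrable h f"
    and \<nu>: "\<And>A. A \<in> sets M \<Longrightarrow> \<nu> A = (LINT x:A|h. f x)"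
  shows "positive_part M \<nu> = density h (\<lambda>x. ennreal (f x))"
proof -
  interpret signed_measure M \<nu>
  proof
    fix A :: "nat \<Rightarrow> 'a set" assume A: "range A \<subseteq> sets M" "disjoint_family A"
    have "complex_measure M (L1_measure h (\<lambda>x. complex_of_real (f x)))"
      using f by (intro complex_measure_L1_measure h) simp
    then have *: "(\<lambda>i. L1_measure h (\<lambda>x. complex_of_real (f x)) (A i)) sums
        L1_measure h (\<lambda>x. complex_of_real (f x)) (\<Union>i. A i)"
      using A by (simp add: complex_measure_def)
    have "L1_measure h (\<lambda>x. complex_of_real (f x)) B = complex_of_real (\<nu> B)" if "B \<in> sets M" for B
      unfolding \<nu>[OF that] L1_measure_def by (rule set_integral_complex_of_real)
    then show "(\<lambda>i. \<nu> (A i)) sums \<nu> (\<Union>i. A i)"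
      using * A by (simp add: sums_of_real_iff range_subsetD sets.countable_UN)
  qed
  have [measurable]: "f \<in> borel_measurable h" using f by simp
  have bound: "ennreal (\<nu> B) \<le> (\<integral>\<^sup>+x. ennreal (f x) * indicator B x \<partial>h)" if B: "B \<in> sets M" for B
  proof -
    have B' [measurable]: "B \<in> sets h" using B h by simp
    have i: "integrable h (\<lambda>x. max 0 (indicator B x * f x))"
      using integrable_mult_indicator[OF B' f] by (intro integrable_max) auto
    have "\<nu> B \<le> (LINT x|h. max 0 (indicator B x * f x))"
      unfolding \<nu>[OF B] set_lebesgue_integral_def real_scaleR_def
      using integrable_mult_indicator[OF B' f] by (intro integral_mono i) auto
    then have "ennreal (\<nu> B) \<le> ennreal (LINT x|h. max 0 (indicator B x * f x))" by (rule ennreal_leI)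
    also have "\<dots> = (\<integral>\<^sup>+x. ennreal (max 0 (indicator B x * f x)) \<partial>h)"
      by (intro nn_integral_eq_integral[symmetric] i) auto
    also have "\<dots> = (\<integral>\<^sup>+x. ennreal (f x) * indicator B x \<partial>h)"
      by (intro nn_integral_cong) (auto simp: indicator_def max_def ennreal_neg)
    finally show ?thesis .
  qed
  show ?thesis
  proof (rule measure_eqI)
    fix A assume "A \<in> sets (positive_part M \<nu>)"
    then have A: "A \<in> sets M" and A' [measurable]: "A \<in> sets h" using h by auto
    have "sup_mass A = (\<integral>\<^sup>+x. ennreal (f x) * indicator A x \<partial>h)"
    proof (rule antisym)
      show "sup_mass A \<le> (\<integral>\<^sup>+x. ennreal (f x) * indicator A x \<partial>h)"
        unfolding sup_mass_def
      proof (rule SUP_least, clarify)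
        fix B assume "B \<in> sets M" "B \<subseteq> A"
        then show "ennreal (\<nu> B) \<le> (\<integral>\<^sup>+x. ennreal (f x) * indicator A x \<partial>h)"
          by (intro order_trans[OF bound] nn_integral_mono) (auto simp: indicator_def)
      qed
      let ?B = "{x \<in> A. 0 \<le> f x}"
      have "?B = A \<inter> {x \<in> space h. 0 \<le> f x}" using sets.sets_into_space[OF A'] by auto
      then have B' [measurable]: "?B \<in> sets h" by simp
      have "(\<integral>\<^sup>+x. ennreal (f x) * indicator A x \<partial>h) = (\<integral>\<^sup>+x. ennreal (indicator ?B x * f x) \<partial>h)"
        by (intro nn_integral_cong) (auto simp: indicator_def ennreal_neg)
      also have "\<dots> = ennreal (\<nu> ?B)"
        using B' h integrable_mult_indicator[OF B' f]
        unfolding \<nu>[OF B'[unfolded h]] set_lebesgue_integral_def real_scaleR_def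
        by (intro nn_integral_eq_integral) (auto simp: indicator_def)
      also have "\<dots> \<le> sup_mass A" using B' h by (intro sup_mass_upper) auto
      finally show "(\<integral>\<^sup>+x. ennreal (f x) * indicator A x \<partial>h) \<le> sup_mass A" .
    qed
    then show "emeasure (positive_part M \<nu>) A = emeasure (density h (\<lambda>x. ennreal (f x))) A"
      by (simp add: emeasure_positive_part[OF A] emeasure_density)
  qed (simp add: h)
qed

section \<open>Integration against complex measures\<close>

lemma complex_measure_integral_cong:
  assumes "\<And>A. A \<in> sets M \<Longrightarrow> \<mu> A = \<nu> A"
  shows "complex_measure_integral M \<mu> f = complex_measure_integral M \<nu> f"
proof -
  have "(SUP B\<in>{B \<in> sets M. B \<subseteq> A}. ennreal (r (\<mu> B))) = (SUP B\<in>{B \<in> sets M. B \<subseteq> A}. ennreal (r (\<nu> B)))" for r A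
    using assms by (intro SUP_cong) auto
  from this[of Re] this[of "\<lambda>z. - Re z"] this[of Im] this[of "\<lambda>z. - Im z"] show ?thesis
    unfolding complex_measure_integral_def positive_part_def by (simp only:)
qed

text \<open>A complex measure in the form \<rho> m. The bound on \<rho> makes every m-integrable
  function integrable against the complex measure, and the four Jordan integrals collapse to a
  single Bochner integral, to which Fubini's theorem applies.\<close>

locale complex_density = finite_measure m for m :: "'a measure" +
  fixes \<rho> :: "'a \<Rightarrow> complex"
  assumes measurable_\<rho> [measurable]: "\<rho> \<in> borel_measurable m"
    and norm_\<rho>: "\<And>x. cmod (\<rho> x) \<le> 1"
begin

lemma integrable_\<rho>_mult: "integrable m f \<Longrightarrow> integrable m (\<lambda>x. \<rho> x * f x)"
  by (rule Bochner_Integration.integrable_bound[where f = f])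
     (auto simp: norm_mult intro!: mult_left_le_one_le norm_\<rho>)

lemma integrable_\<rho>: "integrable m \<rho>"
  using integrable_\<rho>_mult[of "\<lambda>_. 1"] by simp

lemma complex_measure: "sets m = sets M \<Longrightarrow> complex_measure M (L1_measure m \<rho>)"
  by (intro complex_measure_L1_measure integrable_\<rho>)

text \<open>The four Jordan parts have over \<open>m\<close> the positive parts of \<rho>'s real and
  imaginary parts and of their negatives as densities; they recombine by r = max 0 r - max 0 (-
  r).\<close>

lemma complex_measure_integral_eq:
  assumes M: "sets m = sets M" and \<mu>: "\<And>A. A \<in> sets M \<Longrightarrow> \<mu> A = L1_measure m \<rho> A"
    and f: "integrable m f"
  shows "complex_measure_integral M \<mu> f = (LINT x|m. \<rho> x * f x)"
proof -
  have [measurable]: "f \<in> borel_measurable m" using f by simp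
  have part: "integrable m (\<lambda>x. complex_of_real (max 0 (r x)) * f x)"
      "(LINT x|positive_part M \<nu>. f x) = (LINT x|m. complex_of_real (max 0 (r x)) * f x)"
    if r [measurable]: "r \<in> borel_measurable m" and r1: "\<And>x. \<bar>r x\<bar> \<le> 1" and \<nu>: "\<And>A. A \<in> sets M \<Longrightarrow> \<nu> A = (LINT x:A|m. r x)" for r \<nu>
  proof -
    have "integrable m r" by (rule integrable_const_bound[where B = 1]) (use r1 in auto)
    from positive_part_density[OF M this \<nu>]
    have "positive_part M \<nu> = density m (\<lambda>x. ennreal (max 0 (r x)))"
      by (simp add: ennreal_max_0)
    then show "(LINT x|positive_part M \<nu>. f x) = (LINT x|m. complex_of_real (max 0 (r x)) * f x)"
      by (simp add: integral_density scaleR_conv_of_real)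
    have "max 0 (r x) \<le> 1" for x using r1[of x] by auto
    then show "integrable m (\<lambda>x. complex_of_real (max 0 (r x)) * f x)"
      by (intro Bochner_Integration.integrable_bound[OF f])
         (auto simp: norm_mult intro!: mult_left_le_one_le)
  qed
  have int: "set_integrable m A \<rho>" if "A \<in> sets M" for A
    using that M integrable_\<rho> by (auto simp: set_integrable_def intro!: integrable_mult_indicator simp del: real_scaleR_def)
  have Re: "Re (\<mu> A) = (LINT x:A|m. Re (\<rho> x))" and Im: "Im (\<mu> A) = (LINT x:A|m. Im (\<rho> x))"
    if A: "A \<in> sets M" for A
    using integral_Re[OF int[OF A, unfolded set_integrable_def]] integral_Im[OF int[OF A, unfolded set_integrable_def]]
    by (simp_all add: \<mu>[OF A] L1_measure_def set_lebesgue_integral_def)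
  have b: "\<bar>Re (\<rho> x)\<bar> \<le> 1" "\<bar>Im (\<rho> x)\<bar> \<le> 1" "\<bar>- Re (\<rho> x)\<bar> \<le> 1" "\<bar>- Im (\<rho> x)\<bar> \<le> 1" for x
    using abs_Re_le_cmod[of "\<rho> x"] abs_Im_le_cmod[of "\<rho> x"] norm_\<rho>[of x] by auto
  have neg: "- (LINT x:A|m. r x) = (LINT x:A|m. - r x)" for A and r :: "'a \<Rightarrow> real"
    by (simp add: set_lebesgue_integral_def)
  note P1 = part[of "\<lambda>x. Re (\<rho> x)" "\<lambda>A. Re (\<mu> A)", OF _ b(1) Re, simplified]
  note P2 = part[of "\<lambda>x. - Re (\<rho> x)" "\<lambda>A. - Re (\<mu> A)", OF _ b(3), simplified neg[symmetric], simplified Re, simplified]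
  note P3 = part[of "\<lambda>x. Im (\<rho> x)" "\<lambda>A. Im (\<mu> A)", OF _ b(2) Im, simplified]
  note P4 = part[of "\<lambda>x. - Im (\<rho> x)" "\<lambda>A. - Im (\<mu> A)", OF _ b(4), simplified neg[symmetric], simplified Im, simplified]
  have "complex_measure_integral M \<mu> f =
    (LINT x|m. (complex_of_real (max 0 (Re (\<rho> x))) * f x - complex_of_real (max 0 (- Re (\<rho> x))) * f x) +
      \<i> * (complex_of_real (max 0 (Im (\<rho> x))) * f x - complex_of_real (max 0 (- Im (\<rho> x))) * f x))"
    unfolding complex_measure_integral_def
    using P1 P2 P3 P4 by simp
  also have "\<dots> = (LINT x|m. \<rho> x * f x)"
  proof (rule Bochner_Integration.integral_cong)
    fix x
    have r: "max 0 r - max 0 (- r) = r" for r :: real by auto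
    have "complex_of_real (max 0 (Re (\<rho> x))) * f x - complex_of_real (max 0 (- Re (\<rho> x))) * f x +
        \<i> * (complex_of_real (max 0 (Im (\<rho> x))) * f x - complex_of_real (max 0 (- Im (\<rho> x))) * f x) =
        (complex_of_real (max 0 (Re (\<rho> x)) - max 0 (- Re (\<rho> x))) +
          \<i> * complex_of_real (max 0 (Im (\<rho> x)) - max 0 (- Im (\<rho> x)))) * f x"
      unfolding of_real_diff by (simp only: algebra_simps)
    also have "\<dots> = \<rho> x * f x" unfolding r by (simp add: complex_eq[symmetric])
    finally show "complex_of_real (max 0 (Re (\<rho> x))) * f x - complex_of_real (max 0 (- Re (\<rho> x))) * f x +
        \<i> * (complex_of_real (max 0 (Im (\<rho> x))) * f x - complex_of_real (max 0 (- Im (\<rho> x))) * f x) = \<rho> x * f x" .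
  qed simp
  finally show ?thesis .
qed

text \<open>Because \<open>w\<close> is nonnegative, the inner integral of the norm is the norm of
  the averaged integrand, which is integrable by the last assumption; so Fubini's theorem applies.
  This serves to write \<phi> as an integral over \<open>k\<close>, and to average \<phi> over
  \<open>a\<close>.\<close>

lemma integral_weighted_swap:
  assumes N: "sigma_finite_measure N"
    and w [measurable]: "(\<lambda>(x, a). w x a) \<in> borel_measurable (m \<Otimes>\<^sub>M N)" and w0: "\<And>x a. 0 \<le> w x a"
    and int: "\<And>x. x \<in> space m \<Longrightarrow> integrable N (w x)"
    and k [measurable]: "k \<in> borel_measurable m" and kw: "integrable m (\<lambda>x. of_real (LINT a|N. w x a) * k x)"
  shows "(LINT a|N. LINT x|m. \<rho> x * (of_real (w x a) * k x)) = (LINT x|m. \<rho> x * (of_real (LINT a|N. w x a) * k x))"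
proof -
  interpret N: sigma_finite_measure N by fact
  interpret P: pair_sigma_finite m N by unfold_locales
  define F where "F x a = \<rho> x * (of_real (w x a) * k x)" for x a
  have [measurable]: "case_prod F \<in> borel_measurable (m \<Otimes>\<^sub>M N)" unfolding F_def by measurable
  have I: "(LINT a|N. F x a) = \<rho> x * (of_real (LINT a|N. w x a) * k x)" for x
    unfolding F_def by (simp only: integral_mult_right_zero integral_mult_left_zero integral_complex_of_real)
  have "integrable (m \<Otimes>\<^sub>M N) (case_prod F)"
  proof (rule P.Fubini_integrable)
    have "(LINT a|N. norm (F x a)) = norm (\<rho> x * (of_real (LINT a|N. w x a) * k x))" for x
    proof -
      have "(LINT a|N. norm (F x a)) = (LINT a|N. norm (\<rho> x) * (w x a * norm (k x)))"
        unfolding F_def by (intro Bochner_Integration.integral_cong) (auto simp: norm_mult w0)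
      also have "\<dots> = norm (\<rho> x) * ((LINT a|N. w x a) * norm (k x))"
        by (simp only: integral_mult_right_zero integral_mult_left_zero)
      finally show ?thesis using w0 by (simp add: norm_mult integral_nonneg_AE)
    qed
    then show "integrable m (\<lambda>x. LINT a|N. norm (case_prod F (x, a)))"
      using integrable_norm[OF integrable_\<rho>_mult[OF kw]] by simp
    have "integrable N (F x)" if "x \<in> space m" for x
      unfolding F_def by (intro integrable_mult_right integrable_mult_left integrable_of_real int that)
    then show "AE x in m. integrable N (\<lambda>a. case_prod F (x, a))" by (intro AE_I2) simp
  qed simp
  then have "(LINT a|N. LINT x|m. F x a) = (LINT x|m. LINT a|N. F x a)" by (rule P.Fubini_integral)
  then show ?thesis unfolding I by (simp add: F_def)
qed

end

section \<open>Dominating measures and simultaneous densities\<close>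

definition add_measure :: "'a measure \<Rightarrow> 'a measure \<Rightarrow> 'a measure" where
  "add_measure M N = measure_of (space M) (sets M) (\<lambda>A. emeasure M A + emeasure N A)"

lemma sets_add_measure [simp]: "sets (add_measure M N) = sets M"
  and space_add_measure [simp]: "space (add_measure M N) = space M"
  by (simp_all add: add_measure_def)

lemma emeasure_add_measure:
  assumes N: "sets N = sets M" and A: "A \<in> sets M"
  shows "emeasure (add_measure M N) A = emeasure M A + emeasure N A"
  unfolding add_measure_def
proof (rule emeasure_measure_of_sigma[OF _ _ _ A])
  show "sigma_algebra (space M) (sets M)" ..
  show "positive (sets M) (\<lambda>A. emeasure M A + emeasure N A)" by (simp add: positive_def)
  show "countably_additive (sets M) (\<lambda>A. emeasure M A + emeasure N A)"
    using N by (auto simp: countably_additive_def suminf_add[symmetric] suminf_emeasure)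
qed

lemma null_sets_add_measure:
  "sets N = sets M \<Longrightarrow> A \<in> null_sets (add_measure M N) \<longleftrightarrow> A \<in> null_sets M \<and> A \<in> null_sets N"
  by (auto simp: null_sets_def emeasure_add_measure)

lemma finite_measure_add_measure:
  assumes "finite_measure M" "finite_measure N" "sets N = sets M"
  shows "finite_measure (add_measure M N)"
proof
  interpret M: finite_measure M by fact
  interpret N: finite_measure N by fact
  show "emeasure (add_measure M N) (space (add_measure M N)) \<noteq> \<infinity>"
    by (simp add: emeasure_add_measure assms M.emeasure_eq_measure N.emeasure_eq_measure)
qed

lemma complex_measure_dominated:
  assumes \<mu>: "complex_measure M \<mu>"
  obtains m where "finite_measure m" "sets m = sets M" "\<And>A. A \<in> null_sets m \<Longrightarrow> \<mu> A = 0"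
proof -
  interpret a: signed_measure M "\<lambda>A. Re (\<mu> A)" using complex_measure_signed[OF \<mu>] by simp
  interpret b: signed_measure M "\<lambda>A. - Re (\<mu> A)" using complex_measure_signed[OF \<mu>] by simp
  interpret c: signed_measure M "\<lambda>A. Im (\<mu> A)" using complex_measure_signed[OF \<mu>] by simp
  interpret d: signed_measure M "\<lambda>A. - Im (\<mu> A)" using complex_measure_signed[OF \<mu>] by simp
  let ?P = "positive_part M"
  let ?m = "add_measure (add_measure (?P (\<lambda>A. Re (\<mu> A))) (?P (\<lambda>A. - Re (\<mu> A))))
      (add_measure (?P (\<lambda>A. Im (\<mu> A))) (?P (\<lambda>A. - Im (\<mu> A))))"
  show thesis
  proof (rule that)
    show "finite_measure ?m"
      by (intro finite_measure_add_measure a.finite_positive_part b.finite_positive_part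
          c.finite_positive_part d.finite_positive_part) simp_all
    show "sets ?m = sets M" by simp
    fix A assume A: "A \<in> null_sets ?m"
    then have "A \<in> sets M" by auto
    then show "\<mu> A = 0"
      using A a.Jordan_decomposition[of A] c.Jordan_decomposition[of A]
      by (auto simp: null_sets_add_measure complex_eq_iff dest!: null_setsD1 simp: measure_def)
  qed
qed

text \<open>Both densities are divided by the same function |f| + |g|. Then \<rho> - \<sigma> is
  bounded by 1 as well, so that \<mu>, \<nu> and their difference are all represented over one base
  measure.\<close>

lemma complex_measure_densities:
  assumes \<mu>: "complex_measure M \<mu>" and \<nu>: "complex_measure M \<nu>"
  obtains m \<rho> \<sigma> where "complex_density m \<rho>" "complex_density m \<sigma>" "\<And>x. cmod (\<rho> x) + cmod (\<sigma> x) \<le> 1"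
    "sets m = sets M" "\<And>A. A \<in> sets M \<Longrightarrow> \<mu> A = L1_measure m \<rho> A" "\<And>A. A \<in> sets M \<Longrightarrow> \<nu> A = L1_measure m \<sigma> A"
proof -
  obtain m1 where m1: "finite_measure m1" "sets m1 = sets M" "\<And>A. A \<in> null_sets m1 \<Longrightarrow> \<mu> A = 0"
    using complex_measure_dominated[OF \<mu>] by blast
  obtain m2 where m2: "finite_measure m2" "sets m2 = sets M" "\<And>A. A \<in> null_sets m2 \<Longrightarrow> \<nu> A = 0"
    using complex_measure_dominated[OF \<nu>] by blast
  let ?n = "add_measure m1 m2"
  have s: "sets ?n = sets M" using m1 by simp
  interpret n: finite_measure ?n by (rule finite_measure_add_measure) (use m1 m2 in auto)
  note null = null_sets_add_measure[of m2 m1]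
  obtain f where f: "integrable ?n f" "\<And>A. A \<in> sets M \<Longrightarrow> \<mu> A = L1_measure ?n f A"
    using complex_measure_Radon_Nikodym[OF \<mu> n.sigma_finite_measure_axioms s] null m1 m2 by auto
  obtain g where g: "integrable ?n g" "\<And>A. A \<in> sets M \<Longrightarrow> \<nu> A = L1_measure ?n g A"
    using complex_measure_Radon_Nikodym[OF \<nu> n.sigma_finite_measure_axioms s] null m1 m2 by auto
  define w where "w x = cmod (f x) + cmod (g x)" for x
  define m where "m = density ?n w"
  have meas [measurable]: "f \<in> borel_measurable ?n" "g \<in> borel_measurable ?n" using f g by auto
  have w [measurable]: "w \<in> borel_measurable ?n" and w0: "0 \<le> w x" for x unfolding w_def by auto
  have wi: "integrable ?n w" unfolding w_def using f g by auto
  have "finite_measure m"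
  proof
    have "emeasure m (space m) = (\<integral>\<^sup>+x. w x \<partial>?n)"
      unfolding m_def by (subst emeasure_density) (auto intro!: nn_integral_cong)
    also have "\<dots> = ennreal (LINT x|?n. w x)" by (rule nn_integral_eq_integral[OF wi]) (simp add: w0)
    finally show "emeasure m (space m) \<noteq> \<infinity>" by simp
  qed
  have *: "complex_density m (\<lambda>x. u x / of_real (w x))" "L1_measure m (\<lambda>x. u x / of_real (w x)) A = L1_measure ?n u A"
    if u [measurable]: "u \<in> borel_measurable ?n" and uw: "\<And>x. cmod (u x) \<le> w x" and A: "A \<in> sets M" for u A
  proof -
    have "cmod (u x / of_real (w x)) \<le> 1" for x
      using uw[of x] w0[of x] by (auto simp: norm_divide divide_le_eq_1)
    then show "complex_density m (\<lambda>x. u x / of_real (w x))"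
      using \<open>finite_measure m\<close> by (auto simp: complex_density_def complex_density_axioms_def m_def)
    have [measurable]: "A \<in> sets ?n" using A s by simp
    \<comment> \<open>Where \<open>w\<close> vanishes so does \<open>u\<close>, and the quotient has
      the default value 0.\<close>
    have "w x *\<^sub>R (indicator A x *\<^sub>R (u x / of_real (w x))) = indicator A x *\<^sub>R u x" for x
      using uw[of x] by (cases "w x = 0") (auto simp: scaleR_conv_of_real)
    then show "L1_measure m (\<lambda>x. u x / of_real (w x)) A = L1_measure ?n u A"
      unfolding L1_measure_def set_lebesgue_integral_def m_def
      by (subst integral_density) (auto simp: w0)
  qed
  have sm: "sets m = sets M" using s by (simp add: m_def)
  have sum: "cmod (f x / of_real (w x)) + cmod (g x / of_real (w x)) \<le> 1" for x
  proof -
    have "cmod (f x / of_real (w x)) + cmod (g x / of_real (w x)) = w x / w x"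
      using w0[of x] by (simp add: norm_divide add_divide_distrib[symmetric]) (simp add: w_def)
    then show ?thesis by (cases "w x = 0") auto
  qed
  show thesis
    by (rule that[OF *(1)[OF meas(1)] *(1)[OF meas(2)] sum sm])
       (use f g *(2)[OF meas(1)] *(2)[OF meas(2)] in \<open>auto simp: w_def\<close>)
qed

lemma complex_measure_density:
  assumes \<mu>: "complex_measure M \<mu>"
  obtains m \<rho> where "complex_density m \<rho>" "sets m = sets M" "\<And>A. A \<in> sets M \<Longrightarrow> \<mu> A = L1_measure m \<rho> A"
  using complex_measure_densities[OF \<mu> \<mu>] by metis

text \<open>The Cauchy-Schwarz inequality against the constant 1. If \<open>F\<close> is not
  integrable, its Bochner integral is 0 and the bound is trivial.\<close>

lemma nn_integral_square_bound:
  fixes F :: "'a \<Rightarrow> complex"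
  assumes F [measurable]: "F \<in> borel_measurable M"
  shows "ennreal ((cmod (LINT x|M. F x))\<^sup>2) \<le> emeasure M (space M) * (\<integral>\<^sup>+x. ennreal ((cmod (F x))\<^sup>2) \<partial>M)"
proof -
  have "ennreal (cmod (LINT x|M. F x)) \<le> (\<integral>\<^sup>+x. ennreal (cmod (F x)) \<partial>M)"
    by (cases "integrable M F") (auto simp: integral_norm_bound_ennreal not_integrable_integral_eq)
  then have "(ennreal (cmod (LINT x|M. F x)))\<^sup>2 \<le> (\<integral>\<^sup>+x. 1 * ennreal (cmod (F x)) \<partial>M)\<^sup>2"
    by (intro power_mono) auto
  also have "\<dots> \<le> (\<integral>\<^sup>+x. 1\<^sup>2 \<partial>M) * (\<integral>\<^sup>+x. (ennreal (cmod (F x)))\<^sup>2 \<partial>M)"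
    by (rule Cauchy_Schwarz_nn_integral) auto
  finally show ?thesis by (simp add: ennreal_power)
qed

lemma complex_measure_cong:
  assumes "\<And>A. A \<in> sets M \<Longrightarrow> \<mu> A = \<nu> A"
  shows "complex_measure M \<mu> \<longleftrightarrow> complex_measure M \<nu>"
proof -
  have "complex_measure M \<nu>" if \<mu>: "complex_measure M \<mu>" and eq: "\<And>A. A \<in> sets M \<Longrightarrow> \<mu> A = \<nu> A" for \<mu> \<nu>
    unfolding complex_measure_def
  proof (intro allI impI)
    fix A :: "nat \<Rightarrow> 'a set" assume A: "range A \<subseteq> sets M" "disjoint_family A"
    have "(\<lambda>i. \<mu> (A i)) sums \<mu> (\<Union>i. A i)"
      using \<mu> A by (simp only: complex_measure_def)
    moreover have "(\<lambda>i. \<mu> (A i)) = (\<lambda>i. \<nu> (A i))" using A(1) by (intro ext eq) auto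
    moreover have "\<mu> (\<Union>i. A i) = \<nu> (\<Union>i. A i)" using A(1) by (intro eq) auto
    ultimately show "(\<lambda>i. \<nu> (A i)) sums \<nu> (\<Union>i. A i)" by (simp only:)
  qed
  from this[of \<mu> \<nu>] this[of \<nu> \<mu>] show ?thesis using assms by metis
qed

text \<open>Vanishing is assumed on all measurable subsets, since \<mu> of the whole set could be 0
  by cancellation. It makes the suprema defining the Jordan parts 0 there.\<close>

lemma complex_measure_integral_eq_0:
  assumes \<mu>: "complex_measure M \<mu>" and w [measurable]: "w \<in> borel_measurable M"
    and null: "\<And>B. B \<in> sets M \<Longrightarrow> B \<subseteq> {x \<in> space M. w x \<noteq> 0} \<Longrightarrow> \<mu> B = 0"
  shows "complex_measure_integral M \<mu> w = 0"
proof -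
  have *: "(LINT x|positive_part M \<nu>. w x) = 0"
    if "signed_measure M \<nu>" "\<And>B. B \<in> sets M \<Longrightarrow> B \<subseteq> {x \<in> space M. w x \<noteq> 0} \<Longrightarrow> \<nu> B = 0" for \<nu>
  proof -
    interpret signed_measure M \<nu> by fact
    have B: "{x \<in> space M. w x \<noteq> 0} \<in> sets M" by measurable
    have "sup_mass {x \<in> space M. w x \<noteq> 0} = 0"
      unfolding sup_mass_def using that(2) by (auto intro!: antisym SUP_least)
    then have "{x \<in> space M. w x \<noteq> 0} \<in> null_sets (positive_part M \<nu>)"
      using B by (simp add: null_sets_def emeasure_positive_part)
    then have "AE x in positive_part M \<nu>. w x = 0"
      by (rule AE_I') auto
    then show ?thesis by (rule integral_eq_zero_AE)
  qed
  show ?thesis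
    unfolding complex_measure_integral_def
    using complex_measure_signed[OF \<mu>, THEN *] null by simp
qed

lemma complex_measure_diff_density:
  assumes \<mu>: "complex_measure M \<mu>" and \<nu>: "complex_measure M \<nu>"
  obtains m \<rho> \<sigma> where "complex_density m \<rho>" "complex_density m \<sigma>" "complex_density m (\<lambda>x. \<rho> x - \<sigma> x)"
    "sets m = sets M" "\<forall>A\<in>sets M. \<mu> A = L1_measure m \<rho> A" "\<forall>A\<in>sets M. \<nu> A = L1_measure m \<sigma> A"
    "\<forall>A\<in>sets M. \<mu> A - \<nu> A = L1_measure m (\<lambda>x. \<rho> x - \<sigma> x) A"
proof -
  obtain m \<rho> \<sigma> where m: "complex_density m \<rho>" "complex_density m \<sigma>" "\<And>x. cmod (\<rho> x) + cmod (\<sigma> x) \<le> 1" "sets m = sets M"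
    and \<mu>m: "\<forall>A\<in>sets M. \<mu> A = L1_measure m \<rho> A" and \<nu>m: "\<forall>A\<in>sets M. \<nu> A = L1_measure m \<sigma> A"
    using complex_measure_densities[OF \<mu> \<nu>] by metis
  interpret D: complex_density m \<rho> by fact
  interpret E: complex_density m \<sigma> by fact
  have d: "complex_density m (\<lambda>x. \<rho> x - \<sigma> x)"
    by unfold_locales (auto intro: order_trans[OF norm_triangle_ineq4] m(3))
  have "\<forall>A\<in>sets M. \<mu> A - \<nu> A = L1_measure m (\<lambda>x. \<rho> x - \<sigma> x) A"
  proof
    fix A assume A: "A \<in> sets M"
    then have "set_integrable m A \<rho>" "set_integrable m A \<sigma>"
      using m(4) D.integrable_\<rho> E.integrable_\<rho>
      by (auto simp: set_integrable_def intro!: integrable_mult_indicator simp del: real_scaleR_def)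
    then show "\<mu> A - \<nu> A = L1_measure m (\<lambda>x. \<rho> x - \<sigma> x) A"
      using A \<mu>m \<nu>m by (simp add: L1_measure_def set_integral_diff)
  qed
  with that[OF m(1,2) d m(4) \<mu>m \<nu>m] show thesis .
qed

text \<open>The Jordan parts are not additive in the measure, so linearity is read off from
  densities over a common base.\<close>

lemma complex_measure_integral_diff:
  assumes \<mu>: "complex_measure M \<mu>" and \<nu>: "complex_measure M \<nu>"
    and w [measurable]: "w \<in> borel_measurable M" and w1: "\<And>x. cmod (w x) \<le> 1"
  shows "complex_measure_integral M (\<lambda>A. \<mu> A - \<nu> A) w =
    complex_measure_integral M \<mu> w - complex_measure_integral M \<nu> w"
proof -
  obtain m \<rho> \<sigma> where m: "complex_density m \<rho>" "complex_density m \<sigma>" "complex_density m (\<lambda>x. \<rho> x - \<sigma> x)"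
    "sets m = sets M" and eq: "\<forall>A\<in>sets M. \<mu> A = L1_measure m \<rho> A" "\<forall>A\<in>sets M. \<nu> A = L1_measure m \<sigma> A"
    "\<forall>A\<in>sets M. \<mu> A - \<nu> A = L1_measure m (\<lambda>x. \<rho> x - \<sigma> x) A"
    by (rule complex_measure_diff_density[OF \<mu> \<nu>]) (rule that)
  interpret D: complex_density m \<rho> by fact
  interpret E: complex_density m \<sigma> by fact
  have w: "integrable m w"
    by (rule D.integrable_const_bound[where B = 1]) (use w1 in \<open>auto simp: measurable_cong_sets[OF m(4) refl]\<close>)
  have eq': "complex_measure_integral M \<kappa> w = (LINT x|m. r x * w x)"
    if "complex_density m r" "\<forall>A\<in>sets M. \<kappa> A = L1_measure m r A" for \<kappa> r
    using that(2) by (intro complex_density.complex_measure_integral_eq[OF that(1) m(4) _ w]) blast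
  show ?thesis
    unfolding eq'[OF m(1) eq(1)] eq'[OF m(2) eq(2)] eq'[OF m(3) eq(3)]
    using w by (simp add: left_diff_distrib D.integrable_\<rho>_mult E.integrable_\<rho>_mult)
qed

text \<open>The cover is made disjoint so that countable additivity applies. With a countable base
  this shows that a measure vanishes off its support.\<close>

lemma complex_measure_null_UN:
  assumes \<mu>: "complex_measure M \<mu>" and \<B>: "countable \<B>" "\<B> \<subseteq> sets M"
    and null: "\<And>V A. V \<in> \<B> \<Longrightarrow> A \<in> sets M \<Longrightarrow> A \<subseteq> V \<Longrightarrow> \<mu> A = 0"
    and A: "A \<in> sets M" "A \<subseteq> \<Union>\<B>"
  shows "\<mu> A = 0"
proof (cases "\<B> = {}")
  case True
  then have "A = {}" using A by auto
  moreover have "\<mu> {} = 0"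
    using complex_measure_signed[OF \<mu>, THEN signed_measure.empty] by (simp add: complex_eq_iff)
  ultimately show ?thesis by simp
next
  case False
  let ?V = "from_nat_into \<B>"
  have V: "range ?V = \<B>" using False \<B>(1) by (rule range_from_nat_into)
  let ?A = "\<lambda>i. A \<inter> disjointed ?V i"
  have "(\<lambda>i. \<mu> (?A i)) sums \<mu> (\<Union>i. ?A i)"
  proof -
    have d: "disjoint_family ?A"
      using disjoint_family_disjointed[of ?V] by (fastforce simp: disjoint_family_on_def)
    have "range ?A \<subseteq> sets M" using A \<B> V sets.range_disjointed_sets[of ?V M] by auto
    then show ?thesis using d by (rule \<mu>[unfolded complex_measure_def, rule_format])
  qed
  moreover have "(\<Union>i. ?A i) = A" using A V UN_disjointed_eq[of ?V] by auto
  moreover have "\<mu> (?A i) = 0" for i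
  proof (rule null)
    show "?V i \<in> \<B>" using V by auto
    show "?A i \<in> sets M" using A \<B> V sets.range_disjointed_sets[of ?V M] by auto
    show "?A i \<subseteq> ?V i" using disjointed_subset[of ?V i] by auto
  qed
  ultimately show ?thesis by (simp add: sums_iff)
qed

lemma L1_measure_null:
  assumes "A \<in> null_sets h" shows "L1_measure h f A = 0"
  unfolding L1_measure_def set_lebesgue_integral_def
  by (rule integral_eq_zero_AE) (use AE_not_in[OF assms] in \<open>auto elim!: eventually_mono\<close>)


section \<open>Convolution operators\<close>

abbreviation sq :: "complex \<Rightarrow> ennreal" where
  "sq z \<equiv> ennreal ((cmod z)\<^sup>2)"

text \<open>The squared L^2-norm with values in \<open>ennreal\<close>: estimates and exchanges of
  integrals can then precede any knowledge of finiteness.\<close>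

definition sq_integral :: "'a measure \<Rightarrow> ('a \<Rightarrow> complex) \<Rightarrow> ennreal" where
  "sq_integral h \<xi> = (\<integral>\<^sup>+x. sq (\<xi> x) \<partial>h)"

lemma L2_iff: "\<xi> \<in> L2 h \<longleftrightarrow> \<xi> \<in> borel_measurable h \<and> sq_integral h \<xi> < \<infinity>"
  by (auto simp: L2_def sq_integral_def integrable_iff_bounded)

lemma L2_measurable: "\<xi> \<in> L2 h \<Longrightarrow> \<xi> \<in> borel_measurable h"
  by (simp add: L2_def)

lemma L2_norm_nonneg: "0 \<le> L2_norm h \<xi>"
  by (simp add: L2_norm_def)

lemma sq_integral_L2_norm: "\<xi> \<in> L2 h \<Longrightarrow> sq_integral h \<xi> = ennreal ((L2_norm h \<xi>)\<^sup>2)"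
  unfolding sq_integral_def L2_norm_def
  by (subst real_sqrt_pow2) (auto simp: L2_def intro!: nn_integral_eq_integral)

lemma sq_integral_cong_AE: "AE x in h. \<xi> x = \<eta> x \<Longrightarrow> sq_integral h \<xi> = sq_integral h \<eta>"
  unfolding sq_integral_def by (intro nn_integral_cong_AE) auto

lemma L2_norm_cong_AE:
  assumes "\<xi> \<in> borel_measurable h" "\<eta> \<in> borel_measurable h" "AE x in h. \<xi> x = \<eta> x"
  shows "L2_norm h \<xi> = L2_norm h \<eta>"
  unfolding L2_norm_def using assms by (intro arg_cong[where f = sqrt] integral_cong_AE) auto

lemma sq_integral_linear_bound:
  assumes [measurable]: "\<xi> \<in> borel_measurable h" "\<eta> \<in> borel_measurable h"
  shows "sq_integral h (\<lambda>x. a * \<xi> x + b * \<eta> x) \<le>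
    ennreal (2 * (cmod a)\<^sup>2) * sq_integral h \<xi> + ennreal (2 * (cmod b)\<^sup>2) * sq_integral h \<eta>"
proof -
  have "(cmod (a * \<xi> x + b * \<eta> x))\<^sup>2 \<le> 2 * (cmod a)\<^sup>2 * (cmod (\<xi> x))\<^sup>2 + 2 * (cmod b)\<^sup>2 * (cmod (\<eta> x))\<^sup>2" for x
  proof -
    have "(cmod (a * \<xi> x + b * \<eta> x))\<^sup>2 \<le> (cmod (a * \<xi> x) + cmod (b * \<eta> x))\<^sup>2"
      by (intro power_mono norm_triangle_ineq) simp
    also have "\<dots> \<le> 2 * (cmod (a * \<xi> x))\<^sup>2 + 2 * (cmod (b * \<eta> x))\<^sup>2"
      using sum_squares_bound[of "cmod (a * \<xi> x)" "cmod (b * \<eta> x)"] by (simp add: power2_sum)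
    finally show ?thesis by (simp add: norm_mult power_mult_distrib)
  qed
  then have "sq_integral h (\<lambda>x. a * \<xi> x + b * \<eta> x) \<le>
      (\<integral>\<^sup>+x. ennreal (2 * (cmod a)\<^sup>2) * sq (\<xi> x) + ennreal (2 * (cmod b)\<^sup>2) * sq (\<eta> x) \<partial>h)"
    unfolding sq_integral_def
    by (intro nn_integral_mono) (simp add: ennreal_mult[symmetric] ennreal_plus[symmetric] ennreal_leI del: ennreal_plus)
  also have "\<dots> = ennreal (2 * (cmod a)\<^sup>2) * sq_integral h \<xi> + ennreal (2 * (cmod b)\<^sup>2) * sq_integral h \<eta>"
    unfolding sq_integral_def by (simp add: nn_integral_add nn_integral_cmult)
  finally show ?thesis .
qed

lemma L2_linear:
  assumes "\<xi> \<in> L2 h" "\<eta> \<in> L2 h"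
  shows "(\<lambda>x. a * \<xi> x + b * \<eta> x) \<in> L2 h"
proof -
  have m: "\<xi> \<in> borel_measurable h" "\<eta> \<in> borel_measurable h" using assms by (simp_all add: L2_iff)
  have "sq_integral h (\<lambda>x. a * \<xi> x + b * \<eta> x) < \<infinity>"
    by (rule le_less_trans[OF sq_integral_linear_bound[OF m]])
       (use assms in \<open>simp add: L2_iff ennreal_mult_less_top\<close>)
  then show ?thesis using m by (simp add: L2_iff)
qed

text \<open>From |F| \<le> 1 + |F|^2: over a finite measure, square-integrable functions are
  integrable.\<close>

lemma (in finite_measure) integrable_sq:
  fixes F :: "'a \<Rightarrow> complex"
  assumes [measurable]: "F \<in> borel_measurable M" and "(\<integral>\<^sup>+x. sq (F x) \<partial>M) < \<infinity>"
  shows "integrable M F"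
proof (rule integrableI_bounded)
  have "cmod (F x) \<le> 1 + (cmod (F x))\<^sup>2" for x
    using sum_squares_bound[of 1 "cmod (F x)"] norm_ge_zero[of "F x"] unfolding power_one mult_1_right by linarith
  then have "(\<integral>\<^sup>+x. ennreal (cmod (F x)) \<partial>M) \<le> (\<integral>\<^sup>+x. 1 + sq (F x) \<partial>M)"
    by (intro nn_integral_mono) (simp add: ennreal_plus[symmetric] ennreal_leI del: ennreal_plus flip: ennreal_1)
  also have "\<dots> < \<infinity>"
    using assms by (simp add: nn_integral_add emeasure_eq_measure)
  finally show "(\<integral>\<^sup>+x. ennreal (cmod (F x)) \<partial>M) < \<infinity>" .
qed fact

text \<open>\<open>haar_measure\<close> makes each single translation measurable; the Fubini
  arguments require multiplication to be jointly measurable for the product sigma-algebra.\<close>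

locale haar_group = comm_group G for G (structure) +
  fixes T :: "'a topology" and h :: "'a measure"
  assumes haar: "haar_measure G T h"
    and sigma_finite_haar: "sigma_finite_measure h"
    and measurable_mult_pair: "(\<lambda>(x, y). x \<otimes> y) \<in> h \<Otimes>\<^sub>M h \<rightarrow>\<^sub>M h"
    and measurable_inv_haar [measurable]: "m_inv G \<in> h \<rightarrow>\<^sub>M h"
begin

abbreviation "conv \<equiv> left_regular G T"

sublocale H: sigma_finite_measure h by (rule sigma_finite_haar)

lemma sets_h: "sets h = sets (borel_of T)" and topspace_T: "topspace T = carrier G"
  using haar by (auto simp: haar_measure_def)

lemma space_h: "space h = carrier G"
  using haar_measure_space[OF haar] by simp

lemma space_eq_carrier: "sets m = sets h \<Longrightarrow> space m = carrier G"
  using sets_eq_imp_space_eq[of m h] by (simp add: space_h)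

lemma measurable_inv' [measurable (raw)]:
  "f \<in> N \<rightarrow>\<^sub>M h \<Longrightarrow> (\<lambda>x. inv (f x)) \<in> N \<rightarrow>\<^sub>M h"
  by (rule measurable_compose[OF _ measurable_inv_haar])

lemma measurable_mult [measurable (raw)]:
  "f \<in> N \<rightarrow>\<^sub>M h \<Longrightarrow> g \<in> N \<rightarrow>\<^sub>M h \<Longrightarrow> (\<lambda>x. f x \<otimes> g x) \<in> N \<rightarrow>\<^sub>M h"
  using measurable_compose[OF measurable_Pair measurable_mult_pair, of f N g] by simp

lemma nn_integral_translate:
  assumes g: "g \<in> carrier G" and F: "F \<in> borel_measurable h"
  shows "(\<integral>\<^sup>+x. F (g \<otimes> x) \<partial>h) = (\<integral>\<^sup>+x. F x \<partial>h)"
proof -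
  have d: "distr h h (\<lambda>x. g \<otimes> x) = h" and m: "(\<lambda>x. g \<otimes> x) \<in> h \<rightarrow>\<^sub>M h"
    using haar g by (auto simp: haar_measure_def)
  have "(\<integral>\<^sup>+x. F x \<partial>h) = (\<integral>\<^sup>+x. F x \<partial>distr h h (\<lambda>x. g \<otimes> x))" by (simp only: d)
  also have "\<dots> = (\<integral>\<^sup>+x. F (g \<otimes> x) \<partial>h)" by (rule nn_integral_distr[OF m]) (simp add: d F)
  finally show ?thesis ..
qed

text \<open>Total mass 1 allows an average over \<open>k\<close> to be inserted for free.
  Translating x by k^-1 turns F(x^-1) into F(x^-1 k), and after exchanging the integrals invariance
  in \<open>k\<close> removes x.\<close>

lemma nn_integral_inverse:
  assumes fin: "emeasure h (space h) = 1" and [measurable]: "F \<in> borel_measurable h"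
  shows "(\<integral>\<^sup>+x. F (inv x) \<partial>h) = (\<integral>\<^sup>+x. F x \<partial>h)"
proof -
  interpret P: pair_sigma_finite h h by unfold_locales
  have "(\<integral>\<^sup>+x. F (inv x) \<partial>h) = (\<integral>\<^sup>+k. (\<integral>\<^sup>+x. F (inv x) \<partial>h) \<partial>h)" by (simp add: fin)
  also have "\<dots> = (\<integral>\<^sup>+k. (\<integral>\<^sup>+x. F (inv x \<otimes> k) \<partial>h) \<partial>h)"
  proof (rule nn_integral_cong)
    fix k assume "k \<in> space h"
    then have k: "k \<in> carrier G" by (simp add: space_h)
    have "(\<integral>\<^sup>+x. F (inv x) \<partial>h) = (\<integral>\<^sup>+x. F (inv (inv k \<otimes> x)) \<partial>h)"
      using k by (intro nn_integral_translate[symmetric]) auto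
    also have "\<dots> = (\<integral>\<^sup>+x. F (inv x \<otimes> k) \<partial>h)"
      using k by (intro nn_integral_cong) (simp add: space_h inv_mult_group)
    finally show "(\<integral>\<^sup>+x. F (inv x) \<partial>h) = (\<integral>\<^sup>+x. F (inv x \<otimes> k) \<partial>h)" .
  qed
  also have "\<dots> = (\<integral>\<^sup>+x. (\<integral>\<^sup>+k. F (inv x \<otimes> k) \<partial>h) \<partial>h)" by (rule P.Fubini') measurable
  also have "\<dots> = (\<integral>\<^sup>+x. (\<integral>\<^sup>+k. F k \<partial>h) \<partial>h)"
    by (intro nn_integral_cong nn_integral_translate) (auto simp: space_h)
  finally show ?thesis by (simp add: fin)
qed

lemma AE_translate:
  assumes g: "g \<in> carrier G" and P: "{x \<in> space h. P x} \<in> sets h" and ae: "AE x in h. P x"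
  shows "AE x in h. P (g \<otimes> x)"
proof -
  have d: "distr h h (\<lambda>x. g \<otimes> x) = h" and m: "(\<lambda>x. g \<otimes> x) \<in> h \<rightarrow>\<^sub>M h"
    using haar g by (auto simp: haar_measure_def)
  from ae have "AE x in distr h h (\<lambda>x. g \<otimes> x). P x" by (simp only: d)
  then show ?thesis by (subst (asm) AE_distr_iff[OF m P])
qed

section \<open>Convolution with a measure given by a density\<close>

context
  fixes m \<rho> assumes md: "complex_density m \<rho>" and sets_m: "sets m = sets h"
begin

interpretation D: complex_density m \<rho> by (rule md)
interpretation P: pair_sigma_finite m h by unfold_locales

lemma nn_integral_translates:
  assumes [measurable]: "\<xi> \<in> borel_measurable h"
  shows "(\<integral>\<^sup>+g. (\<integral>\<^sup>+s. sq (\<xi> (inv s \<otimes> g)) \<partial>m) \<partial>h) = emeasure m (space m) * sq_integral h \<xi>"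
proof -
  note [measurable_cong] = sets_m
  have "(\<integral>\<^sup>+g. (\<integral>\<^sup>+s. sq (\<xi> (inv s \<otimes> g)) \<partial>m) \<partial>h) =
      (\<integral>\<^sup>+s. (\<integral>\<^sup>+g. sq (\<xi> (inv s \<otimes> g)) \<partial>h) \<partial>m)"
    by (rule P.Fubini') measurable
  also have "\<dots> = (\<integral>\<^sup>+s. sq_integral h \<xi> \<partial>m)"
    using sets_eq_imp_space_eq[OF sets_m] unfolding sq_integral_def
    by (intro nn_integral_cong nn_integral_translate[where F = "\<lambda>x. sq (\<xi> x)"])
       (auto simp: space_h)
  finally show ?thesis by (simp add: mult.commute)
qed

lemma AE_integrable_translates:
  assumes \<xi>: "\<xi> \<in> L2 h"
  shows "AE g in h. integrable m (\<lambda>s. \<xi> (inv s \<otimes> g))"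
proof -
  note [measurable_cong] = sets_m
  have [measurable]: "\<xi> \<in> borel_measurable h" using \<xi> by (rule L2_measurable)
  have "AE g in h. (\<integral>\<^sup>+s. sq (\<xi> (inv s \<otimes> g)) \<partial>m) \<noteq> \<infinity>"
  proof (rule nn_integral_PInf_AE)
    show "(\<integral>\<^sup>+g. (\<integral>\<^sup>+s. sq (\<xi> (inv s \<otimes> g)) \<partial>m) \<partial>h) \<noteq> \<infinity>"
      using \<xi> by (simp add: nn_integral_translates L2_iff D.emeasure_eq_measure ennreal_mult_eq_top_iff less_top)
  qed measurable
  then show ?thesis
  proof (rule AE_mp, intro AE_I2 impI)
    fix g assume [measurable]: "g \<in> space h" and "(\<integral>\<^sup>+s. sq (\<xi> (inv s \<otimes> g)) \<partial>m) \<noteq> \<infinity>"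
    then show "integrable m (\<lambda>s. \<xi> (inv s \<otimes> g))"
      by (intro D.integrable_sq) (auto simp: less_top)
  qed
qed

text \<open>Only for almost every g is s \<mapsto> \<xi>(s^-1 g) known to be integrable; elsewhere
  default values of the Jordan integrals may intervene.\<close>

lemma AE_left_regular_eq:
  assumes \<mu>: "\<forall>A\<in>sets h. \<mu> A = L1_measure m \<rho> A" and \<xi>: "\<xi> \<in> L2 h"
  shows "AE g in h. conv \<mu> \<xi> g = (LINT s|m. \<rho> s * \<xi> (inv s \<otimes> g))"
  using AE_integrable_translates[OF \<xi>]
  unfolding left_regular_def
  by eventually_elim (intro D.complex_measure_integral_eq; simp add: sets_m sets_h[symmetric] \<mu>)

text \<open>The crude bound by total mass. It is needed to know that convolution is a bounded
  operator at all, before sharper bounds are compared.\<close>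

lemma sq_integral_convolution:
  assumes [measurable]: "\<xi> \<in> borel_measurable h"
  shows "sq_integral h (\<lambda>g. LINT s|m. \<rho> s * \<xi> (inv s \<otimes> g)) \<le> ennreal ((measure m (space m))\<^sup>2) * sq_integral h \<xi>"
proof -
  note [measurable_cong] = sets_m
  have "sq (LINT s|m. \<rho> s * \<xi> (inv s \<otimes> g)) \<le>
      emeasure m (space m) * (\<integral>\<^sup>+s. sq (\<xi> (inv s \<otimes> g)) \<partial>m)" if [measurable]: "g \<in> space h" for g
  proof -
    have "sq (LINT s|m. \<rho> s * \<xi> (inv s \<otimes> g)) \<le>
      emeasure m (space m) * (\<integral>\<^sup>+s. sq (\<rho> s * \<xi> (inv s \<otimes> g)) \<partial>m)"
      by (rule nn_integral_square_bound) measurable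
    also have "\<dots> \<le> emeasure m (space m) * (\<integral>\<^sup>+s. sq (\<xi> (inv s \<otimes> g)) \<partial>m)"
      using D.norm_\<rho>
      by (intro mult_left_mono nn_integral_mono ennreal_leI power_mono)
         (auto simp: norm_mult intro!: mult_left_le_one_le)
    finally show ?thesis .
  qed
  then have "sq_integral h (\<lambda>g. LINT s|m. \<rho> s * \<xi> (inv s \<otimes> g)) \<le>
      (\<integral>\<^sup>+g. emeasure m (space m) * (\<integral>\<^sup>+s. sq (\<xi> (inv s \<otimes> g)) \<partial>m) \<partial>h)"
    unfolding sq_integral_def by (intro nn_integral_mono)
  also have "\<dots> = emeasure m (space m) * (emeasure m (space m) * sq_integral h \<xi>)"
    by (subst nn_integral_cmult) (simp_all add: nn_integral_translates)
  also have "\<dots> = ennreal ((measure m (space m))\<^sup>2) * sq_integral h \<xi>"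
    by (simp add: D.emeasure_eq_measure mult.assoc[symmetric] ennreal_mult[symmetric] power2_eq_square)
  finally show ?thesis .
qed

end

abbreviation "cmeasure \<equiv> complex_measure (borel_of T)"

lemma density_rep:
  assumes "cmeasure \<mu>"
  obtains m \<rho> where "complex_density m \<rho>" "sets m = sets h" "\<forall>A\<in>sets h. \<mu> A = L1_measure m \<rho> A"
  using complex_measure_density[OF assms] unfolding sets_h[symmetric] by metis

text \<open>Proved on the four Jordan parts, because the formula through densities holds only almost
  everywhere.\<close>

lemma measurable_left_regular [measurable]:
  assumes \<mu>: "cmeasure \<mu>" and [measurable]: "\<xi> \<in> borel_measurable h"
  shows "conv \<mu> \<xi> \<in> borel_measurable h"
proof -
  have *: "(\<lambda>g. LINT s|positive_part (borel_of T) \<nu>. \<xi> (inv s \<otimes> g)) \<in> borel_measurable h"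
    if "signed_measure (borel_of T) \<nu>" for \<nu>
  proof -
    interpret signed_measure "borel_of T" \<nu> by fact
    interpret P: finite_measure "positive_part (borel_of T) \<nu>" by (rule finite_positive_part)
    have "(\<lambda>(g, s). \<xi> (inv s \<otimes> g)) \<in> borel_measurable (h \<Otimes>\<^sub>M h)" by measurable
    also have "sets (h \<Otimes>\<^sub>M h) = sets (h \<Otimes>\<^sub>M positive_part (borel_of T) \<nu>)"
      by (intro sets_pair_measure_cong) (simp_all add: sets_h)
    then have "borel_measurable (h \<Otimes>\<^sub>M h) = borel_measurable (h \<Otimes>\<^sub>M positive_part (borel_of T) \<nu>)"
      by (rule measurable_cong_sets) simp
    finally show ?thesis by (rule P.borel_measurable_lebesgue_integral)
  qed
  note [measurable] = complex_measure_signed[OF \<mu>, THEN *]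
  show ?thesis unfolding left_regular_def complex_measure_integral_def by measurable
qed

text \<open>The constant bounds the square of the operator norm.\<close>

definition op_bound :: "('a set \<Rightarrow> complex) \<Rightarrow> real \<Rightarrow> bool" where
  "op_bound \<mu> C \<longleftrightarrow> (\<forall>\<xi>\<in>L2 h. sq_integral h (conv \<mu> \<xi>) \<le> ennreal C * sq_integral h \<xi>)"

lemma op_bound_cong:
  assumes "\<And>A. A \<in> sets h \<Longrightarrow> \<mu> A = \<nu> A" shows "op_bound \<mu> = op_bound \<nu>"
  using complex_measure_integral_cong[of "borel_of T" \<mu> \<nu>] assms
  by (simp add: op_bound_def left_regular_def[abs_def] sets_h fun_eq_iff)

lemma ex_op_bound:
  assumes \<mu>: "cmeasure \<mu>"
  obtains C where "0 \<le> C" "op_bound \<mu> (C\<^sup>2)"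
proof -
  obtain m \<rho> where m: "complex_density m \<rho>" "sets m = sets h" "\<forall>A\<in>sets h. \<mu> A = L1_measure m \<rho> A"
    using density_rep[OF \<mu>] by blast
  show thesis
  proof (rule that)
    show "op_bound \<mu> ((measure m (space m))\<^sup>2)"
      unfolding op_bound_def
    proof
      fix \<xi> assume \<xi>: "\<xi> \<in> L2 h"
      show "sq_integral h (conv \<mu> \<xi>) \<le> ennreal ((measure m (space m))\<^sup>2) * sq_integral h \<xi>"
        unfolding sq_integral_cong_AE[OF AE_left_regular_eq[OF m \<xi>]]
        by (rule sq_integral_convolution[OF m(1,2) L2_measurable[OF \<xi>]])
    qed
  qed simp
qed

lemma L2_left_regular:
  assumes \<mu>: "cmeasure \<mu>" and \<xi>: "\<xi> \<in> L2 h" shows "conv \<mu> \<xi> \<in> L2 h"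
proof -
  obtain C where "op_bound \<mu> (C\<^sup>2)" using ex_op_bound[OF \<mu>] by blast
  then have "sq_integral h (conv \<mu> \<xi>) \<le> ennreal (C\<^sup>2) * sq_integral h \<xi>"
    using \<xi> by (simp add: op_bound_def)
  also have "\<dots> < \<infinity>" using \<xi> by (simp add: L2_iff ennreal_mult_less_top)
  finally show ?thesis using measurable_left_regular[OF \<mu> L2_measurable[OF \<xi>]] by (simp add: L2_iff)
qed

lemma op_bound_L2_norm:
  assumes \<mu>: "cmeasure \<mu>" and "0 \<le> C"
  shows "op_bound \<mu> (C\<^sup>2) \<longleftrightarrow> (\<forall>\<xi>\<in>L2 h. L2_norm h (conv \<mu> \<xi>) \<le> C * L2_norm h \<xi>)"
proof -
  have "sq_integral h (conv \<mu> \<xi>) \<le> ennreal (C\<^sup>2) * sq_integral h \<xi> \<longleftrightarrow>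
      L2_norm h (conv \<mu> \<xi>) \<le> C * L2_norm h \<xi>" if \<xi>: "\<xi> \<in> L2 h" for \<xi>
  proof -
    have "sq_integral h (conv \<mu> \<xi>) \<le> ennreal (C\<^sup>2) * sq_integral h \<xi> \<longleftrightarrow>
        (L2_norm h (conv \<mu> \<xi>))\<^sup>2 \<le> (C * L2_norm h \<xi>)\<^sup>2"
      using sq_integral_L2_norm[OF \<xi>] sq_integral_L2_norm[OF L2_left_regular[OF \<mu> \<xi>]]
      by (simp add: ennreal_mult[symmetric] power_mult_distrib)
    also have "\<dots> \<longleftrightarrow> L2_norm h (conv \<mu> \<xi>) \<le> C * L2_norm h \<xi>"
      using \<open>0 \<le> C\<close> by (intro abs_le_square_iff[symmetric, THEN trans]) (simp add: L2_norm_nonneg)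
    finally show ?thesis .
  qed
  then show ?thesis by (simp add: op_bound_def)
qed

lemma AE_left_regular_linear:
  assumes \<mu>: "cmeasure \<mu>" and \<xi>: "\<xi> \<in> L2 h" and \<eta>: "\<eta> \<in> L2 h"
  shows "AE g in h. conv \<mu> (\<lambda>x. a * \<xi> x + b * \<eta> x) g =
    a * conv \<mu> \<xi> g + b * conv \<mu> \<eta> g"
proof -
  obtain m \<rho> where m: "complex_density m \<rho>" "sets m = sets h" "\<forall>A\<in>sets h. \<mu> A = L1_measure m \<rho> A"
    using density_rep[OF \<mu>] by blast
  interpret D: complex_density m \<rho> by fact
  from AE_left_regular_eq[OF m \<xi>] AE_left_regular_eq[OF m \<eta>] AE_left_regular_eq[OF m L2_linear[OF \<xi> \<eta>, of a b]]
    AE_integrable_translates[OF m(1,2) \<xi>] AE_integrable_translates[OF m(1,2) \<eta>]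
  show ?thesis
  proof eventually_elim
    case (elim g)
    have "(LINT s|m. \<rho> s * (a * \<xi> (inv s \<otimes> g) + b * \<eta> (inv s \<otimes> g))) =
        (LINT s|m. a * (\<rho> s * \<xi> (inv s \<otimes> g)) + b * (\<rho> s * \<eta> (inv s \<otimes> g)))"
      by (intro Bochner_Integration.integral_cong) (simp_all add: algebra_simps)
    then show ?case using elim by (simp add: D.integrable_\<rho>_mult)
  qed
qed

lemma AE_left_regular_diff:
  assumes \<mu>: "cmeasure \<mu>" and \<nu>: "cmeasure \<nu>" and \<xi>: "\<xi> \<in> L2 h"
  shows "AE g in h. conv (\<lambda>A. \<mu> A - \<nu> A) \<xi> g = conv \<mu> \<xi> g - conv \<nu> \<xi> g"
proof -
  obtain m \<rho> \<sigma> where m: "complex_density m \<rho>" "complex_density m \<sigma>" "complex_density m (\<lambda>x. \<rho> x - \<sigma> x)"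
    "sets m = sets h" and eq: "\<forall>A\<in>sets h. \<mu> A = L1_measure m \<rho> A" "\<forall>A\<in>sets h. \<nu> A = L1_measure m \<sigma> A"
    "\<forall>A\<in>sets h. \<mu> A - \<nu> A = L1_measure m (\<lambda>x. \<rho> x - \<sigma> x) A"
    by (rule complex_measure_diff_density[OF \<mu> \<nu>, folded sets_h]) (rule that)
  interpret D: complex_density m \<rho> by fact
  interpret E: complex_density m \<sigma> by fact
  from AE_left_regular_eq[OF m(1,4) eq(1) \<xi>] AE_left_regular_eq[OF m(2,4) eq(2) \<xi>] AE_left_regular_eq[OF m(3,4) eq(3) \<xi>]
    AE_integrable_translates[OF m(1,4) \<xi>]
  show ?thesis
    by eventually_elim (simp add: left_diff_distrib D.integrable_\<rho>_mult E.integrable_\<rho>_mult)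
qed

section \<open>Operator norms and membership in the reduced C*-algebra\<close>

lemma bounded_operator_left_regular:
  assumes "cmeasure \<mu>" shows "bounded_operator h (conv \<mu>)"
proof -
  obtain C where "0 \<le> C" "op_bound \<mu> (C\<^sup>2)" using ex_op_bound[OF assms] by blast
  then have "\<exists>C. \<forall>\<xi>\<in>L2 h. L2_norm h (conv \<mu> \<xi>) \<le> C * L2_norm h \<xi>"
    using op_bound_L2_norm[OF assms] by blast
  then show ?thesis
    unfolding bounded_operator_def using L2_left_regular[OF assms] AE_left_regular_linear[OF assms] by blast
qed

lemma zero_operator_iff:
  assumes \<mu>: "cmeasure \<mu>" shows "zero_operator h (conv \<mu>) \<longleftrightarrow> op_bound \<mu> 0"
proof -
  have "(AE x in h. conv \<mu> \<xi> x = 0) \<longleftrightarrow> sq_integral h (conv \<mu> \<xi>) = 0" if "\<xi> \<in> L2 h" for \<xi>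
    unfolding sq_integral_def using measurable_left_regular[OF \<mu> L2_measurable[OF that]]
    by (subst nn_integral_0_iff_AE) auto
  then show ?thesis by (auto simp: zero_operator_def op_bound_def)
qed

text \<open>\<open>operator_norm\<close> is a supremum of reals, so it dominates its members only
  for a set bounded above. The crude constant \<open>K\<close> provides this and also settles
  vectors of norm 0; all others are normalised.\<close>

lemma op_bound_iff_operator_norm:
  assumes \<mu>: "cmeasure \<mu>" and C: "0 \<le> C"
  shows "op_bound \<mu> (C\<^sup>2) \<longleftrightarrow> operator_norm h (conv \<mu>) \<le> C"
proof
  have z: "(\<lambda>_. 0) \<in> L2 h" "L2_norm h (\<lambda>_. 0) = 0" by (auto simp: L2_def L2_norm_def)
  assume "op_bound \<mu> (C\<^sup>2)"
  then have b: "L2_norm h (conv \<mu> \<xi>) \<le> C * L2_norm h \<xi>" if "\<xi> \<in> L2 h" for \<xi>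
    using op_bound_L2_norm[OF \<mu> C] that by blast
  show "operator_norm h (conv \<mu>) \<le> C"
    unfolding operator_norm_def
  proof (rule cSUP_least)
    show "{\<xi> \<in> L2 h. L2_norm h \<xi> \<le> 1} \<noteq> {}" using z by force
    fix \<xi> assume "\<xi> \<in> {\<xi> \<in> L2 h. L2_norm h \<xi> \<le> 1}"
    then have "L2_norm h (conv \<mu> \<xi>) \<le> C * L2_norm h \<xi>" "C * L2_norm h \<xi> \<le> C * 1"
      using C b by (blast, intro mult_left_mono) auto
    then show "L2_norm h (conv \<mu> \<xi>) \<le> C" by simp
  qed
next
  assume n: "operator_norm h (conv \<mu>) \<le> C"
  obtain K where K: "0 \<le> K" "op_bound \<mu> (K\<^sup>2)" using ex_op_bound[OF \<mu>] by blast
  then have b: "L2_norm h (conv \<mu> \<xi>) \<le> K * L2_norm h \<xi>" if "\<xi> \<in> L2 h" for \<xi>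
    using op_bound_L2_norm[OF \<mu> K(1)] that by blast
  have bdd: "bdd_above ((\<lambda>\<xi>. L2_norm h (conv \<mu> \<xi>)) ` {\<xi> \<in> L2 h. L2_norm h \<xi> \<le> 1})"
  proof (rule bdd_aboveI2)
    fix \<xi> assume "\<xi> \<in> {\<xi> \<in> L2 h. L2_norm h \<xi> \<le> 1}"
    then have "L2_norm h (conv \<mu> \<xi>) \<le> K * L2_norm h \<xi>" "K * L2_norm h \<xi> \<le> K * 1"
      using K b by (blast, intro mult_left_mono) auto
    then show "L2_norm h (conv \<mu> \<xi>) \<le> K" by simp
  qed
  have "L2_norm h (conv \<mu> \<xi>) \<le> C * L2_norm h \<xi>" if \<xi>: "\<xi> \<in> L2 h" for \<xi>
  proof (cases "L2_norm h \<xi> = 0")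
    case True
    then show ?thesis using b[OF \<xi>] by simp
  next
    case False
    define r where "r = L2_norm h \<xi>"
    have r: "r > 0" using False L2_norm_nonneg[of h \<xi>] by (simp add: r_def)
    define \<xi>' where "\<xi>' x = of_real (1 / r) * \<xi> x" for x
    have \<xi>': "\<xi>' \<in> L2 h" using L2_linear[OF \<xi> \<xi>, of "of_real (1 / r)" 0] by (simp add: \<xi>'_def[abs_def])
    have norm_scale: "L2_norm h (\<lambda>x. of_real (1 / r) * \<zeta> x) = L2_norm h \<zeta> / r" for \<zeta>
      using r unfolding L2_norm_def
      by (simp add: norm_mult norm_divide power_mult_distrib power_divide real_sqrt_divide)
    have "L2_norm h \<xi>' = 1" using r unfolding \<xi>'_def[abs_def] norm_scale by (simp add: r_def[symmetric])
    then have "L2_norm h (conv \<mu> \<xi>') \<le> operator_norm h (conv \<mu>)"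
      unfolding operator_norm_def using \<xi>' by (intro cSUP_upper bdd) auto
    also have "L2_norm h (conv \<mu> \<xi>') = L2_norm h (\<lambda>x. of_real (1 / r) * conv \<mu> \<xi> x)"
    proof (rule L2_norm_cong_AE)
      show "AE x in h. conv \<mu> \<xi>' x = of_real (1 / r) * conv \<mu> \<xi> x"
        using AE_left_regular_linear[OF \<mu> \<xi> \<xi>, of "of_real (1 / r)" 0] by (simp add: \<xi>'_def[abs_def])
    qed (use measurable_left_regular[OF \<mu> L2_measurable] \<xi> \<xi>' in auto)
    finally have "L2_norm h (conv \<mu> \<xi>) / r \<le> C" using n unfolding norm_scale by linarith
    then show ?thesis using r by (simp add: r_def[symmetric] divide_le_eq mult.commute)
  qed
  then show "op_bound \<mu> (C\<^sup>2)" using op_bound_L2_norm[OF \<mu> C] by blast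
qed

lemma cmeasure_L1_measure: "integrable h f \<Longrightarrow> cmeasure (L1_measure h f)"
  by (intro complex_measure_L1_measure sets_h)

text \<open>As \<epsilon> ranges over all positive numbers, bounds on the norm and on its square are
  interchangeable: sqrt \<epsilon> serves in one direction, (\<epsilon>/2)^2 in the other, where
  halving restores the strict inequality.\<close>

lemma left_regular_in_Cstar_iff:
  assumes \<mu>: "cmeasure \<mu>"
  shows "conv \<mu> \<in> reduced_group_Cstar G T h \<longleftrightarrow>
    (\<forall>\<epsilon>>0. \<exists>f. integrable h f \<and> op_bound (\<lambda>A. \<mu> A - L1_measure h f A) \<epsilon>)"
proof -
  have eq: "operator_norm h (\<lambda>\<xi> x. conv \<mu> \<xi> x - conv (L1_measure h f) \<xi> x) =
      operator_norm h (conv (\<lambda>A. \<mu> A - L1_measure h f A))" if f: "integrable h f" for f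
    unfolding operator_norm_def
  proof (rule SUP_cong[OF refl])
    fix \<xi> assume "\<xi> \<in> {\<xi> \<in> L2 h. L2_norm h \<xi> \<le> 1}"
    then have \<xi>: "\<xi> \<in> L2 h" by simp
    show "L2_norm h (\<lambda>x. conv \<mu> \<xi> x - conv (L1_measure h f) \<xi> x) =
        L2_norm h (conv (\<lambda>A. \<mu> A - L1_measure h f A) \<xi>)"
      using AE_left_regular_diff[OF \<mu> cmeasure_L1_measure[OF f] \<xi>]
        measurable_left_regular[OF _ L2_measurable[OF \<xi>]] \<mu> cmeasure_L1_measure[OF f]
      by (intro L2_norm_cong_AE) (auto intro: complex_measure_diff)
  qed
  have d: "cmeasure (\<lambda>A. \<mu> A - L1_measure h f A)" if "integrable h f" for f
    by (intro complex_measure_diff \<mu> cmeasure_L1_measure that)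
  have "(\<forall>\<epsilon>>0. \<exists>f. integrable h f \<and> operator_norm h (conv (\<lambda>A. \<mu> A - L1_measure h f A)) < \<epsilon>) \<longleftrightarrow>
      (\<forall>\<epsilon>>0. \<exists>f. integrable h f \<and> op_bound (\<lambda>A. \<mu> A - L1_measure h f A) \<epsilon>)"
  proof (intro iffI allI impI)
    fix \<epsilon> :: real assume \<epsilon>: "\<epsilon> > 0"
      and "\<forall>\<epsilon>>0. \<exists>f. integrable h f \<and> operator_norm h (conv (\<lambda>A. \<mu> A - L1_measure h f A)) < \<epsilon>"
    then obtain f where f: "integrable h f" "operator_norm h (conv (\<lambda>A. \<mu> A - L1_measure h f A)) \<le> sqrt \<epsilon>"
      using less_imp_le real_sqrt_gt_zero[OF \<epsilon>] by blast
    then have "op_bound (\<lambda>A. \<mu> A - L1_measure h f A) ((sqrt \<epsilon>)\<^sup>2)"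
      using op_bound_iff_operator_norm[OF d[OF f(1)], of "sqrt \<epsilon>"] \<epsilon> by simp
    then show "\<exists>f. integrable h f \<and> op_bound (\<lambda>A. \<mu> A - L1_measure h f A) \<epsilon>" using f \<epsilon> by auto
  next
    fix \<epsilon> :: real assume \<epsilon>: "\<epsilon> > 0"
      and "\<forall>\<epsilon>>0. \<exists>f. integrable h f \<and> op_bound (\<lambda>A. \<mu> A - L1_measure h f A) \<epsilon>"
    then obtain f where f: "integrable h f" "op_bound (\<lambda>A. \<mu> A - L1_measure h f A) ((\<epsilon> / 2)\<^sup>2)"
      by (metis half_gt_zero zero_less_power)
    then show "\<exists>f. integrable h f \<and> operator_norm h (conv (\<lambda>A. \<mu> A - L1_measure h f A)) < \<epsilon>"
      using op_bound_iff_operator_norm[OF d[OF f(1)], of "\<epsilon> / 2"] \<epsilon> by (intro exI[of _ f]) auto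
  qed
  then show ?thesis
    unfolding reduced_group_Cstar_def using bounded_operator_left_regular[OF \<mu>] eq by (simp cong: conj_cong)
qed

section \<open>Supports and witnesses for restricted multiplicity\<close>

lemma mult_inv_cancel: "x \<in> carrier G \<Longrightarrow> y \<in> carrier G \<Longrightarrow> x \<otimes> (inv x \<otimes> y) = y"
  by (simp add: m_assoc[symmetric])

text \<open>The complement of the support is a possibly uncountable union of null open sets; members
  of a countable base contained in them already cover it.\<close>

lemma measures_on_iff:
  assumes T: "second_countable T" and E: "closedin T E"
  shows "\<mu> \<in> measures_on T E \<longleftrightarrow> cmeasure \<mu> \<and> (\<forall>A\<in>sets h. A \<inter> E = {} \<longrightarrow> \<mu> A = 0)"
proof (intro iffI conjI ballI impI)
  assume \<mu>: "\<mu> \<in> measures_on T E"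
  then show "cmeasure \<mu>" by (simp add: measures_on_def)
  fix A assume A: "A \<in> sets h" "A \<inter> E = {}"
  obtain B where B: "countable B" "\<And>V. V \<in> B \<Longrightarrow> openin T V"
      "\<And>U x. openin T U \<Longrightarrow> x \<in> U \<Longrightarrow> \<exists>V\<in>B. x \<in> V \<and> V \<subseteq> U"
    by (rule second_countableE[OF T]) (rule that)
  let ?B = "{V \<in> B. \<forall>A\<in>sets (borel_of T). A \<subseteq> V \<longrightarrow> \<mu> A = 0}"
  show "\<mu> A = 0"
  proof (rule complex_measure_null_UN[OF \<open>cmeasure \<mu>\<close>, of ?B])
    show "A \<subseteq> \<Union>?B"
    proof
      fix x assume "x \<in> A"
      moreover have "A \<subseteq> topspace T" using sets.sets_into_space[OF A(1)] by (simp add: space_h topspace_T)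
      ultimately have "x \<in> \<Union>{U. openin T U \<and> (\<forall>A\<in>sets (borel_of T). A \<subseteq> U \<longrightarrow> \<mu> A = 0)}"
        using \<mu> A(2) by (auto simp: measures_on_def measure_support_def)
      then obtain U where "openin T U" "x \<in> U" "\<forall>A\<in>sets (borel_of T). A \<subseteq> U \<longrightarrow> \<mu> A = 0" by auto
      then show "x \<in> \<Union>?B" using B(3)[of U x] by blast
    qed
    show "?B \<subseteq> sets (borel_of T)" using B(2) openin_in_borel_of by blast
  qed (use A B(1) in \<open>auto simp: sets_h\<close>)
next
  assume "cmeasure \<mu> \<and> (\<forall>A\<in>sets h. A \<inter> E = {} \<longrightarrow> \<mu> A = 0)"
  then have \<mu>: "cmeasure \<mu>" and null: "\<And>A. A \<in> sets h \<Longrightarrow> A \<inter> E = {} \<Longrightarrow> \<mu> A = 0" by blast+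
  have "\<forall>A\<in>sets (borel_of T). A \<subseteq> topspace T - E \<longrightarrow> \<mu> A = 0"
    using null unfolding sets_h by blast
  moreover have "openin T (topspace T - E)" using E by (simp add: closedin_def)
  ultimately have "topspace T - E \<subseteq> \<Union>{U. openin T U \<and> (\<forall>A\<in>sets (borel_of T). A \<subseteq> U \<longrightarrow> \<mu> A = 0)}"
    by (intro Union_upper CollectI conjI)
  then have "measure_support T \<mu> \<subseteq> E" unfolding measure_support_def by blast
  then show "\<mu> \<in> measures_on T E" using \<mu> by (simp add: measures_on_def)
qed

text \<open>A measure whose convolution operator is a nonzero element of the intersection of
  \<lambda>(M(E)) with the reduced C*-algebra. The choice of operator maps off \<open>L2\<close> no
  longer enters.\<close>

definition M0_witness :: "'a set \<Rightarrow> ('a set \<Rightarrow> complex) \<Rightarrow> bool" where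
  "M0_witness E \<mu> \<longleftrightarrow> cmeasure \<mu> \<and> (\<forall>A\<in>sets h. A \<inter> E = {} \<longrightarrow> \<mu> A = 0) \<and>
    (\<forall>\<epsilon>>0. \<exists>f. integrable h f \<and> op_bound (\<lambda>A. \<mu> A - L1_measure h f A) \<epsilon>) \<and> \<not> op_bound \<mu> 0"

lemma M0_set_iff:
  assumes T: "second_countable T" and E: "closedin T E"
  shows "M0_set G T h E \<longleftrightarrow> (\<exists>\<mu>. M0_witness E \<mu>)"
proof -
  have "M0_set G T h E \<longleftrightarrow> (\<exists>\<mu>\<in>measures_on T E. conv \<mu> \<in> reduced_group_Cstar G T h \<and>
      \<not> zero_operator h (conv \<mu>))"
    unfolding M0_set_def extended_uniqueness_set_def using E by fast
  also have "\<dots> \<longleftrightarrow> (\<exists>\<mu>. M0_witness E \<mu>)"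
    unfolding Bex_def
  proof (rule ex_cong1)
    fix \<mu>
    show "\<mu> \<in> measures_on T E \<and> conv \<mu> \<in> reduced_group_Cstar G T h \<and>
        \<not> zero_operator h (conv \<mu>) \<longleftrightarrow> M0_witness E \<mu>"
    proof (cases "cmeasure \<mu>")
      case True
      then show ?thesis
        unfolding M0_witness_def measures_on_iff[OF T E] left_regular_in_Cstar_iff[OF True] zero_operator_iff[OF True] using True by blast
    next
      case False
      then show ?thesis unfolding M0_witness_def measures_on_iff[OF T E] by blast
    qed
  qed
  finally show ?thesis .
qed

end


section \<open>Quotients with a Borel section\<close>

text \<open>Threefold products of elements of \<open>W\<close> stay in the range of \<open>s\<close>: two factors cover the set where
  \<open>\<phi> a\<close> below does not vanish, and the third one leaves room to move the point at which a
  convolution is evaluated.\<close>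

locale haar_section = Gr: haar_group G TG hG + Hr: haar_group H TH hH
  for G :: "('a, 'c) monoid_scheme" and TG hG and H :: "('b, 'd) monoid_scheme" and TH hH +
  fixes q :: "'a \<Rightarrow> 'b" and s :: "'b \<Rightarrow> 'a" and W :: "'a set"
  assumes q_hom: "q \<in> hom G H"
    and measurable_q [measurable]: "q \<in> hG \<rightarrow>\<^sub>M hH"
    and measurable_s [measurable]: "s \<in> hH \<rightarrow>\<^sub>M hG"
    and q_s: "\<And>x. x \<in> carrier H \<Longrightarrow> q (s x) = x"
    and countable_kernel: "countable (kernel G H q)"
    and emeasure_H: "emeasure hH (space hH) = 1"
    and fundamental [measurable]: "{x \<in> space hG. s (q x) = x} \<in> sets hG"
    and haar_quotient: "distr (density hG (indicator {x \<in> space hG. s (q x) = x})) hH q = hH"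
    and W [measurable]: "W \<in> sets hG" and W_pos: "emeasure hG W \<noteq> 0"
    and one_W: "\<one>\<^bsub>G\<^esub> \<in> W" and inv_W: "\<And>x. x \<in> W \<Longrightarrow> inv\<^bsub>G\<^esub> x \<in> W"
    and W_section: "\<And>x y z. x \<in> W \<Longrightarrow> y \<in> W \<Longrightarrow> z \<in> W \<Longrightarrow>
      s (q (x \<otimes>\<^bsub>G\<^esub> y \<otimes>\<^bsub>G\<^esub> z)) = x \<otimes>\<^bsub>G\<^esub> y \<otimes>\<^bsub>G\<^esub> z"
begin

abbreviation mult_G (infixl "\<odot>" 70) where "x \<odot> y \<equiv> x \<otimes>\<^bsub>G\<^esub> y"
abbreviation mult_H (infixl "\<star>" 70) where "x \<star> y \<equiv> x \<otimes>\<^bsub>H\<^esub> y"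
abbreviation inv_G ("iG _" [81] 80) where "iG x \<equiv> inv\<^bsub>G\<^esub> x"
abbreviation inv_H ("iH _" [81] 80) where "iH x \<equiv> inv\<^bsub>H\<^esub> x"

sublocale HP: finite_measure hH by standard (simp add: emeasure_H)
lemma measure_le_1: "measure hH A \<le> 1"
  using HP.bounded_measure[of A] by (simp add: measure_def emeasure_H)

sublocale hom: group_hom G H q
  by unfold_locales (rule q_hom)

lemma s_closed [simp]: "x \<in> carrier H \<Longrightarrow> s x \<in> carrier G"
  using measurable_space[OF measurable_s] by (simp add: Gr.space_h Hr.space_h)

text \<open>The range of \<open>s\<close>: a fundamental domain for the kernel of
  \<open>q\<close>.\<close>

definition Q :: "'a set" where "Q = {x \<in> space hG. s (q x) = x}"

lemma sets_Q [measurable]: "Q \<in> sets hG"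
  unfolding Q_def by (rule fundamental)

lemma W_subset_Q: "W \<subseteq> Q"
proof
  fix x assume x: "x \<in> W"
  then have "x \<in> carrier G" using sets.sets_into_space[OF W] by (auto simp: Gr.space_h)
  then show "x \<in> Q" using W_section[OF x one_W one_W] by (simp add: Q_def Gr.space_h)
qed

lemma nn_integral_quotient:
  assumes [measurable]: "F \<in> borel_measurable hH"
  shows "(\<integral>\<^sup>+x. F x \<partial>hH) = (\<integral>\<^sup>+x. indicator Q x * F (q x) \<partial>hG)"
proof -
  have "(\<integral>\<^sup>+x. F x \<partial>hH) = (\<integral>\<^sup>+x. F x \<partial>distr (density hG (indicator Q)) hH q)"
    by (simp only: haar_quotient Q_def)
  also have "\<dots> = (\<integral>\<^sup>+x. indicator Q x * F (q x) \<partial>hG)"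
    by (subst nn_integral_distr) (simp_all add: nn_integral_density)
  finally show ?thesis .
qed

lemma nn_integral_section:
  assumes [measurable]: "F \<in> borel_measurable hG"
  shows "(\<integral>\<^sup>+x. F (s x) \<partial>hH) = (\<integral>\<^sup>+x. indicator Q x * F x \<partial>hG)"
  by (subst nn_integral_quotient) (auto intro!: nn_integral_cong simp: indicator_def Q_def)

lemma nn_integral_section_le:
  assumes [measurable]: "F \<in> borel_measurable hG"
  shows "(\<integral>\<^sup>+x. F (s x) \<partial>hH) \<le> (\<integral>\<^sup>+x. F x \<partial>hG)"
  unfolding nn_integral_section[OF assms] by (intro nn_integral_mono) (auto simp: indicator_def)

lemma emeasure_Q: "emeasure hG Q = 1"
proof -
  have "emeasure hG Q = (\<integral>\<^sup>+x. indicator Q x * 1 \<partial>hG)" by simp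
  also have "\<dots> = 1" using nn_integral_quotient[of "\<lambda>_. 1"] by (simp add: emeasure_H)
  finally show ?thesis .
qed

lemma emeasure_W: "emeasure hG W \<le> 1"
  using emeasure_mono[OF W_subset_Q sets_Q] by (simp add: emeasure_Q)

text \<open>The exceptional set meets \<open>Q\<close> in a null set by
  \<open>nn_integral_quotient\<close>. Countably many kernel translations carry this to all of
  \<open>G\<close>.\<close>

lemma AE_quotient:
  assumes P: "{x \<in> space hH. P x} \<in> sets hH" and ae: "AE x in hH. P x"
  shows "AE x in hG. P (q x)"
proof -
  have [measurable]: "Measurable.pred hH P" using P by (simp add: pred_def)
  have "(\<integral>\<^sup>+x. indicator Q x * indicator {x \<in> space hH. \<not> P x} (q x) \<partial>hG) = (\<integral>\<^sup>+x. indicator {x \<in> space hH. \<not> P x} x \<partial>hH)"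
    by (rule nn_integral_quotient[symmetric]) measurable
  also have "\<dots> = 0" using ae by (subst nn_integral_0_iff_AE) (auto elim!: eventually_mono)
  finally have "AE x in hG. indicator Q x * indicator {x \<in> space hH. \<not> P x} (q x) = (0 :: ennreal)"
    by (subst (asm) nn_integral_0_iff_AE) auto
  then have Q: "AE x in hG. x \<in> Q \<longrightarrow> P (q x)"
    using AE_space by eventually_elim (auto simp: Gr.space_h Hr.space_h split: split_indicator_asm)
  have "AE x in hG. \<forall>y\<in>kernel G H q. y \<odot> x \<in> Q \<longrightarrow> P (q (y \<odot> x))"
  proof (subst AE_ball_countable[OF countable_kernel], intro ballI)
    fix y assume "y \<in> kernel G H q"
    then show "AE x in hG. y \<odot> x \<in> Q \<longrightarrow> P (q (y \<odot> x))"
      using Q by (intro Gr.AE_translate[where P = "\<lambda>x. x \<in> Q \<longrightarrow> P (q x)"]) (auto simp: kernel_def)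
  qed
  then show ?thesis
    using AE_space
  proof eventually_elim
    case (elim x)
    then have x: "x \<in> carrier G" by (simp add: Gr.space_h)
    \<comment> \<open>The kernel element that moves x into \<open>Q\<close>.\<close>
    let ?y = "s (q x) \<odot> iG x"
    have y: "?y \<in> kernel G H q" using x by (simp add: kernel_def q_s)
    have "?y \<odot> x = s (q x)" using x by (simp add: Gr.m_assoc)
    moreover have "s (q x) \<in> Q" using x by (simp add: Q_def q_s Gr.space_h)
    ultimately show ?case using elim(1) y x by (auto simp: q_s)
  qed
qed


subsection \<open>Lifting measures\<close>

text \<open>For y over x, the k with \<tau> x k = y are exactly those with s k in y Q. This is how
  the weight |Q \<inter> y Q| arises when \<open>k\<close> is integrated out.\<close>

definition \<tau> :: "'b \<Rightarrow> 'b \<Rightarrow> 'a" where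
  "\<tau> x k = s k \<odot> iG (s (iH x \<star> k))"

lemma measurable_\<tau> [measurable (raw)]:
  assumes [measurable]: "f \<in> N \<rightarrow>\<^sub>M hH" "g \<in> N \<rightarrow>\<^sub>M hH"
  shows "(\<lambda>x. \<tau> (f x) (g x)) \<in> N \<rightarrow>\<^sub>M hG"
  unfolding \<tau>_def by measurable

lemma q_\<tau>: "x \<in> carrier H \<Longrightarrow> k \<in> carrier H \<Longrightarrow> q (\<tau> x k) = x"
  unfolding \<tau>_def by (simp add: q_s Hr.inv_mult_group Hr.m_assoc[symmetric] Hr.m_comm)

text \<open>The reason for the shape of \<tau>: the factor u = (s k)^-1 g does not involve x, so for
  fixed k the integral over x is a convolution on \<open>H\<close> of the slice x \<mapsto> \<xi>(s
  x \<odot> u), evaluated at k.\<close>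

lemma inv_\<tau>_mult:
  "x \<in> carrier H \<Longrightarrow> k \<in> carrier H \<Longrightarrow> g \<in> carrier G \<Longrightarrow>
    iG (\<tau> x k) \<odot> g = s (iH x \<star> k) \<odot> (iG (s k) \<odot> g)"
  unfolding \<tau>_def by (simp add: Gr.inv_mult_group Gr.m_assoc)

definition lift :: "('b set \<Rightarrow> complex) \<Rightarrow> 'a set \<Rightarrow> complex" where
  "lift \<sigma> A = complex_measure_integral (borel_of TH) \<sigma> (\<lambda>x. complex_of_real (measure hH {k \<in> space hH. \<tau> x k \<in> A}))"

definition lift_base :: "'b measure \<Rightarrow> 'a measure" where
  "lift_base m = distr (m \<Otimes>\<^sub>M hH) hG (\<lambda>(x, k). \<tau> x k)"

lemma sets_lift_base: "sets (lift_base m) = sets hG"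
  by (simp add: lift_base_def)

text \<open>The convolution on \<open>H\<close> of \<rho> m with the slice of \<xi> at
  \<open>u\<close>, evaluated at \<open>k\<close>. Keeping \<open>u\<close> and \<open>k\<close>
  independent permits the substitution in \<open>op_bound_lift\<close>.\<close>

definition lift_kernel :: "'b measure \<Rightarrow> ('b \<Rightarrow> complex) \<Rightarrow> ('a \<Rightarrow> complex) \<Rightarrow> 'a \<Rightarrow> 'b \<Rightarrow> complex" where
  "lift_kernel m \<rho> \<xi> u k = (LINT x|m. \<rho> x * \<xi> (s (iH x \<star> k) \<odot> u))"

context
  fixes m \<rho> assumes md: "complex_density m \<rho>" and sets_m: "sets m = sets hH"
begin

interpretation D: complex_density m \<rho> by (rule md)
interpretation P: pair_sigma_finite m hH by unfold_locales
interpretation PF: finite_measure "m \<Otimes>\<^sub>M hH"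
  by (intro finite_measure_pair_measure) unfold_locales

lemma complex_density_lift_base: "complex_density (lift_base m) (\<lambda>x. \<rho> (q x))"
proof -
  note [measurable_cong] = sets_m sets_lift_base
  note [measurable] = D.measurable_\<rho>
  interpret B: finite_measure "lift_base m"
    unfolding lift_base_def by (rule PF.finite_measure_distr) measurable
  show ?thesis
    by unfold_locales (use D.norm_\<rho> in \<open>auto simp: measurable_cong_sets[OF sets_lift_base refl]\<close>)
qed

text \<open>Since \<tau> x k lies over x, the density is constant in \<open>k\<close>, and
  integrating \<open>k\<close> out leaves the weight in the definition of
  \<open>lift\<close>.\<close>

lemma lift_eq:
  assumes \<sigma>: "\<forall>A\<in>sets hH. \<sigma> A = L1_measure m \<rho> A"
  shows "\<forall>A\<in>sets hG. lift \<sigma> A = L1_measure (lift_base m) (\<lambda>x. \<rho> (q x)) A"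
proof
  note [measurable_cong] = sets_m sets_lift_base
  fix A assume A [measurable]: "A \<in> sets hG"
  have int: "integrable (m \<Otimes>\<^sub>M hH) (\<lambda>(x, k). indicator A (\<tau> x k) *\<^sub>R \<rho> (q (\<tau> x k)))"
    by (rule PF.integrable_const_bound[where B = 1])
       (use D.norm_\<rho> in \<open>auto simp: indicator_def\<close>)
  have meas: "integrable m (\<lambda>x. complex_of_real (measure hH {k \<in> space hH. \<tau> x k \<in> A}))"
    by (rule D.integrable_const_bound[where B = 1]) (auto simp: measure_le_1)
  have "L1_measure (lift_base m) (\<lambda>x. \<rho> (q x)) A = (LINT p|(m \<Otimes>\<^sub>M hH). (\<lambda>(x, k). indicator A (\<tau> x k) *\<^sub>R \<rho> (q (\<tau> x k))) p)"
    unfolding L1_measure_def set_lebesgue_integral_def lift_base_def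
    by (subst integral_distr) (simp_all add: case_prod_beta')
  also have "\<dots> = (LINT x|m. LINT k|hH. indicator A (\<tau> x k) *\<^sub>R \<rho> (q (\<tau> x k)))"
    using P.integral_fst'[OF int] by simp
  also have "\<dots> = (LINT x|m. \<rho> x * complex_of_real (measure hH {k \<in> space hH. \<tau> x k \<in> A}))"
  proof (rule Bochner_Integration.integral_cong)
    fix x assume x [measurable]: "x \<in> space m"
    have "(LINT k|hH. indicator A (\<tau> x k) *\<^sub>R \<rho> (q (\<tau> x k))) = (LINT k|hH. indicator {k \<in> space hH. \<tau> x k \<in> A} k *\<^sub>R \<rho> x)"
      using x by (intro Bochner_Integration.integral_cong) (auto simp: Hr.space_eq_carrier[OF sets_m] Hr.space_h q_\<tau> indicator_def)
    also have "\<dots> = measure hH {k \<in> space hH. \<tau> x k \<in> A} *\<^sub>R \<rho> x"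
    proof -
      have [measurable]: "x \<in> space hH" using x sets_eq_imp_space_eq[OF sets_m] by simp
      have "{k \<in> space hH. \<tau> x k \<in> A} \<in> sets hH" by measurable
      then show ?thesis by (subst integral_scaleR_left) (simp_all add: HP.emeasure_eq_measure)
    qed
    finally show "(LINT k|hH. indicator A (\<tau> x k) *\<^sub>R \<rho> (q (\<tau> x k))) =
        \<rho> x * complex_of_real (measure hH {k \<in> space hH. \<tau> x k \<in> A})"
      by (simp add: scaleR_conv_of_real mult.commute)
  qed simp
  also have "\<dots> = lift \<sigma> A"
    unfolding lift_def using \<sigma>
    by (intro D.complex_measure_integral_eq[symmetric] meas) (auto simp: sets_m Hr.sets_h)
  finally show "lift \<sigma> A = L1_measure (lift_base m) (\<lambda>x. \<rho> (q x)) A" ..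
qed

lemma measurable_lift_kernel:
  assumes [measurable]: "\<xi> \<in> borel_measurable hG" "f \<in> N \<rightarrow>\<^sub>M hG" "g \<in> N \<rightarrow>\<^sub>M hH"
  shows "(\<lambda>x. lift_kernel m \<rho> \<xi> (f x) (g x)) \<in> borel_measurable N"
proof -
  note [measurable_cong] = sets_m
  show ?thesis unfolding lift_kernel_def by measurable
qed

lemma AE_left_regular_lift:
  assumes \<sigma>: "\<forall>A\<in>sets hH. \<sigma> A = L1_measure m \<rho> A" and \<xi>: "\<xi> \<in> L2 hG"
  shows "AE g in hG. Gr.conv (lift \<sigma>) \<xi> g = (LINT k|hH. lift_kernel m \<rho> \<xi> (iG (s k) \<odot> g) k)"
  using Gr.AE_left_regular_eq[OF complex_density_lift_base sets_lift_base lift_eq[OF \<sigma>] \<xi>]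
    Gr.AE_integrable_translates[OF complex_density_lift_base sets_lift_base \<xi>] AE_space
proof eventually_elim
  case (elim g)
  interpret B: complex_density "lift_base m" "\<lambda>x. \<rho> (q x)" by (rule complex_density_lift_base)
  note [measurable_cong] = sets_m sets_lift_base
  have [measurable]: "\<xi> \<in> borel_measurable hG" using \<xi> by (rule L2_measurable)
  note [measurable] = elim(3)
  have g: "g \<in> carrier G" using elim(3) by (simp add: Gr.space_h)
  have "integrable (lift_base m) (\<lambda>x. \<rho> (q x) * \<xi> (iG x \<odot> g))" by (rule B.integrable_\<rho>_mult) (rule elim(2))
  then have int: "integrable (m \<Otimes>\<^sub>M hH) (\<lambda>(x, k). \<rho> (q (\<tau> x k)) * \<xi> (iG (\<tau> x k) \<odot> g))"
    unfolding lift_base_def by (subst (asm) integrable_distr_eq) (simp_all add: case_prod_beta')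
  have "(LINT x|lift_base m. \<rho> (q x) * \<xi> (iG x \<odot> g)) =
      (LINT p|(m \<Otimes>\<^sub>M hH). (\<lambda>(x, k). \<rho> (q (\<tau> x k)) * \<xi> (iG (\<tau> x k) \<odot> g)) p)"
    unfolding lift_base_def by (subst integral_distr) (simp_all add: case_prod_beta')
  also have "\<dots> = (LINT k|hH. LINT x|m. \<rho> (q (\<tau> x k)) * \<xi> (iG (\<tau> x k) \<odot> g))"
    using P.integral_snd[OF int] by simp
  also have "\<dots> = (LINT k|hH. lift_kernel m \<rho> \<xi> (iG (s k) \<odot> g) k)"
    unfolding lift_kernel_def using g
    by (intro Bochner_Integration.integral_cong) (simp_all add: Hr.space_eq_carrier[OF sets_m] Hr.space_h q_\<tau> inv_\<tau>_mult)
  finally show ?case using elim(1) by simp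
qed

text \<open>For fixed x the slice variable \<open>u\<close> is only translated by s x; the remaining
  integral over \<open>H\<close> has total mass 1.\<close>

lemma sq_integral_slices:
  assumes [measurable]: "\<xi> \<in> borel_measurable hG"
  shows "(\<integral>\<^sup>+u. sq_integral hH (\<lambda>x. \<xi> (s x \<odot> u)) \<partial>hG) = sq_integral hG \<xi>"
proof -
  interpret PP: pair_sigma_finite hH hG by unfold_locales
  have "(\<integral>\<^sup>+u. sq_integral hH (\<lambda>x. \<xi> (s x \<odot> u)) \<partial>hG) =
      (\<integral>\<^sup>+x. (\<integral>\<^sup>+u. sq (\<xi> (s x \<odot> u)) \<partial>hG) \<partial>hH)"
    unfolding sq_integral_def by (rule PP.Fubini') measurable
  also have "\<dots> = (\<integral>\<^sup>+x. sq_integral hG \<xi> \<partial>hH)"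
    unfolding sq_integral_def
    by (intro nn_integral_cong Gr.nn_integral_translate[where F = "\<lambda>u. sq (\<xi> u)"])
       (auto simp: Hr.space_h)
  finally show ?thesis by (simp add: emeasure_H)
qed

lemma AE_slices_L2:
  assumes \<xi>: "\<xi> \<in> L2 hG"
  shows "AE u in hG. (\<lambda>x. \<xi> (s x \<odot> u)) \<in> L2 hH"
proof -
  have [measurable]: "\<xi> \<in> borel_measurable hG" using \<xi> by (rule L2_measurable)
  have "AE u in hG. sq_integral hH (\<lambda>x. \<xi> (s x \<odot> u)) \<noteq> \<infinity>"
  proof (rule nn_integral_PInf_AE)
    show "(\<integral>\<^sup>+u. sq_integral hH (\<lambda>x. \<xi> (s x \<odot> u)) \<partial>hG) \<noteq> \<infinity>"
      using \<xi> by (simp add: sq_integral_slices L2_iff less_top)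
  qed (unfold sq_integral_def, measurable)
  then show ?thesis
    using AE_space by eventually_elim (simp add: L2_iff less_top)
qed

lemma op_bound_lift:
  assumes \<sigma>: "\<forall>A\<in>sets hH. \<sigma> A = L1_measure m \<rho> A" and C: "Hr.op_bound \<sigma> C"
  shows "Gr.op_bound (lift \<sigma>) C"
  unfolding Gr.op_bound_def
proof
  note [measurable_cong] = sets_m sets_lift_base
  note [measurable] = D.measurable_\<rho>
  interpret PP: pair_sigma_finite hH hG by unfold_locales
  fix \<xi> assume \<xi>: "\<xi> \<in> L2 hG"
  have [measurable]: "\<xi> \<in> borel_measurable hG" using \<xi> by (rule L2_measurable)
  note [measurable (raw)] = measurable_lift_kernel[OF \<open>\<xi> \<in> borel_measurable hG\<close>]
  let ?c = "lift_kernel m \<rho> \<xi>"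
  have slice: "AE u in hG. (\<integral>\<^sup>+k. sq (?c u k) \<partial>hH) \<le> ennreal C * sq_integral hH (\<lambda>x. \<xi> (s x \<odot> u))"
    using AE_slices_L2[OF \<xi>]
  proof eventually_elim
    case (elim u)
    have "(\<integral>\<^sup>+k. sq (?c u k) \<partial>hH) = sq_integral hH (Hr.conv \<sigma> (\<lambda>x. \<xi> (s x \<odot> u)))"
      unfolding sq_integral_def lift_kernel_def
      by (rule sq_integral_cong_AE[symmetric, unfolded sq_integral_def, OF Hr.AE_left_regular_eq[OF md sets_m \<sigma> elim]])
    also have "\<dots> \<le> ennreal C * sq_integral hH (\<lambda>x. \<xi> (s x \<odot> u))"
      using C elim by (simp add: Hr.op_bound_def)
    finally show ?case .
  qed
  have "sq_integral hG (Gr.conv (lift \<sigma>) \<xi>) = sq_integral hG (\<lambda>g. LINT k|hH. ?c (iG (s k) \<odot> g) k)"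
    by (rule sq_integral_cong_AE[OF AE_left_regular_lift[OF \<sigma> \<xi>]])
  \<comment> \<open>Cauchy-Schwarz over \<open>k\<close>; as \<open>hH\<close> has total mass 1, no
    constant appears.\<close>
  also have "\<dots> \<le> (\<integral>\<^sup>+g. (\<integral>\<^sup>+k. sq (?c (iG (s k) \<odot> g) k) \<partial>hH) \<partial>hG)"
    unfolding sq_integral_def
  proof (rule nn_integral_mono)
    fix g assume [measurable]: "g \<in> space hG"
    show "sq (LINT k|hH. ?c (iG (s k) \<odot> g) k) \<le> (\<integral>\<^sup>+k. sq (?c (iG (s k) \<odot> g) k) \<partial>hH)"
      using nn_integral_square_bound[of "\<lambda>k. ?c (iG (s k) \<odot> g) k" hH] by (simp add: emeasure_H)
  qed
  also have "\<dots> = (\<integral>\<^sup>+k. (\<integral>\<^sup>+g. sq (?c (iG (s k) \<odot> g) k) \<partial>hG) \<partial>hH)"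
    by (rule PP.Fubini') measurable
  \<comment> \<open>For fixed k, invariance replaces (s k)^-1 g by a free variable u. This has to
    precede the bound on \<open>H\<close>, because the slice lies in L^2 only for almost every
    u.\<close>
  also have "\<dots> = (\<integral>\<^sup>+k. (\<integral>\<^sup>+u. sq (?c u k) \<partial>hG) \<partial>hH)"
    by (intro nn_integral_cong Gr.nn_integral_translate[where F = "\<lambda>u. sq (?c u _)"])
       (auto simp: Hr.space_h)
  also have "\<dots> = (\<integral>\<^sup>+u. (\<integral>\<^sup>+k. sq (?c u k) \<partial>hH) \<partial>hG)"
    by (rule PP.Fubini'[symmetric]) measurable
  also have "\<dots> \<le> (\<integral>\<^sup>+u. ennreal C * sq_integral hH (\<lambda>x. \<xi> (s x \<odot> u)) \<partial>hG)"
    by (rule nn_integral_mono_AE[OF slice])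
  also have "\<dots> = ennreal C * sq_integral hG \<xi>"
    by (subst nn_integral_cmult) (simp_all add: sq_integral_slices, simp add: sq_integral_def)
  finally show "sq_integral hG (Gr.conv (lift \<sigma>) \<xi>) \<le> ennreal C * sq_integral hG \<xi>" .
qed

end

lemma cmeasure_lift:
  assumes "Hr.cmeasure \<sigma>" shows "Gr.cmeasure (lift \<sigma>)"
proof -
  obtain m \<rho> where m: "complex_density m \<rho>" "sets m = sets hH" "\<forall>A\<in>sets hH. \<sigma> A = L1_measure m \<rho> A"
    using Hr.density_rep[OF assms] by blast
  have "Gr.cmeasure (L1_measure (lift_base m) (\<lambda>x. \<rho> (q x)))"
    by (rule complex_density.complex_measure[OF complex_density_lift_base[OF m(1,2)]])
       (simp add: sets_lift_base Gr.sets_h)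
  then show ?thesis
    using complex_measure_cong[of "borel_of TG" "lift \<sigma>"] lift_eq[OF m] by (simp add: Gr.sets_h)
qed


subsection \<open>Localising and pushing forward measures\<close>

text \<open>For fixed \<open>a\<close> this is the matrix coefficient of the regular representation of \<open>G\<close> at the indicator
  function of \<open>W\<close> and its translate by \<open>a\<close>; the integral over \<open>G\<close> lives on \<open>W\<close>, hence can be
  taken over \<open>H\<close>.\<close>

definition \<phi> :: "'a \<Rightarrow> 'a \<Rightarrow> real" where
  "\<phi> a x = measure hH {k \<in> space hH. s k \<in> W \<and> iG x \<odot> (a \<odot> s k) \<in> W}"

definition desc :: "'a \<Rightarrow> ('a set \<Rightarrow> complex) \<Rightarrow> 'b set \<Rightarrow> complex" where
  "desc a \<mu> A = complex_measure_integral (borel_of TG) \<mu> (\<lambda>x. of_real (\<phi> a x) * indicator A (q x))"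

text \<open>The section moved to a neighbourhood of \<open>a\<close>. It inverts \<open>q\<close>
  wherever \<phi> a does not vanish, so that densities on \<open>G\<close> can be written as
  functions on \<open>H\<close>.\<close>

definition desc_section :: "'a \<Rightarrow> 'b \<Rightarrow> 'a" where
  "desc_section a x = a \<odot> s (iH (q a) \<star> x)"

lemma \<phi>_bounds: "0 \<le> \<phi> a x" "\<phi> a x \<le> 1"
  by (simp_all add: \<phi>_def measure_le_1)

lemma ennreal_\<phi>:
  assumes [measurable]: "a \<in> carrier G" "x \<in> carrier G"
  shows "ennreal (\<phi> a x) = (\<integral>\<^sup>+k. indicator W (s k) * indicator W (iG x \<odot> (a \<odot> s k)) \<partial>hH)"
proof -
  have [measurable]: "a \<in> space hG" "x \<in> space hG" using assms by (simp_all add: Gr.space_h)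
  have "ennreal (\<phi> a x) = (\<integral>\<^sup>+k. indicator {k \<in> space hH. s k \<in> W \<and> iG x \<odot> (a \<odot> s k) \<in> W} k \<partial>hH)"
    by (subst nn_integral_indicator) (auto simp: \<phi>_def HP.emeasure_eq_measure)
  also have "\<dots> = (\<integral>\<^sup>+k. indicator W (s k) * indicator W (iG x \<odot> (a \<odot> s k)) \<partial>hH)"
    by (intro nn_integral_cong) (auto simp: indicator_def)
  finally show ?thesis .
qed

lemma measurable_\<phi> [measurable (raw)]:
  assumes [measurable]: "f \<in> N \<rightarrow>\<^sub>M hG" "g \<in> N \<rightarrow>\<^sub>M hG"
  shows "(\<lambda>x. \<phi> (f x) (g x)) \<in> borel_measurable N"
  unfolding \<phi>_def by measurable

lemma measurable_desc_section [measurable (raw)]: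
  assumes [measurable]: "f \<in> N \<rightarrow>\<^sub>M hG" "g \<in> N \<rightarrow>\<^sub>M hH"
  shows "(\<lambda>x. desc_section (f x) (g x)) \<in> N \<rightarrow>\<^sub>M hG"
  unfolding desc_section_def by measurable

text \<open>If k is a point of the set measured by \<phi> a x, then x^-1 a is the product of x^-1 a
  (s k) and (s k)^-1, and \<open>W\<close> is symmetric.\<close>

lemma \<phi>_nonzero:
  assumes "\<phi> a x \<noteq> 0" and a: "a \<in> carrier G" and x: "x \<in> carrier G"
  obtains y z where "y \<in> W" "z \<in> W" "iG x \<odot> a = y \<odot> z"
proof -
  have "{k \<in> space hH. s k \<in> W \<and> iG x \<odot> (a \<odot> s k) \<in> W} \<noteq> {}"
    using assms by (auto simp: \<phi>_def simp del: Collect_empty_eq)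
  then obtain k where k: "k \<in> carrier H" "s k \<in> W" "iG x \<odot> (a \<odot> s k) \<in> W" by (auto simp: Hr.space_h)
  have "iG x \<odot> a = (iG x \<odot> (a \<odot> s k)) \<odot> iG (s k)" using a x k by (simp add: Gr.m_assoc)
  then show thesis using that k inv_W by blast
qed

lemma W_carrier: "x \<in> W \<Longrightarrow> x \<in> carrier G"
  using sets.sets_into_space[OF W] by (auto simp: Gr.space_h)

text \<open>By \<open>\<phi>_nonzero\<close>, a^-1 x is a product of two elements of
  \<open>W\<close>; \<open>W_section\<close> applies with the unit as third factor.\<close>

lemma desc_section_q:
  assumes "\<phi> a x \<noteq> 0" and a: "a \<in> carrier G" and x: "x \<in> carrier G"
  shows "desc_section a (q x) = x"
proof -
  obtain y z where yz: "y \<in> W" "z \<in> W" "iG x \<odot> a = y \<odot> z" using \<phi>_nonzero[OF assms] by blast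
  have "iG a \<odot> x = iG (iG x \<odot> a)" using a x by (simp add: Gr.inv_mult_group)
  also have "\<dots> = iG z \<odot> iG y \<odot> \<one>\<^bsub>G\<^esub>" using yz W_carrier by (simp add: Gr.inv_mult_group)
  finally have "s (q (iG a \<odot> x)) = iG a \<odot> x" using W_section[OF inv_W[OF yz(2)] inv_W[OF yz(1)] one_W] by simp
  then show ?thesis using a x by (simp add: desc_section_def Gr.mult_inv_cancel)
qed

text \<open>For fixed k the integral over \<open>a\<close> of the second indicator is the mass of
  \<open>W\<close> by invariance, whatever x is. The first indicator contributes the mass of
  \<open>W\<close> once more, since \<open>W\<close> lies in \<open>Q\<close>.\<close>

lemma nn_integral_\<phi>:
  assumes x: "x \<in> carrier G"
  shows "(\<integral>\<^sup>+a. ennreal (\<phi> a x) \<partial>hG) = (emeasure hG W)\<^sup>2"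
proof -
  interpret PP: pair_sigma_finite hH hG by unfold_locales
  have [measurable]: "x \<in> space hG" using x by (simp add: Gr.space_h)
  have "(\<integral>\<^sup>+a. ennreal (\<phi> a x) \<partial>hG) = (\<integral>\<^sup>+a. (\<integral>\<^sup>+k. indicator W (s k) * indicator W (iG x \<odot> (a \<odot> s k)) \<partial>hH) \<partial>hG)"
    using x by (intro nn_integral_cong ennreal_\<phi>) (auto simp: Gr.space_h)
  also have "\<dots> = (\<integral>\<^sup>+k. (\<integral>\<^sup>+a. indicator W (s k) * indicator W (iG x \<odot> (a \<odot> s k)) \<partial>hG) \<partial>hH)"
    by (rule PP.Fubini') measurable
  also have "\<dots> = (\<integral>\<^sup>+k. indicator W (s k) * emeasure hG W \<partial>hH)"
  proof (rule nn_integral_cong)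
    fix k assume k [measurable]: "k \<in> space hH"
    then have "k \<in> carrier H" by (simp add: Hr.space_h)
    have "(\<integral>\<^sup>+a. indicator W (s k) * indicator W (iG x \<odot> (a \<odot> s k)) \<partial>hG) =
        indicator W (s k) * (\<integral>\<^sup>+a. indicator W (iG x \<odot> (a \<odot> s k)) \<partial>hG)"
      by (rule nn_integral_cmult) measurable
    also have "(\<integral>\<^sup>+a. indicator W (iG x \<odot> (a \<odot> s k)) \<partial>hG) = (\<integral>\<^sup>+a. indicator W (iG x \<odot> s k \<odot> a) \<partial>hG)"
      using x \<open>k \<in> carrier H\<close> by (intro nn_integral_cong) (simp add: Gr.space_h Gr.m_ac)
    also have "\<dots> = (\<integral>\<^sup>+a. indicator W a \<partial>hG)"
      using x \<open>k \<in> carrier H\<close> by (intro Gr.nn_integral_translate) auto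
    finally show "(\<integral>\<^sup>+a. indicator W (s k) * indicator W (iG x \<odot> (a \<odot> s k)) \<partial>hG) = indicator W (s k) * emeasure hG W"
      by simp
  qed
  also have "\<dots> = emeasure hG W * (\<integral>\<^sup>+x. indicator Q x * indicator W x \<partial>hG)"
  proof -
    have "(\<integral>\<^sup>+k. indicator W (s k) * emeasure hG W \<partial>hH) = (\<integral>\<^sup>+k. indicator W (s k) \<partial>hH) * emeasure hG W"
      by (rule nn_integral_multc) measurable
    also have "(\<integral>\<^sup>+k. indicator W (s k) \<partial>hH) = (\<integral>\<^sup>+x. indicator Q x * indicator W x \<partial>hG)"
      by (rule nn_integral_section) measurable
    finally show ?thesis by (simp only: mult.commute)
  qed
  also have "(\<integral>\<^sup>+x. indicator Q x * indicator W x \<partial>hG) = (\<integral>\<^sup>+x. indicator W x \<partial>hG)"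
    using W_subset_Q by (intro nn_integral_cong) (auto simp: indicator_def)
  finally show ?thesis by (simp add: power2_eq_square)
qed

definition desc_base :: "'a measure \<Rightarrow> 'a \<Rightarrow> 'b measure" where
  "desc_base m a = distr (density m (\<lambda>x. ennreal (\<phi> a x))) hH q"

lemma sets_desc_base: "sets (desc_base m a) = sets hH"
  by (simp add: desc_base_def)

text \<open>The convolution on \<open>G\<close> of \<rho> m with the cut-off function g \<mapsto>
  1_W(g) \<xi>(q g \<star> u), evaluated at \<open>g\<close>.\<close>

definition desc_kernel :: "'a measure \<Rightarrow> ('a \<Rightarrow> complex) \<Rightarrow> ('b \<Rightarrow> complex) \<Rightarrow> 'b \<Rightarrow> 'a \<Rightarrow> complex" where
  "desc_kernel m \<rho> \<xi> u g = (LINT x|m. \<rho> x * (indicator W (iG x \<odot> g) * \<xi> (q (iG x \<odot> g) \<star> u)))"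

context
  fixes m \<rho> assumes md: "complex_density m \<rho>" and sets_m: "sets m = sets hG"
begin

interpretation D: complex_density m \<rho> by (rule md)
interpretation P: pair_sigma_finite m hH by unfold_locales

lemma complex_density_desc_base:
  assumes a: "a \<in> carrier G" shows "complex_density (desc_base m a) (\<lambda>x. \<rho> (desc_section a x))"
proof -
  note [measurable_cong] = sets_m sets_desc_base
  note [measurable] = D.measurable_\<rho>
  have [measurable]: "a \<in> space hG" using a by (simp add: Gr.space_h)
  have "finite_measure (density m (\<lambda>x. ennreal (\<phi> a x)))"
  proof
    have "emeasure (density m (\<lambda>x. ennreal (\<phi> a x))) (space m) = (\<integral>\<^sup>+x. ennreal (\<phi> a x) \<partial>m)"
      by (subst emeasure_density) (auto intro!: nn_integral_cong)
    also have "\<dots> \<le> (\<integral>\<^sup>+x. 1 \<partial>m)" by (intro nn_integral_mono) (simp add: \<phi>_bounds)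
    finally show "emeasure (density m (\<lambda>x. ennreal (\<phi> a x))) (space (density m (\<lambda>x. ennreal (\<phi> a x)))) \<noteq> \<infinity>"
      by (auto simp: D.emeasure_eq_measure top_unique)
  qed
  then interpret B: finite_measure "desc_base m a"
    unfolding desc_base_def by (rule finite_measure.finite_measure_distr) measurable
  show ?thesis
    by unfold_locales (use D.norm_\<rho> in \<open>auto simp: measurable_cong_sets[OF sets_desc_base refl]\<close>)
qed

lemma integral_desc_base:
  assumes a: "a \<in> carrier G" and f [measurable]: "f \<in> borel_measurable hH"
  shows "(LINT x|desc_base m a. \<rho> (desc_section a x) * f x) = (LINT x|m. \<rho> x * (of_real (\<phi> a x) * f (q x)))"
    and "integrable (desc_base m a) f \<longleftrightarrow> integrable m (\<lambda>x. of_real (\<phi> a x) * f (q x))"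
proof -
  note [measurable_cong] = sets_m sets_desc_base
  note [measurable] = D.measurable_\<rho>
  have [measurable]: "a \<in> space hG" using a by (simp add: Gr.space_h)
  have "(LINT x|desc_base m a. \<rho> (desc_section a x) * f x) =
      (LINT x|m. \<phi> a x *\<^sub>R (\<rho> (desc_section a (q x)) * f (q x)))"
    unfolding desc_base_def by (simp add: integral_distr integral_density \<phi>_bounds)
  \<comment> \<open>Either \<phi> a x = 0 and both sides vanish, or \<open>desc_section a\<close>
    takes q x back to x.\<close>
  also have "\<dots> = (LINT x|m. \<rho> x * (of_real (\<phi> a x) * f (q x)))"
  proof (rule Bochner_Integration.integral_cong)
    fix x assume "x \<in> space m"
    then show "\<phi> a x *\<^sub>R (\<rho> (desc_section a (q x)) * f (q x)) = \<rho> x * (of_real (\<phi> a x) * f (q x))"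
      using desc_section_q[OF _ a, of x] by (cases "\<phi> a x = 0") (auto simp: Gr.space_eq_carrier[OF sets_m] scaleR_conv_of_real)
  qed simp
  finally show "(LINT x|desc_base m a. \<rho> (desc_section a x) * f x) = (LINT x|m. \<rho> x * (of_real (\<phi> a x) * f (q x)))" .
  show "integrable (desc_base m a) f \<longleftrightarrow> integrable m (\<lambda>x. of_real (\<phi> a x) * f (q x))"
    unfolding desc_base_def
    by (simp add: integrable_distr_eq integrable_density \<phi>_bounds scaleR_conv_of_real)
qed

lemma desc_eq:
  assumes \<mu>: "\<forall>A\<in>sets hG. \<mu> A = L1_measure m \<rho> A" and a: "a \<in> carrier G"
  shows "\<forall>A\<in>sets hH. desc a \<mu> A = L1_measure (desc_base m a) (\<lambda>x. \<rho> (desc_section a x)) A"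
proof
  note [measurable_cong] = sets_m sets_desc_base
  note [measurable] = D.measurable_\<rho>
  have [measurable]: "a \<in> space hG" using a by (simp add: Gr.space_h)
  fix A assume A [measurable]: "A \<in> sets hH"
  have "cmod (of_real (\<phi> a x) * indicator A (q x)) \<le> 1" for x
    using \<phi>_bounds[of a x] by (auto simp: indicator_def)
  then have "integrable m (\<lambda>x. of_real (\<phi> a x) * indicator A (q x) :: complex)"
    by (intro D.integrable_const_bound[where B = 1]) auto
  then have "desc a \<mu> A = (LINT x|m. \<rho> x * (of_real (\<phi> a x) * indicator A (q x)))"
    unfolding desc_def using \<mu>
    by (intro D.complex_measure_integral_eq) (auto simp: sets_m Gr.sets_h)
  also have "\<dots> = (LINT x|desc_base m a. \<rho> (desc_section a x) * indicator A x)"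
    by (rule integral_desc_base(1)[OF a, symmetric]) measurable
  also have "\<dots> = L1_measure (desc_base m a) (\<lambda>x. \<rho> (desc_section a x)) A"
    unfolding L1_measure_def set_lebesgue_integral_def
    by (intro Bochner_Integration.integral_cong) (auto simp: indicator_def)
  finally show "desc a \<mu> A = L1_measure (desc_base m a) (\<lambda>x. \<rho> (desc_section a x)) A" .
qed

lemma AE_left_regular_desc:
  assumes \<mu>: "\<forall>A\<in>sets hG. \<mu> A = L1_measure m \<rho> A" and a: "a \<in> carrier G" and \<xi>: "\<xi> \<in> L2 hH"
  shows "AE g in hH. integrable m (\<lambda>x. of_real (\<phi> a x) * \<xi> (iH (q x) \<star> g))"
    and "AE g in hH. Hr.conv (desc a \<mu>) \<xi> g = (LINT x|m. \<rho> x * (of_real (\<phi> a x) * \<xi> (iH (q x) \<star> g)))"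
proof -
  note ae = Hr.AE_integrable_translates[OF complex_density_desc_base[OF a] sets_desc_base \<xi>]
    Hr.AE_left_regular_eq[OF complex_density_desc_base[OF a] sets_desc_base desc_eq[OF \<mu> a] \<xi>]
  have m: "(\<lambda>x. \<xi> (iH x \<star> g)) \<in> borel_measurable hH" if "g \<in> space hH" for g
  proof -
    note [measurable] = L2_measurable[OF \<xi>] that
    show ?thesis by measurable
  qed
  show "AE g in hH. integrable m (\<lambda>x. of_real (\<phi> a x) * \<xi> (iH (q x) \<star> g))"
    using ae(1) AE_space by eventually_elim (simp add: integral_desc_base(2)[OF a m])
  show "AE g in hH. Hr.conv (desc a \<mu>) \<xi> g = (LINT x|m. \<rho> x * (of_real (\<phi> a x) * \<xi> (iH (q x) \<star> g)))"
    using ae(2) AE_space by eventually_elim (simp add: integral_desc_base(1)[OF a m])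
qed

lemma measurable_desc_kernel:
  assumes [measurable]: "\<xi> \<in> borel_measurable hH" "f \<in> N \<rightarrow>\<^sub>M hH" "g \<in> N \<rightarrow>\<^sub>M hG"
  shows "(\<lambda>x. desc_kernel m \<rho> \<xi> (f x) (g x)) \<in> borel_measurable N"
proof -
  note [measurable_cong] = sets_m
  show ?thesis unfolding desc_kernel_def by measurable
qed

text \<open>The absorption identity. Put g' = a \<odot> s k and u = k^-1 q(a)^-1 g; then q(x^-1 g')
  u = q(x)^-1 g. The second indicator in \<phi> a x is 1_W(x^-1 g'), so it joins \<xi> to form the
  cut-off function, and the integral over x becomes a convolution on \<open>G\<close> at g'.\<close>

lemma integral_\<phi>_eq_desc_kernel:
  assumes a: "a \<in> carrier G" and g: "g \<in> carrier H" and [measurable]: "\<xi> \<in> borel_measurable hH"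
    and int: "integrable m (\<lambda>x. of_real (\<phi> a x) * \<xi> (iH (q x) \<star> g))"
  shows "(LINT x|m. \<rho> x * (of_real (\<phi> a x) * \<xi> (iH (q x) \<star> g))) =
    (LINT k|hH. indicator W (s k) * desc_kernel m \<rho> \<xi> (iH k \<star> (iH (q a) \<star> g)) (a \<odot> s k))"
proof -
  note [measurable_cong] = sets_m
  have [measurable]: "a \<in> space hG" "g \<in> space hH" using a g by (simp_all add: Gr.space_h Hr.space_h)
  let ?w = "\<lambda>x k. indicator W (s k) * indicator W (iG x \<odot> (a \<odot> s k)) :: real"
  have w: "integrable hH (?w x)" "(LINT k|hH. ?w x k) = \<phi> a x" if x: "x \<in> space m" for x
  proof -
    have [measurable]: "x \<in> space hG" using x by (simp add: Gr.space_eq_carrier[OF sets_m] Gr.space_h)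
    show *: "integrable hH (?w x)"
      by (rule HP.integrable_const_bound[where B = 1]) (auto simp: indicator_def)
    have "ennreal (LINT k|hH. ?w x k) = (\<integral>\<^sup>+k. ennreal (?w x k) \<partial>hH)"
      by (rule nn_integral_eq_integral[symmetric, OF *]) (simp add: indicator_def)
    also have "\<dots> = (\<integral>\<^sup>+k. indicator W (s k) * indicator W (iG x \<odot> (a \<odot> s k)) \<partial>hH)"
      by (intro nn_integral_cong) (simp add: indicator_def)
    also have "\<dots> = ennreal (\<phi> a x)"
      using x by (intro ennreal_\<phi>[symmetric] a) (simp add: Gr.space_eq_carrier[OF sets_m])
    finally show "(LINT k|hH. ?w x k) = \<phi> a x"
      by (subst (asm) ennreal_inj) (auto simp: \<phi>_bounds intro!: integral_nonneg_AE)
  qed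
  have "(LINT x|m. \<rho> x * (of_real (\<phi> a x) * \<xi> (iH (q x) \<star> g))) =
      (LINT x|m. \<rho> x * (of_real (LINT k|hH. ?w x k) * \<xi> (iH (q x) \<star> g)))"
    by (intro Bochner_Integration.integral_cong) (simp_all only: w)
  also have "\<dots> = (LINT k|hH. LINT x|m. \<rho> x * (of_real (?w x k) * \<xi> (iH (q x) \<star> g)))"
  proof (rule D.integral_weighted_swap[OF Hr.sigma_finite_haar _ _ w(1), symmetric])
    have "integrable m (\<lambda>x. of_real (LINT k|hH. ?w x k) * \<xi> (iH (q x) \<star> g)) \<longleftrightarrow>
        integrable m (\<lambda>x. of_real (\<phi> a x) * \<xi> (iH (q x) \<star> g))"
      by (intro Bochner_Integration.integrable_cong) (simp_all only: w)
    then show "integrable m (\<lambda>x. of_real (LINT k|hH. ?w x k) * \<xi> (iH (q x) \<star> g))" using int by simp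
    show "(\<lambda>(x, k). indicator W (s k) * indicator W (iG x \<odot> (a \<odot> s k)) :: real) \<in> borel_measurable (m \<Otimes>\<^sub>M hH)"
      and "(\<lambda>x. \<xi> (iH (q x) \<star> g)) \<in> borel_measurable m"
      by measurable
  qed simp
  also have "\<dots> = (LINT k|hH. indicator W (s k) * desc_kernel m \<rho> \<xi> (iH k \<star> (iH (q a) \<star> g)) (a \<odot> s k))"
  proof (rule Bochner_Integration.integral_cong)
    fix k assume "k \<in> space hH"
    then have k: "k \<in> carrier H" by (simp add: Hr.space_h)
    have "q (iG x \<odot> (a \<odot> s k)) \<star> (iH k \<star> (iH (q a) \<star> g)) = iH (q x) \<star> g" if x: "x \<in> carrier G" for x
    proof -
      have "q (iG x \<odot> (a \<odot> s k)) \<star> (iH k \<star> (iH (q a) \<star> g)) = iH (q x) \<star> (q a \<star> (k \<star> (iH k \<star> (iH (q a) \<star> g))))"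
        using x a k g by (simp add: q_s Hr.m_assoc)
      also have "\<dots> = iH (q x) \<star> g" using x a k g by (simp add: Hr.mult_inv_cancel)
      finally show ?thesis .
    qed
    then have F: "\<rho> x * (of_real (?w x k) * \<xi> (iH (q x) \<star> g)) = indicator W (s k) * (\<rho> x * (indicator W (iG x \<odot> (a \<odot> s k)) * \<xi> (q (iG x \<odot> (a \<odot> s k)) \<star> (iH k \<star> (iH (q a) \<star> g)))))"
      if "x \<in> space m" for x
      using that by (simp add: Gr.space_eq_carrier[OF sets_m] indicator_def)
    show "(LINT x|m. \<rho> x * (of_real (?w x k) * \<xi> (iH (q x) \<star> g))) = indicator W (s k) * desc_kernel m \<rho> \<xi> (iH k \<star> (iH (q a) \<star> g)) (a \<odot> s k)"
      unfolding desc_kernel_def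
      by (subst integral_mult_right_zero[symmetric], rule Bochner_Integration.integral_cong[OF refl], rule F)
  qed simp
  finally show ?thesis .
qed

end

lemma cmeasure_desc:
  assumes "Gr.cmeasure \<mu>" and a: "a \<in> carrier G" shows "Hr.cmeasure (desc a \<mu>)"
proof -
  obtain m \<rho> where m: "complex_density m \<rho>" "sets m = sets hG" "\<forall>A\<in>sets hG. \<mu> A = L1_measure m \<rho> A"
    using Gr.density_rep[OF assms(1)] by blast
  have "Hr.cmeasure (L1_measure (desc_base m a) (\<lambda>x. \<rho> (desc_section a x)))"
    by (rule complex_density.complex_measure[OF complex_density_desc_base[OF m(1,2) a]])
       (simp add: sets_desc_base Hr.sets_h)
  then show ?thesis
    using complex_measure_cong[of "borel_of TH" "desc a \<mu>"] desc_eq[OF m a] by (simp add: Hr.sets_h)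
qed

section \<open>The norm bound for localised push-forwards and its converse for zero
  operators\<close>

context
  fixes m \<rho> assumes md: "complex_density m \<rho>" and sets_m: "sets m = sets hG"
begin

interpretation D: complex_density m \<rho> by (rule md)

text \<open>Integrating over \<open>u\<close> first frees \<xi> from g; what is left is the mass of
  \<open>W\<close>, at most 1 because \<open>W\<close> lies in \<open>Q\<close>.\<close>

lemma nn_integral_cutoffs:
  assumes [measurable]: "\<xi> \<in> borel_measurable hH"
  shows "(\<integral>\<^sup>+u. sq_integral hG (\<lambda>g. indicator W g * \<xi> (q g \<star> u)) \<partial>hH) \<le> sq_integral hH \<xi>"
proof -
  interpret PP: pair_sigma_finite hG hH by unfold_locales
  have "(\<integral>\<^sup>+u. sq_integral hG (\<lambda>g. indicator W g * \<xi> (q g \<star> u)) \<partial>hH) =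
      (\<integral>\<^sup>+u. (\<integral>\<^sup>+g. indicator W g * sq (\<xi> (q g \<star> u)) \<partial>hG) \<partial>hH)"
    unfolding sq_integral_def by (intro nn_integral_cong) (auto simp: indicator_def)
  also have "\<dots> = (\<integral>\<^sup>+g. (\<integral>\<^sup>+u. indicator W g * sq (\<xi> (q g \<star> u)) \<partial>hH) \<partial>hG)"
    by (rule PP.Fubini') measurable
  also have "\<dots> = (\<integral>\<^sup>+g. indicator W g * sq_integral hH \<xi> \<partial>hG)"
  proof (rule nn_integral_cong)
    fix g assume [measurable]: "g \<in> space hG"
    then have g: "g \<in> carrier G" by (simp add: Gr.space_h)
    have "(\<integral>\<^sup>+u. indicator W g * sq (\<xi> (q g \<star> u)) \<partial>hH) =
        indicator W g * (\<integral>\<^sup>+u. sq (\<xi> (q g \<star> u)) \<partial>hH)"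
      by (rule nn_integral_cmult) measurable
    also have "(\<integral>\<^sup>+u. sq (\<xi> (q g \<star> u)) \<partial>hH) = sq_integral hH \<xi>"
      unfolding sq_integral_def using g
      by (intro Hr.nn_integral_translate[where F = "\<lambda>u. sq (\<xi> u)"]) auto
    finally show "(\<integral>\<^sup>+u. indicator W g * sq (\<xi> (q g \<star> u)) \<partial>hH) = indicator W g * sq_integral hH \<xi>" .
  qed
  also have "\<dots> = emeasure hG W * sq_integral hH \<xi>"
    by (subst nn_integral_multc) auto
  also have "\<dots> \<le> 1 * sq_integral hH \<xi>"
    by (intro mult_right_mono emeasure_W) simp
  finally show ?thesis by simp
qed

lemma AE_cutoffs_L2:
  assumes \<xi>: "\<xi> \<in> L2 hH"
  shows "AE u in hH. (\<lambda>g. indicator W g * \<xi> (q g \<star> u)) \<in> L2 hG"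
proof -
  have [measurable]: "\<xi> \<in> borel_measurable hH" using \<xi> by (rule L2_measurable)
  have "AE u in hH. sq_integral hG (\<lambda>g. indicator W g * \<xi> (q g \<star> u)) \<noteq> \<infinity>"
  proof (rule nn_integral_PInf_AE)
    have "(\<integral>\<^sup>+u. sq_integral hG (\<lambda>g. indicator W g * \<xi> (q g \<star> u)) \<partial>hH) < \<infinity>"
      by (rule le_less_trans[OF nn_integral_cutoffs]) (use \<xi> in \<open>simp_all add: L2_iff\<close>)
    then show "(\<integral>\<^sup>+u. sq_integral hG (\<lambda>g. indicator W g * \<xi> (q g \<star> u)) \<partial>hH) \<noteq> \<infinity>" by simp
  qed (unfold sq_integral_def, measurable)
  then show ?thesis
    using AE_space by eventually_elim (simp add: L2_iff less_top)
qed

text \<open>The mirror image of \<open>op_bound_lift\<close>: the cut-off functions play the part of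
  the slices, and again only almost every \<open>u\<close> gives an element of L^2, so
  \<open>u\<close> must be made a free variable first.\<close>

lemma op_bound_desc:
  assumes \<mu>: "\<forall>A\<in>sets hG. \<mu> A = L1_measure m \<rho> A" and a: "a \<in> carrier G" and C: "Gr.op_bound \<mu> C"
  shows "Hr.op_bound (desc a \<mu>) C"
  unfolding Hr.op_bound_def
proof
  interpret PP: pair_sigma_finite hH hG by unfold_locales
  interpret HH: pair_sigma_finite hH hH by unfold_locales
  fix \<xi> assume \<xi>: "\<xi> \<in> L2 hH"
  note [measurable] = L2_measurable[OF \<xi>]
  note [measurable (raw)] = measurable_desc_kernel[OF md sets_m L2_measurable[OF \<xi>]]
  have [measurable]: "a \<in> space hG" using a by (simp add: Gr.space_h)
  let ?c = "desc_kernel m \<rho> \<xi>"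
  let ?d = "\<lambda>k g. ?c (iH k \<star> (iH (q a) \<star> g)) (a \<odot> s k)"
  let ?\<Xi> = "\<lambda>u g. indicator W g * \<xi> (q g \<star> u)"
  have slice: "AE u in hH. (\<integral>\<^sup>+g. sq (?c u g) \<partial>hG) \<le> ennreal C * sq_integral hG (?\<Xi> u)"
    using AE_cutoffs_L2[OF \<xi>]
  proof eventually_elim
    case (elim u)
    have "(\<integral>\<^sup>+g. sq (?c u g) \<partial>hG) = sq_integral hG (Gr.conv \<mu> (?\<Xi> u))"
      unfolding sq_integral_def desc_kernel_def
      by (rule sq_integral_cong_AE[symmetric, unfolded sq_integral_def, OF Gr.AE_left_regular_eq[OF md sets_m \<mu> elim]])
    also have "\<dots> \<le> ennreal C * sq_integral hG (?\<Xi> u)"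
      using C elim by (simp add: Gr.op_bound_def)
    finally show ?case .
  qed
  have "AE g in hH. Hr.conv (desc a \<mu>) \<xi> g =
      (LINT k|hH. indicator W (s k) * ?d k g)"
    using AE_left_regular_desc[OF md sets_m \<mu> a \<xi>] AE_space
    by eventually_elim (simp add: integral_\<phi>_eq_desc_kernel[OF md sets_m a] Hr.space_h)
  then have "sq_integral hH (Hr.conv (desc a \<mu>) \<xi>) =
      sq_integral hH (\<lambda>g. LINT k|hH. indicator W (s k) * ?d k g)"
    by (rule sq_integral_cong_AE)
  also have "\<dots> \<le> (\<integral>\<^sup>+g. (\<integral>\<^sup>+k. sq (?d k g) \<partial>hH) \<partial>hH)"
    unfolding sq_integral_def
  proof (rule nn_integral_mono)
    fix g assume [measurable]: "g \<in> space hH"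
    have "sq (LINT k|hH. indicator W (s k) * ?d k g) \<le>
        emeasure hH (space hH) * (\<integral>\<^sup>+k. sq (indicator W (s k) * ?d k g) \<partial>hH)"
      by (rule nn_integral_square_bound) measurable
    also have "\<dots> \<le> (\<integral>\<^sup>+k. sq (?d k g) \<partial>hH)"
      unfolding emeasure_H mult_1 by (intro nn_integral_mono) (auto simp: indicator_def)
    finally show "sq (LINT k|hH. indicator W (s k) * ?d k g) \<le>
      (\<integral>\<^sup>+k. sq (?d k g) \<partial>hH)" .
  qed
  also have "\<dots> = (\<integral>\<^sup>+k. (\<integral>\<^sup>+g. sq (?d k g) \<partial>hH) \<partial>hH)"
    by (rule HH.Fubini') measurable
  \<comment> \<open>For fixed k, translation by k^-1 q(a)^-1 turns g into u; the evaluation point a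
    \<odot> s k stays.\<close>
  also have "\<dots> = (\<integral>\<^sup>+k. (\<integral>\<^sup>+u. sq (?c u (a \<odot> s k)) \<partial>hH) \<partial>hH)"
  proof (rule nn_integral_cong)
    fix k assume [measurable]: "k \<in> space hH"
    then have k: "k \<in> carrier H" by (simp add: Hr.space_h)
    have "(\<integral>\<^sup>+g. sq (?d k g) \<partial>hH) =
        (\<integral>\<^sup>+g. sq (?c (iH k \<star> iH (q a) \<star> g) (a \<odot> s k)) \<partial>hH)"
      using a k by (intro nn_integral_cong) (simp add: Hr.space_h Hr.m_assoc)
    also have "\<dots> = (\<integral>\<^sup>+u. sq (?c u (a \<odot> s k)) \<partial>hH)"
      using a k by (intro Hr.nn_integral_translate[where F = "\<lambda>u. sq (?c u (a \<odot> s k))"]) auto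
    finally show "(\<integral>\<^sup>+g. sq (?d k g) \<partial>hH) =
        (\<integral>\<^sup>+u. sq (?c u (a \<odot> s k)) \<partial>hH)" .
  qed
  also have "\<dots> = (\<integral>\<^sup>+u. (\<integral>\<^sup>+k. sq (?c u (a \<odot> s k)) \<partial>hH) \<partial>hH)"
    by (rule HH.Fubini') measurable
  \<comment> \<open>The points a \<odot> s k only fill a translate of the fundamental domain.
    Enlarging it to all of \<open>G\<close> gives the full L^2-norm there.\<close>
  also have "\<dots> \<le> (\<integral>\<^sup>+u. (\<integral>\<^sup>+g. sq (?c u g) \<partial>hG) \<partial>hH)"
  proof (rule nn_integral_mono)
    fix u assume [measurable]: "u \<in> space hH"
    have "(\<integral>\<^sup>+k. sq (?c u (a \<odot> s k)) \<partial>hH) \<le> (\<integral>\<^sup>+g. sq (?c u (a \<odot> g)) \<partial>hG)"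
      by (rule nn_integral_section_le) measurable
    also have "\<dots> = (\<integral>\<^sup>+g. sq (?c u g) \<partial>hG)"
      by (rule Gr.nn_integral_translate[OF a]) measurable
    finally show "(\<integral>\<^sup>+k. sq (?c u (a \<odot> s k)) \<partial>hH) \<le> (\<integral>\<^sup>+g. sq (?c u g) \<partial>hG)" .
  qed
  also have "\<dots> \<le> (\<integral>\<^sup>+u. ennreal C * sq_integral hG (?\<Xi> u) \<partial>hH)"
    by (rule nn_integral_mono_AE[OF slice])
  also have "\<dots> = ennreal C * (\<integral>\<^sup>+u. sq_integral hG (?\<Xi> u) \<partial>hH)"
    by (rule nn_integral_cmult) (unfold sq_integral_def, measurable)
  also have "\<dots> \<le> ennreal C * sq_integral hH \<xi>"
    by (intro mult_left_mono nn_integral_cutoffs) simp_all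
  finally show "sq_integral hH (Hr.conv (desc a \<mu>) \<xi>) \<le> ennreal C * sq_integral hH \<xi>" .
qed

text \<open>The weights average to the squared mass of \<open>W\<close>, which is finite as
  \<open>W\<close> lies in \<open>Q\<close> and nonzero by \<open>W_pos\<close>, so it can be
  divided out.\<close>

lemma integral_\<phi>_average:
  assumes k: "integrable m k"
    and zero: "AE a in hG. (LINT x|m. \<rho> x * (of_real (\<phi> a x) * k x)) = 0"
  shows "(LINT x|m. \<rho> x * k x) = 0"
proof -
  note [measurable_cong] = sets_m
  have [measurable]: "k \<in> borel_measurable m" using k by simp
  define c where "c = enn2real ((emeasure hG W)\<^sup>2)"
  have fin: "(emeasure hG W)\<^sup>2 < \<infinity>"
    using emeasure_W by (simp add: power_less_top_ennreal le_less_trans[OF _ ennreal_one_less_top])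
  have c: "ennreal c = (emeasure hG W)\<^sup>2" using fin by (simp add: c_def)
  have c0: "c \<noteq> 0" using W_pos c by auto
  have \<phi>: "integrable hG (\<lambda>a. \<phi> a x)" "(LINT a|hG. \<phi> a x) = c" if x: "x \<in> space m" for x
  proof -
    have [measurable]: "x \<in> space hG" using x by (simp add: Gr.space_eq_carrier[OF sets_m] Gr.space_h)
    have n: "(\<integral>\<^sup>+a. ennreal (\<phi> a x) \<partial>hG) = ennreal c" using nn_integral_\<phi>[of x] x by (simp add: c Gr.space_eq_carrier[OF sets_m])
    show "integrable hG (\<lambda>a. \<phi> a x)" by (rule integrableI_nonneg) (use n \<phi>_bounds in auto)
    show "(LINT a|hG. \<phi> a x) = c"
      by (rule integral_eq_nn_integral[THEN trans]) (use n \<phi>_bounds in \<open>auto simp: c_def\<close>)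
  qed
  have "of_real c * (LINT x|m. \<rho> x * k x) = (LINT x|m. \<rho> x * (of_real c * k x))"
    by (simp add: mult.left_commute)
  also have "\<dots> = (LINT x|m. \<rho> x * (of_real (LINT a|hG. \<phi> a x) * k x))"
    by (intro Bochner_Integration.integral_cong) (simp_all only: \<phi>)
  also have "\<dots> = (LINT a|hG. LINT x|m. \<rho> x * (of_real (\<phi> a x) * k x))"
  proof (rule D.integral_weighted_swap[OF Gr.sigma_finite_haar _ _ \<phi>(1), symmetric])
    have "integrable m (\<lambda>x. of_real (LINT a|hG. \<phi> a x) * k x) \<longleftrightarrow> integrable m (\<lambda>x. of_real c * k x)"
      by (intro Bochner_Integration.integrable_cong) (simp_all only: \<phi>)
    then show "integrable m (\<lambda>x. of_real (LINT a|hG. \<phi> a x) * k x)" using k by simp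
    show "(\<lambda>(x, a). \<phi> a x) \<in> borel_measurable (m \<Otimes>\<^sub>M hG)" by measurable
  qed (use k in \<open>auto simp: \<phi>_bounds\<close>)
  also have "\<dots> = 0" by (rule integral_eq_zero_AE) (rule zero)
  finally show ?thesis using c0 by simp
qed

text \<open>The functions \<open>\<phi> a\<close> average to a constant over \<open>a\<close>, so a convolution vanishes as soon as
  all its localised versions do.\<close>

lemma AE_\<phi>_average:
  assumes N: "sigma_finite_measure N" and k [measurable]: "(\<lambda>(x, g). k x g) \<in> borel_measurable (hG \<Otimes>\<^sub>M N)"
    and int: "AE g in N. integrable m (\<lambda>x. k x g)"
    and zero: "\<And>a. a \<in> carrier G \<Longrightarrow> AE g in N. (LINT x|m. \<rho> x * (of_real (\<phi> a x) * k x g)) = 0"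
  shows "AE g in N. (LINT x|m. \<rho> x * k x g) = 0"
proof -
  note [measurable_cong] = sets_m
  interpret N: sigma_finite_measure N by (rule N)
  interpret PP: pair_sigma_finite hG N by unfold_locales
  have "{p \<in> space (hG \<Otimes>\<^sub>M N). (LINT x|m. \<rho> x * (of_real (\<phi> (fst p) x) * k x (snd p))) = 0} \<in> sets (hG \<Otimes>\<^sub>M N)"
    by measurable
  from PP.AE_commute[OF this]
  have "AE g in N. AE a in hG. (LINT x|m. \<rho> x * (of_real (\<phi> a x) * k x g)) = 0"
    using zero by (auto simp: Gr.space_h[symmetric] intro!: AE_I2)
  then show ?thesis using int by eventually_elim (rule integral_\<phi>_average)
qed

text \<open>The hypothesis only tests functions pulled back from \<open>H\<close>, whereas \<xi> is
  arbitrary on \<open>G\<close>. For x near a and g near b, however, x^-1 g stays in a translate of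
  W W W, where \<open>q\<close> is injective; there \<xi> agrees with a function pulled back from
  \<open>H\<close>.\<close>

lemma op_bound_0_if_desc:
  assumes \<mu>: "\<forall>A\<in>sets hG. \<mu> A = L1_measure m \<rho> A" and \<mu>': "Gr.cmeasure \<mu>"
    and desc: "\<And>a. a \<in> carrier G \<Longrightarrow> Hr.op_bound (desc a \<mu>) 0"
  shows "Gr.op_bound \<mu> 0"
  unfolding Gr.zero_operator_iff[OF \<mu>', symmetric] zero_operator_def
proof
  note [measurable_cong] = sets_m
  interpret GG: pair_sigma_finite hG hG by unfold_locales
  fix \<xi> assume \<xi>: "\<xi> \<in> L2 hG"
  note [measurable] = L2_measurable[OF \<xi>]
  have "AE g in hG. (LINT x|m. \<rho> x * \<xi> (iG x \<odot> g)) = 0"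
  proof (rule AE_\<phi>_average[OF Gr.sigma_finite_haar])
    show "AE g in hG. integrable m (\<lambda>x. \<xi> (iG x \<odot> g))"
      by (rule Gr.AE_integrable_translates[OF md sets_m \<xi>])
    fix a assume a: "a \<in> carrier G"
    then have [measurable]: "a \<in> space hG" by (simp add: Gr.space_h)
    let ?Z = "\<lambda>g. (LINT x|m. \<rho> x * (of_real (\<phi> a x) * \<xi> (iG x \<odot> g))) = 0"
    have local: "AE g in hG. iG b \<odot> g \<in> W \<longrightarrow> ?Z g" if b: "b \<in> carrier G" for b
    proof -
      have [measurable]: "b \<in> space hG" using b by (simp add: Gr.space_h)
      \<comment> \<open>The centre of the region in which x^-1 g varies; \<eta> below carries \<xi>
        over to \<open>H\<close> by the section centred at \<open>e\<close>.\<close>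
      define e where "e = iG a \<odot> b"
      have e: "e \<in> carrier G" and [measurable]: "e \<in> space hG" using a b by (simp_all add: e_def Gr.space_h)
      define \<eta> where "\<eta> x = \<xi> (e \<odot> s (iH (q e) \<star> x))" for x
      have [measurable]: "q e \<in> space hH" using e by (simp add: Hr.space_h)
      have \<eta>m [measurable]: "\<eta> \<in> borel_measurable hH" unfolding \<eta>_def by measurable
      have "sq_integral hH \<eta> = (\<integral>\<^sup>+x. sq (\<xi> (e \<odot> s x)) \<partial>hH)"
        unfolding sq_integral_def \<eta>_def using e
        by (intro Hr.nn_integral_translate[where F = "\<lambda>x. sq (\<xi> (e \<odot> s x))"]) auto
      also have "\<dots> \<le> (\<integral>\<^sup>+x. sq (\<xi> (e \<odot> x)) \<partial>hG)"
        by (rule nn_integral_section_le) measurable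
      also have "\<dots> = sq_integral hG \<xi>"
        unfolding sq_integral_def by (rule Gr.nn_integral_translate[OF e]) measurable
      also have "\<dots> < \<infinity>" using \<xi> by (simp add: L2_iff)
      finally have \<eta>: "\<eta> \<in> L2 hH" using \<eta>m by (simp add: L2_iff)
      have "AE g in hH. Hr.conv (desc a \<mu>) \<eta> g = 0"
        using Hr.zero_operator_iff[OF cmeasure_desc[OF \<mu>' a]] desc[OF a] \<eta> by (simp add: zero_operator_def)
      with AE_left_regular_desc(2)[OF md sets_m \<mu> a \<eta>]
      have "AE g in hH. (LINT x|m. \<rho> x * (of_real (\<phi> a x) * \<eta> (iH (q x) \<star> g))) = 0"
        by eventually_elim simp
      then have "AE g in hG. (LINT x|m. \<rho> x * (of_real (\<phi> a x) * \<eta> (iH (q x) \<star> q g))) = 0"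
        by (intro AE_quotient[where P = "\<lambda>g. (LINT x|m. \<rho> x * (of_real (\<phi> a x) * \<eta> (iH (q x) \<star> g))) = 0"]) measurable
      then show ?thesis
        using AE_space
      proof eventually_elim
        case (elim g)
        then have g: "g \<in> carrier G" by (simp add: Gr.space_h)
        show ?case
        proof
          assume bg: "iG b \<odot> g \<in> W"
          have "of_real (\<phi> a x) * \<eta> (iH (q x) \<star> q g) = of_real (\<phi> a x) * \<xi> (iG x \<odot> g)" if "x \<in> space m" for x
          proof (cases "\<phi> a x = 0")
            case False
            have x: "x \<in> carrier G" using that by (simp add: Gr.space_eq_carrier[OF sets_m])
            obtain y z where yz: "y \<in> W" "z \<in> W" "iG x \<odot> a = y \<odot> z" using \<phi>_nonzero[OF False a x] by blast
            \<comment> \<open>Here the third factor of \<open>W_section\<close> is used: x^-1 a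
              supplies two elements of \<open>W\<close>, and b^-1 g the third.\<close>
            have "iG e \<odot> (iG x \<odot> g) = (iG x \<odot> a) \<odot> (iG b \<odot> g)"
              using a b x g by (simp add: e_def Gr.inv_mult_group Gr.m_ac)
            then have "iG e \<odot> (iG x \<odot> g) = y \<odot> z \<odot> (iG b \<odot> g)" by (simp only: yz)
            then have "s (q (iG e \<odot> (iG x \<odot> g))) = iG e \<odot> (iG x \<odot> g)"
              using W_section[OF yz(1,2) bg] by simp
            then have "e \<odot> s (q (iG e \<odot> (iG x \<odot> g))) = iG x \<odot> g"
              using e x g by (simp add: Gr.mult_inv_cancel)
            then show ?thesis using e x g by (simp add: \<eta>_def)
          qed simp
          then have "(LINT x|m. \<rho> x * (of_real (\<phi> a x) * \<eta> (iH (q x) \<star> q g))) =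
              (LINT x|m. \<rho> x * (of_real (\<phi> a x) * \<xi> (iG x \<odot> g)))"
            by (intro Bochner_Integration.integral_cong) simp_all
          then show "?Z g" using elim by simp
        qed
      qed
    qed
    \<comment> \<open>Fubini's theorem patches the local statements: for almost every g the
      implication holds for almost every b, and the b with b^-1 g in \<open>W\<close> form a
      translate of \<open>W\<close>, hence a set of positive measure.\<close>
    have "{p \<in> space (hG \<Otimes>\<^sub>M hG). iG (fst p) \<odot> snd p \<in> W \<longrightarrow> ?Z (snd p)} \<in> sets (hG \<Otimes>\<^sub>M hG)"
      by measurable
    from GG.AE_commute[OF this]
    have "AE g in hG. AE b in hG. iG b \<odot> g \<in> W \<longrightarrow> ?Z g"
      using local by (auto simp: Gr.space_h[symmetric] intro!: AE_I2)
    then show "AE g in hG. ?Z g"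
      using AE_space
    proof eventually_elim
      case (elim g)
      then have g: "g \<in> carrier G" and [measurable]: "g \<in> space hG" by (simp_all add: Gr.space_h)
      show ?case
      proof (rule ccontr)
        assume nz: "\<not> ?Z g"
        from elim(1) have "AE b in hG. iG b \<odot> g \<notin> W" by eventually_elim (use nz in blast)
        then have "AE b in hG. iG g \<odot> b \<notin> W"
          using AE_space
        proof eventually_elim
          case (elim b)
          then have "iG b \<odot> g = iG (iG g \<odot> b)" using g by (simp add: Gr.space_h Gr.inv_mult_group)
          then show ?case using elim(1) inv_W by metis
        qed
        then have "(\<integral>\<^sup>+b. indicator W (iG g \<odot> b) \<partial>hG) = 0"
          by (subst nn_integral_0_iff_AE) (auto elim!: eventually_mono)
        moreover have "(\<integral>\<^sup>+b. indicator W (iG g \<odot> b) \<partial>hG) = (\<integral>\<^sup>+b. indicator W b \<partial>hG)"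
          using g by (intro Gr.nn_integral_translate) auto
        ultimately show False using W_pos by simp
      qed
    qed
  qed measurable
  then show "AE g in hG. Gr.conv \<mu> \<xi> g = 0"
    using Gr.AE_left_regular_eq[OF md sets_m \<mu> \<xi>] by eventually_elim simp
qed

end


subsection \<open>Comparison of \<open>M\<^sub>0\<close>-sets\<close>

text \<open>\<open>q\<close> pushes the lift forward to \<sigma> itself. By
  \<open>op_bound_desc\<close> every localised push-forward of the lift has the zero operator, and
  averaging over \<open>a\<close> removes the localisation. The test functions already come from
  \<open>H\<close>.\<close>

lemma op_bound_0_if_lift:
  assumes md: "complex_density m \<rho>" and sets_m: "sets m = sets hH"
    and \<sigma>: "\<forall>A\<in>sets hH. \<sigma> A = L1_measure m \<rho> A" and \<sigma>': "Hr.cmeasure \<sigma>"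
    and lift: "Gr.op_bound (lift \<sigma>) 0"
  shows "Hr.op_bound \<sigma> 0"
  unfolding Hr.zero_operator_iff[OF \<sigma>', symmetric] zero_operator_def
proof
  note [measurable_cong] = sets_m sets_lift_base
  interpret D: complex_density m \<rho> by (rule md)
  interpret P: pair_sigma_finite m hH by unfold_locales
  note B = complex_density_lift_base[OF md sets_m] sets_lift_base lift_eq[OF md sets_m \<sigma>]
  \<comment> \<open>Since q (\<tau> x k) = x, the variable \<open>k\<close> integrates to the total
    mass 1.\<close>
  have q_lift: "distr (lift_base m) hH q = m"
  proof (rule measure_eqI)
    fix A assume "A \<in> sets (distr (lift_base m) hH q)"
    then have [measurable]: "A \<in> sets hH" and Am [measurable]: "A \<in> sets m" by (simp_all add: sets_m)
    have "emeasure (distr (lift_base m) hH q) A = (\<integral>\<^sup>+x. indicator A x \<partial>distr (lift_base m) hH q)" by simp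
    also have "\<dots> = (\<integral>\<^sup>+x. indicator A (q x) \<partial>lift_base m)"
      by (rule nn_integral_distr) measurable
    also have "\<dots> = (\<integral>\<^sup>+p. (\<lambda>(x, k). indicator A (q (\<tau> x k))) p \<partial>(m \<Otimes>\<^sub>M hH))"
      unfolding lift_base_def
      by (rule nn_integral_distr[THEN trans]) (measurable, simp add: case_prod_beta')
    also have "\<dots> = (\<integral>\<^sup>+x. (\<integral>\<^sup>+k. indicator A (q (\<tau> x k)) \<partial>hH) \<partial>m)"
      by (subst Hr.H.nn_integral_fst[symmetric]) simp_all
    also have "\<dots> = (\<integral>\<^sup>+x. (\<integral>\<^sup>+k. indicator A x \<partial>hH) \<partial>m)"
      by (intro nn_integral_cong) (simp add: q_\<tau> Hr.space_eq_carrier[OF sets_m] Hr.space_h)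
    also have "\<dots> = emeasure m A" using Am by (simp add: emeasure_H)
    finally show "emeasure (distr (lift_base m) hH q) A = emeasure m A" .
  qed (simp add: sets_m)
  fix \<xi> assume \<xi>: "\<xi> \<in> L2 hH"
  note [measurable] = L2_measurable[OF \<xi>]
  have m: "(\<lambda>x. \<xi> (iH x \<star> g)) \<in> borel_measurable hH" if [measurable]: "g \<in> space hH" for g by measurable
  have "AE g in hH. (LINT x|lift_base m. \<rho> (q x) * \<xi> (iH (q x) \<star> g)) = 0"
  proof (rule AE_\<phi>_average[OF B(1,2) Hr.sigma_finite_haar])
    show "AE g in hH. integrable (lift_base m) (\<lambda>x. \<xi> (iH (q x) \<star> g))"
      using Hr.AE_integrable_translates[OF md sets_m \<xi>] AE_space
    proof eventually_elim
      case (elim g)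
      then have "integrable (distr (lift_base m) hH q) (\<lambda>x. \<xi> (iH x \<star> g))" by (simp only: q_lift)
      then show ?case by (subst (asm) integrable_distr_eq) (use m[OF elim(2)] in measurable)
    qed
    fix a assume a: "a \<in> carrier G"
    have "Hr.op_bound (desc a (lift \<sigma>)) 0" by (rule op_bound_desc[OF B a lift])
    then have "AE g in hH. Hr.conv (desc a (lift \<sigma>)) \<xi> g = 0"
      using Hr.zero_operator_iff[OF cmeasure_desc[OF cmeasure_lift[OF \<sigma>'] a]] \<xi> by (simp add: zero_operator_def)
    with AE_left_regular_desc(2)[OF B a \<xi>]
    show "AE g in hH. (LINT x|lift_base m. \<rho> (q x) * (of_real (\<phi> a x) * \<xi> (iH (q x) \<star> g))) = 0"
      by eventually_elim simp
  qed measurable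
  then show "AE g in hH. Hr.conv \<sigma> \<xi> g = 0"
    using Hr.AE_left_regular_eq[OF md sets_m \<sigma> \<xi>] AE_space
  proof eventually_elim
    case (elim g)
    have "(LINT x|m. \<rho> x * \<xi> (iH x \<star> g)) = (LINT x|distr (lift_base m) hH q. \<rho> x * \<xi> (iH x \<star> g))"
      by (simp only: q_lift)
    also have "\<dots> = (LINT x|lift_base m. \<rho> (q x) * \<xi> (iH (q x) \<star> g))"
    proof (rule integral_distr)
      have [measurable]: "\<rho> \<in> borel_measurable hH" using D.measurable_\<rho> by (simp add: measurable_cong_sets[OF sets_m refl])
      show "(\<lambda>x. \<rho> x * \<xi> (iH x \<star> g)) \<in> borel_measurable hH" using m[OF elim(3)] by measurable
    qed measurable
    finally show ?case using elim by simp
  qed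
qed

lemma lift_weight:
  assumes [measurable]: "A \<in> sets hG"
  shows "(\<lambda>x. complex_of_real (measure hH {k \<in> space hH. \<tau> x k \<in> A})) \<in> borel_measurable (borel_of TH)"
    and "cmod (complex_of_real (measure hH {k \<in> space hH. \<tau> x k \<in> A})) \<le> 1"
proof -
  have "(\<lambda>x. complex_of_real (measure hH {k \<in> space hH. \<tau> x k \<in> A})) \<in> borel_measurable hH"
    by measurable
  then show "(\<lambda>x. complex_of_real (measure hH {k \<in> space hH. \<tau> x k \<in> A})) \<in> borel_measurable (borel_of TH)"
    by (simp add: measurable_cong_sets[OF Hr.sets_h refl])
qed (simp add: measure_le_1)

lemma desc_weight:
  assumes [measurable]: "A \<in> sets hH" and a: "a \<in> carrier G"
  shows "(\<lambda>x. complex_of_real (\<phi> a x) * indicator A (q x)) \<in> borel_measurable (borel_of TG)"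
    and "cmod (complex_of_real (\<phi> a x) * indicator A (q x)) \<le> 1"
proof -
  have [measurable]: "a \<in> space hG" using a by (simp add: Gr.space_h)
  have "(\<lambda>x. complex_of_real (\<phi> a x) * indicator A (q x)) \<in> borel_measurable hG"
    by measurable
  then show "(\<lambda>x. complex_of_real (\<phi> a x) * indicator A (q x)) \<in> borel_measurable (borel_of TG)"
    by (simp add: measurable_cong_sets[OF Gr.sets_h refl])
qed (auto simp: indicator_def \<phi>_bounds)

text \<open>With its counterpart \<open>desc_null\<close>, this serves twice: for supports and for
  absolute continuity.\<close>

lemma lift_null:
  assumes "Hr.cmeasure \<sigma>" "A \<in> sets hG"
    and "\<And>B. B \<in> sets hH \<Longrightarrow> B \<subseteq> {x \<in> space hH. measure hH {k \<in> space hH. \<tau> x k \<in> A} \<noteq> 0} \<Longrightarrow> \<sigma> B = 0"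
  shows "lift \<sigma> A = 0"
  unfolding lift_def using assms
  by (intro complex_measure_integral_eq_0 lift_weight) (auto simp: Hr.sets_h Hr.space_h Hr.topspace_T)

lemma desc_null:
  assumes "Gr.cmeasure \<mu>" "A \<in> sets hH" "a \<in> carrier G"
    and "\<And>B. B \<in> sets hG \<Longrightarrow> B \<subseteq> {x \<in> space hG. q x \<in> A} \<Longrightarrow> \<mu> B = 0"
  shows "desc a \<mu> A = 0"
  unfolding desc_def
proof (rule complex_measure_integral_eq_0[OF assms(1) desc_weight(1)[OF assms(2,3)]])
  fix B assume "B \<in> sets (borel_of TG)"
    "B \<subseteq> {x \<in> space (borel_of TG). complex_of_real (\<phi> a x) * indicator A (q x) \<noteq> 0}"
  then show "\<mu> B = 0"
    by (intro assms(4)) (auto simp: Gr.sets_h Gr.space_h Gr.topspace_T split: split_indicator_asm)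
qed

text \<open>The key to absolute continuity of lifts. For fixed k, inversion and translation replace
  x^-1 k by x, which decouples the two sections. For fixed x, the integral over k is then at most
  the Haar measure of a translate of A, which is 0.\<close>

lemma AE_\<tau>_null:
  assumes A: "A \<in> null_sets hG"
  shows "AE x in hH. measure hH {k \<in> space hH. \<tau> x k \<in> A} = 0"
proof -
  interpret HH: pair_sigma_finite hH hH by unfold_locales
  have [measurable]: "A \<in> sets hG" using A by auto
  have "(\<integral>\<^sup>+x. emeasure hH {k \<in> space hH. \<tau> x k \<in> A} \<partial>hH) = (\<integral>\<^sup>+x. (\<integral>\<^sup>+k. indicator A (s k \<odot> iG (s (iH x \<star> k))) \<partial>hH) \<partial>hH)"
  proof (rule nn_integral_cong)
    fix x assume [measurable]: "x \<in> space hH"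
    have "emeasure hH {k \<in> space hH. \<tau> x k \<in> A} = (\<integral>\<^sup>+k. indicator {k \<in> space hH. \<tau> x k \<in> A} k \<partial>hH)"
      by (subst nn_integral_indicator) measurable
    also have "\<dots> = (\<integral>\<^sup>+k. indicator A (s k \<odot> iG (s (iH x \<star> k))) \<partial>hH)"
      by (intro nn_integral_cong) (auto simp: indicator_def \<tau>_def)
    finally show "emeasure hH {k \<in> space hH. \<tau> x k \<in> A} = (\<integral>\<^sup>+k. indicator A (s k \<odot> iG (s (iH x \<star> k))) \<partial>hH)" .
  qed
  also have "\<dots> = (\<integral>\<^sup>+k. (\<integral>\<^sup>+x. indicator A (s k \<odot> iG (s (iH x \<star> k))) \<partial>hH) \<partial>hH)"
    by (rule HH.Fubini') measurable
  also have "\<dots> = (\<integral>\<^sup>+k. (\<integral>\<^sup>+x. indicator A (s k \<odot> iG (s x)) \<partial>hH) \<partial>hH)"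
  proof (rule nn_integral_cong)
    fix k assume [measurable]: "k \<in> space hH"
    then have k: "k \<in> carrier H" by (simp add: Hr.space_h)
    have "(\<integral>\<^sup>+x. indicator A (s k \<odot> iG (s (iH x \<star> k))) \<partial>hH) = (\<integral>\<^sup>+x. indicator A (s k \<odot> iG (s (x \<star> k))) \<partial>hH)"
      by (rule Hr.nn_integral_inverse[OF emeasure_H, where F = "\<lambda>x. indicator A (s k \<odot> iG (s (x \<star> k)))"]) measurable
    also have "\<dots> = (\<integral>\<^sup>+x. indicator A (s k \<odot> iG (s (k \<star> x))) \<partial>hH)"
      using k by (intro nn_integral_cong) (simp add: Hr.space_h Hr.m_comm)
    also have "\<dots> = (\<integral>\<^sup>+x. indicator A (s k \<odot> iG (s x)) \<partial>hH)"
      by (rule Hr.nn_integral_translate[OF k, where F = "\<lambda>x. indicator A (s k \<odot> iG (s x))"]) measurable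
    finally show "(\<integral>\<^sup>+x. indicator A (s k \<odot> iG (s (iH x \<star> k))) \<partial>hH) = (\<integral>\<^sup>+x. indicator A (s k \<odot> iG (s x)) \<partial>hH)" .
  qed
  also have "\<dots> = (\<integral>\<^sup>+x. (\<integral>\<^sup>+k. indicator A (s k \<odot> iG (s x)) \<partial>hH) \<partial>hH)"
    by (rule HH.Fubini') measurable
  also have "\<dots> \<le> (\<integral>\<^sup>+x. 0 \<partial>hH)"
  proof (rule nn_integral_mono)
    fix x assume [measurable]: "x \<in> space hH"
    then have x: "x \<in> carrier H" by (simp add: Hr.space_h)
    have "(\<integral>\<^sup>+k. indicator A (s k \<odot> iG (s x)) \<partial>hH) \<le> (\<integral>\<^sup>+g. indicator A (g \<odot> iG (s x)) \<partial>hG)"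
      by (rule nn_integral_section_le[where F = "\<lambda>g. indicator A (g \<odot> iG (s x))"]) measurable
    also have "\<dots> = (\<integral>\<^sup>+g. indicator A (iG (s x) \<odot> g) \<partial>hG)"
      using x by (intro nn_integral_cong) (simp add: Gr.space_h Gr.m_comm)
    also have "\<dots> = (\<integral>\<^sup>+g. indicator A g \<partial>hG)"
      using x by (intro Gr.nn_integral_translate) auto
    also have "\<dots> = 0" using A by (simp add: null_setsD1)
    finally show "(\<integral>\<^sup>+k. indicator A (s k \<odot> iG (s x)) \<partial>hH) \<le> 0" .
  qed
  finally have "(\<integral>\<^sup>+x. emeasure hH {k \<in> space hH. \<tau> x k \<in> A} \<partial>hH) = 0" by simp
  then have "AE x in hH. emeasure hH {k \<in> space hH. \<tau> x k \<in> A} = 0"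
    by (subst (asm) nn_integral_0_iff_AE) auto
  then show ?thesis by eventually_elim (simp add: measure_def)
qed

lemma lift_L1:
  assumes f: "integrable hH f"
  obtains F where "integrable hG F" "\<And>A. A \<in> sets hG \<Longrightarrow> lift (L1_measure hH f) A = L1_measure hG F A"
proof -
  have s: "sets hG = sets (borel_of TG)" by (rule Gr.sets_h)
  have "lift (L1_measure hH f) A = 0" if A: "A \<in> null_sets hG" for A
  proof (rule lift_null[OF Hr.cmeasure_L1_measure[OF f]])
    fix B assume B: "B \<in> sets hH" "B \<subseteq> {x \<in> space hH. measure hH {k \<in> space hH. \<tau> x k \<in> A} \<noteq> 0}"
    \<comment> \<open>On \<open>B\<close> the weight is nonzero, which by
      \<open>AE_\<tau>_null\<close> happens only on a null set.\<close>
    have "B \<in> null_sets hH"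
      using AE_\<tau>_null[OF A] B by (subst AE_iff_null_sets) (auto elim!: eventually_mono)
    then show "L1_measure hH f B = 0" by (rule L1_measure_null)
  qed (use A in auto)
  from complex_measure_Radon_Nikodym[OF cmeasure_lift[OF Hr.cmeasure_L1_measure[OF f]] Gr.sigma_finite_haar s this]
  show thesis using that unfolding s by metis
qed

lemma desc_L1:
  assumes f: "integrable hG f" and a: "a \<in> carrier G"
  obtains F where "integrable hH F" "\<And>A. A \<in> sets hH \<Longrightarrow> desc a (L1_measure hG f) A = L1_measure hH F A"
proof -
  have s: "sets hH = sets (borel_of TH)" by (rule Hr.sets_h)
  have "desc a (L1_measure hG f) A = 0" if A: "A \<in> null_sets hH" for A
  proof (rule desc_null[OF Gr.cmeasure_L1_measure[OF f] _ a])
    have [measurable]: "A \<in> sets hH" using A by auto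
    fix B assume B: "B \<in> sets hG" "B \<subseteq> {x \<in> space hG. q x \<in> A}"
    \<comment> \<open>Preimages of null sets under \<open>q\<close> are null, so \<mu> = f h
      vanishes on every measurable part of them.\<close>
    have "AE x in hG. q x \<notin> A"
      by (rule AE_quotient[where P = "\<lambda>x. x \<notin> A"]) (use AE_not_in[OF A] in measurable)
    then have "B \<in> null_sets hG"
      using B by (subst AE_iff_null_sets) (auto elim!: eventually_mono)
    then show "L1_measure hG f B = 0" by (rule L1_measure_null)
  qed (use A in auto)
  from complex_measure_Radon_Nikodym[OF cmeasure_desc[OF Gr.cmeasure_L1_measure[OF f] a] Hr.sigma_finite_haar s this]
  show thesis using that unfolding s by metis
qed

theorem M0_set_preimage_iff:
  assumes TH: "second_countable TH" and TG: "second_countable TG"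
    and E: "closedin TH E" and qE: "closedin TG {x \<in> carrier G. q x \<in> E}"
  shows "M0_set H TH hH E \<longleftrightarrow> M0_set G TG hG {x \<in> carrier G. q x \<in> E}"
  unfolding Hr.M0_set_iff[OF TH E] Gr.M0_set_iff[OF TG qE]
proof
  assume "\<exists>\<mu>. Hr.M0_witness E \<mu>"
  then obtain \<sigma> where \<sigma>: "Hr.cmeasure \<sigma>" and null: "\<And>A. A \<in> sets hH \<Longrightarrow> A \<inter> E = {} \<Longrightarrow> \<sigma> A = 0"
    and approx: "\<And>\<epsilon>. \<epsilon> > 0 \<Longrightarrow> \<exists>f. integrable hH f \<and> Hr.op_bound (\<lambda>A. \<sigma> A - L1_measure hH f A) \<epsilon>"
    and nz: "\<not> Hr.op_bound \<sigma> 0" unfolding Hr.M0_witness_def by blast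
  show "\<exists>\<mu>. Gr.M0_witness {x \<in> carrier G. q x \<in> E} \<mu>"
    unfolding Gr.M0_witness_def
  proof (intro exI[of _ "lift \<sigma>"] conjI ballI allI impI)
    show "Gr.cmeasure (lift \<sigma>)" by (rule cmeasure_lift[OF \<sigma>])
    obtain m \<rho> where m: "complex_density m \<rho>" "sets m = sets hH" "\<forall>A\<in>sets hH. \<sigma> A = L1_measure m \<rho> A"
      using Hr.density_rep[OF \<sigma>] by blast
    show "\<not> Gr.op_bound (lift \<sigma>) 0" using op_bound_0_if_lift[OF m \<sigma>] nz by blast
  next
    fix A assume A: "A \<in> sets hG" "A \<inter> {x \<in> carrier G. q x \<in> E} = {}"
    show "lift \<sigma> A = 0"
    proof (rule lift_null[OF \<sigma> A(1)])
      fix B assume B: "B \<in> sets hH" "B \<subseteq> {x \<in> space hH. measure hH {k \<in> space hH. \<tau> x k \<in> A} \<noteq> 0}"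
      have "x \<notin> E" if "x \<in> B" for x
      proof
        assume "x \<in> E"
        have x: "x \<in> carrier H" using that sets.sets_into_space[OF B(1)] by (auto simp: Hr.space_h)
        have "\<tau> x k \<notin> A" if "k \<in> space hH" for k
        proof -
          have "\<tau> x k \<in> carrier G" using x that by (simp add: \<tau>_def Hr.space_h)
          moreover have "q (\<tau> x k) \<in> E" using x that \<open>x \<in> E\<close> by (simp add: q_\<tau> Hr.space_h)
          ultimately show ?thesis using A(2) by blast
        qed
        then have "{k \<in> space hH. \<tau> x k \<in> A} = {}" by blast
        then have "measure hH {k \<in> space hH. \<tau> x k \<in> A} = 0" by (simp only: measure_empty)
        then show False using B(2) that by blast
      qed
      then show "\<sigma> B = 0" using null[OF B(1)] by blast
    qed
  next
    fix \<epsilon> :: real assume "\<epsilon> > 0"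
    then obtain f where f: "integrable hH f" and b: "Hr.op_bound (\<lambda>A. \<sigma> A - L1_measure hH f A) \<epsilon>"
      using approx by blast
    obtain F where F: "integrable hG F" "\<And>A. A \<in> sets hG \<Longrightarrow> lift (L1_measure hH f) A = L1_measure hG F A"
      using lift_L1[OF f] by blast
    have d: "Hr.cmeasure (\<lambda>A. \<sigma> A - L1_measure hH f A)"
      by (intro complex_measure_diff \<sigma> Hr.cmeasure_L1_measure f)
    obtain m \<rho> where m: "complex_density m \<rho>" "sets m = sets hH"
        "\<forall>A\<in>sets hH. \<sigma> A - L1_measure hH f A = L1_measure m \<rho> A"
      using Hr.density_rep[OF d] by blast
    have "Gr.op_bound (lift (\<lambda>A. \<sigma> A - L1_measure hH f A)) \<epsilon>" by (rule op_bound_lift[OF m b])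
    \<comment> \<open>Lifting is linear, so the bound for the lifted difference is the distance of
      the lift from an absolutely continuous measure.\<close>
    also have "Gr.op_bound (lift (\<lambda>A. \<sigma> A - L1_measure hH f A)) = Gr.op_bound (\<lambda>A. lift \<sigma> A - L1_measure hG F A)"
    proof (rule Gr.op_bound_cong)
      fix A assume A: "A \<in> sets hG"
      show "lift (\<lambda>A. \<sigma> A - L1_measure hH f A) A = lift \<sigma> A - L1_measure hG F A"
        unfolding F(2)[OF A, symmetric] lift_def
        by (rule complex_measure_integral_diff[OF \<sigma> Hr.cmeasure_L1_measure[OF f] lift_weight[OF A]])
    qed
    finally show "\<exists>f. integrable hG f \<and> Gr.op_bound (\<lambda>A. lift \<sigma> A - L1_measure hG f A) \<epsilon>" using F(1) by blast
  qed
next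
  assume "\<exists>\<mu>. Gr.M0_witness {x \<in> carrier G. q x \<in> E} \<mu>"
  then obtain \<mu> where \<mu>: "Gr.cmeasure \<mu>" and null: "\<And>A. A \<in> sets hG \<Longrightarrow> A \<inter> {x \<in> carrier G. q x \<in> E} = {} \<Longrightarrow> \<mu> A = 0"
    and approx: "\<And>\<epsilon>. \<epsilon> > 0 \<Longrightarrow> \<exists>f. integrable hG f \<and> Gr.op_bound (\<lambda>A. \<mu> A - L1_measure hG f A) \<epsilon>"
    and nz: "\<not> Gr.op_bound \<mu> 0" unfolding Gr.M0_witness_def by blast
  obtain m \<rho> where m: "complex_density m \<rho>" "sets m = sets hG" "\<forall>A\<in>sets hG. \<mu> A = L1_measure m \<rho> A"
    using Gr.density_rep[OF \<mu>] by blast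
  \<comment> \<open>The centre \<open>a\<close> depends on \<mu>; some localisation must keep the
    operator nonzero, for otherwise averaging would give 0.\<close>
  obtain a where a: "a \<in> carrier G" "\<not> Hr.op_bound (desc a \<mu>) 0"
    using op_bound_0_if_desc[OF m \<mu>] nz by blast
  show "\<exists>\<mu>. Hr.M0_witness E \<mu>"
    unfolding Hr.M0_witness_def
  proof (intro exI[of _ "desc a \<mu>"] conjI ballI allI impI)
    show "Hr.cmeasure (desc a \<mu>)" by (rule cmeasure_desc[OF \<mu> a(1)])
    show "\<not> Hr.op_bound (desc a \<mu>) 0" by (rule a(2))
  next
    fix A assume A: "A \<in> sets hH" "A \<inter> E = {}"
    show "desc a \<mu> A = 0"
      by (rule desc_null[OF \<mu> A(1) a(1)]) (use A(2) in \<open>intro null; blast\<close>)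
  next
    fix \<epsilon> :: real assume "\<epsilon> > 0"
    then obtain f where f: "integrable hG f" and b: "Gr.op_bound (\<lambda>A. \<mu> A - L1_measure hG f A) \<epsilon>"
      using approx by blast
    obtain F where F: "integrable hH F" "\<And>A. A \<in> sets hH \<Longrightarrow> desc a (L1_measure hG f) A = L1_measure hH F A"
      using desc_L1[OF f a(1)] by blast
    have d: "Gr.cmeasure (\<lambda>A. \<mu> A - L1_measure hG f A)"
      by (intro complex_measure_diff \<mu> Gr.cmeasure_L1_measure f)
    obtain n \<tau> where n: "complex_density n \<tau>" "sets n = sets hG"
        "\<forall>A\<in>sets hG. \<mu> A - L1_measure hG f A = L1_measure n \<tau> A"
      using Gr.density_rep[OF d] by blast
    have "Hr.op_bound (desc a (\<lambda>A. \<mu> A - L1_measure hG f A)) \<epsilon>" by (rule op_bound_desc[OF n a(1) b])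
    also have "Hr.op_bound (desc a (\<lambda>A. \<mu> A - L1_measure hG f A)) = Hr.op_bound (\<lambda>A. desc a \<mu> A - L1_measure hH F A)"
    proof (rule Hr.op_bound_cong)
      fix A assume A: "A \<in> sets hH"
      show "desc a (\<lambda>A. \<mu> A - L1_measure hG f A) A = desc a \<mu> A - L1_measure hH F A"
        unfolding F(2)[OF A, symmetric] desc_def
        by (rule complex_measure_integral_diff[OF \<mu> Gr.cmeasure_L1_measure[OF f] desc_weight[OF A a(1)]])
    qed
    finally show "\<exists>f. integrable hH f \<and> Hr.op_bound (\<lambda>A. desc a \<mu> A - L1_measure hH f A) \<epsilon>" using F(1) by blast
  qed
qed

end


section \<open>The quotient map onto the torus\<close>

lemma second_countable_prod_topology:
  assumes X: "second_countable X" and Y: "second_countable Y"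
  shows "second_countable (prod_topology X Y)"
proof -
  obtain B where B: "countable B" "\<And>V. V \<in> B \<Longrightarrow> openin X V"
      "\<And>U x. openin X U \<Longrightarrow> x \<in> U \<Longrightarrow> \<exists>V\<in>B. x \<in> V \<and> V \<subseteq> U"
    by (rule second_countableE[OF X]) (rule that)
  obtain C where C: "countable C" "\<And>V. V \<in> C \<Longrightarrow> openin Y V"
      "\<And>U x. openin Y U \<Longrightarrow> x \<in> U \<Longrightarrow> \<exists>V\<in>C. x \<in> V \<and> V \<subseteq> U"
    by (rule second_countableE[OF Y]) (rule that)
  show ?thesis
    unfolding second_countable_def
  proof (intro exI[of _ "(\<lambda>(V, V'). V \<times> V') ` (B \<times> C)"] conjI ballI allI impI)
    show "countable ((\<lambda>(V, V'). V \<times> V') ` (B \<times> C))" using B(1) C(1) by simp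
    show "openin (prod_topology X Y) V" if "V \<in> (\<lambda>(V, V'). V \<times> V') ` (B \<times> C)" for V
      using that B(2) C(2) by (auto simp: openin_prod_Times_iff)
    fix U z assume U: "openin (prod_topology X Y) U \<and> z \<in> U"
    obtain x y where z: "z = (x, y)" by (cases z)
    then obtain V V' where V: "openin X V" "openin Y V'" "x \<in> V" "y \<in> V'" "V \<times> V' \<subseteq> U"
      using U unfolding openin_prod_topology_alt by blast
    obtain D where D: "D \<in> B" "x \<in> D" "D \<subseteq> V" using B(3)[OF V(1,3)] by blast
    obtain D' where D': "D' \<in> C" "y \<in> D'" "D' \<subseteq> V'" using C(3)[OF V(2,4)] by blast
    show "\<exists>V\<in>(\<lambda>(V, V'). V \<times> V') ` (B \<times> C). z \<in> V \<and> V \<subseteq> U"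
      using D D' V(5) z by (intro bexI[of _ "D \<times> D'"]) auto
  qed
qed

lemma comm_group_product_group:
  assumes "\<And>i. i \<in> I \<Longrightarrow> comm_group (G i)"
  shows "comm_group (product_group I G)"
proof (rule group.group_comm_groupI)
  show "group (product_group I G)" using assms by (intro product_group) (simp add: comm_group_def)
  fix x y assume "x \<in> carrier (product_group I G)" "y \<in> carrier (product_group I G)"
  then show "x \<otimes>\<^bsub>product_group I G\<^esub> y = y \<otimes>\<^bsub>product_group I G\<^esub> x"
    using assms by (auto simp: PiE_iff comm_groupE(4) intro!: restrict_ext)
qed

lemma comm_group_DirProd:
  assumes G: "comm_group G" and H: "comm_group H"
  shows "comm_group (G \<times>\<times> H)"
proof (rule group.group_comm_groupI)
  show "group (G \<times>\<times> H)" using assms by (intro DirProd_group) (simp_all add: comm_group_def)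
  show "x \<otimes>\<^bsub>G \<times>\<times> H\<^esub> y = y \<otimes>\<^bsub>G \<times>\<times> H\<^esub> x" if "x \<in> carrier (G \<times>\<times> H)" "y \<in> carrier (G \<times>\<times> H)" for x y
    using that by (auto simp: mult_DirProd' comm_groupE(4)[OF G] comm_groupE(4)[OF H])
qed

lemma haar_group_PiM:
  assumes I: "finite I" and G: "haar_group G T h" and T: "second_countable T" "Hausdorff_space T"
  shows "haar_group (product_group I (\<lambda>_. G)) (product_topology (\<lambda>_. T) I) (PiM I (\<lambda>_. h))"
proof -
  interpret haar_group G T h by fact
  interpret product_sigma_finite "\<lambda>_. h" by (simp add: product_sigma_finite_def sigma_finite_haar)
  show ?thesis
    unfolding haar_group_def haar_group_axioms_def
  proof (intro conjI)
    show "comm_group (product_group I (\<lambda>_. G))" by (intro comm_group_product_group) unfold_locales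
    show "haar_measure (product_group I (\<lambda>_. G)) (product_topology (\<lambda>_. T) I) (PiM I (\<lambda>_. h))"
      by (intro haar_measure_PiM I haar sigma_finite_haar T)
    show "sigma_finite_measure (PiM I (\<lambda>_. h))" by (rule sigma_finite[OF I])
    show "(\<lambda>(x, y). x \<otimes>\<^bsub>product_group I (\<lambda>_. G)\<^esub> y) \<in> PiM I (\<lambda>_. h) \<Otimes>\<^sub>M PiM I (\<lambda>_. h) \<rightarrow>\<^sub>M PiM I (\<lambda>_. h)"
      unfolding mult_product_group case_prod_beta'
      by (rule measurable_restrict) measurable
    have "(\<lambda>x. \<lambda>i\<in>I. inv\<^bsub>G\<^esub> (x i)) \<in> PiM I (\<lambda>_. h) \<rightarrow>\<^sub>M PiM I (\<lambda>_. h)"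
      by (rule measurable_restrict) measurable
    then show "m_inv (product_group I (\<lambda>_. G)) \<in> PiM I (\<lambda>_. h) \<rightarrow>\<^sub>M PiM I (\<lambda>_. h)"
      by (rule measurable_cong[THEN iffD1, rotated])
         (simp add: space_PiM space_h inv_product_group[OF _ is_group])
  qed
qed

lemma haar_group_pair:
  assumes G: "haar_group G T h" and T: "second_countable T" "Hausdorff_space T"
    and G': "haar_group G' T' h'" and T': "second_countable T'" "Hausdorff_space T'"
  shows "haar_group (G \<times>\<times> G') (prod_topology T T') (h \<Otimes>\<^sub>M h')"
proof -
  interpret A: haar_group G T h by fact
  interpret B: haar_group G' T' h' by fact
  show ?thesis
    unfolding haar_group_def haar_group_axioms_def
  proof (intro conjI)
    show "comm_group (G \<times>\<times> G')" by (intro comm_group_DirProd) unfold_locales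
    show "haar_measure (G \<times>\<times> G') (prod_topology T T') (h \<Otimes>\<^sub>M h')"
      by (intro haar_measure_pair A.haar B.haar A.sigma_finite_haar B.sigma_finite_haar T T')
    show "sigma_finite_measure (h \<Otimes>\<^sub>M h')"
      by (intro sigma_finite_pair_measure A.sigma_finite_haar B.sigma_finite_haar)
    show "(\<lambda>(x, y). x \<otimes>\<^bsub>G \<times>\<times> G'\<^esub> y) \<in> (h \<Otimes>\<^sub>M h') \<Otimes>\<^sub>M (h \<Otimes>\<^sub>M h') \<rightarrow>\<^sub>M h \<Otimes>\<^sub>M h'"
      unfolding mult_DirProd' case_prod_beta' by measurable
    have "(\<lambda>p. (inv\<^bsub>G\<^esub> (fst p), inv\<^bsub>G'\<^esub> (snd p))) \<in> h \<Otimes>\<^sub>M h' \<rightarrow>\<^sub>M h \<Otimes>\<^sub>M h'" by measurable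
    then show "m_inv (G \<times>\<times> G') \<in> h \<Otimes>\<^sub>M h' \<rightarrow>\<^sub>M h \<Otimes>\<^sub>M h'"
      by (rule measurable_cong[THEN iffD1, rotated])
         (auto simp: space_pair_measure A.space_h B.space_h inv_DirProd[OF A.is_group B.is_group])
  qed
qed

section \<open>The line, the circle and the principal argument\<close>

lemma haar_group_real: "haar_group real_group euclideanreal lborel"
  unfolding haar_group_def haar_group_axioms_def
proof (intro conjI)
  show cg: "comm_group real_group"
    by (rule comm_groupI) (auto simp: real_group_def intro: exI[of _ "- x" for x :: real])
  show "haar_measure real_group euclideanreal lborel" by (rule haar_measure_lborel)
  show "sigma_finite_measure (lborel :: real measure)" by (rule sigma_finite_lborel)
  show "(\<lambda>(x, y). x \<otimes>\<^bsub>real_group\<^esub> y) \<in> lborel \<Otimes>\<^sub>M lborel \<rightarrow>\<^sub>M lborel"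
    by (simp add: real_group_def)
  have "inv\<^bsub>real_group\<^esub> x = - x" for x
    by (rule group.inv_equality) (use cg in \<open>auto simp: real_group_def comm_group_def\<close>)
  then have "m_inv real_group = uminus" by blast
  then show "m_inv real_group \<in> lborel \<rightarrow>\<^sub>M lborel" by simp
qed

lemma space_circle_haar: "space circle_haar = sphere 0 1"
  by (simp add: circle_haar_def circle_topology_props)

lemma sets_circle_haar: "sets circle_haar = sets (borel_of circle_topology)"
  by (simp add: circle_haar_def)

lemma measurable_circle_haar_borel: "(\<lambda>z. z) \<in> circle_haar \<rightarrow>\<^sub>M borel"
proof -
  have "continuous_map circle_topology euclidean (\<lambda>z. z)"
    unfolding circle_topology_def by (intro continuous_map_from_subtopology continuous_map_id[unfolded id_def])
  from continuous_map_measurable_borel_of[OF this] show ?thesis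
    by (simp add: measurable_cong_sets[OF sets_circle_haar sets_borel_of_euclidean[symmetric]])
qed

lemma measurable_to_circle_haar:
  assumes f [measurable]: "f \<in> borel_measurable N" and s: "f \<in> space N \<rightarrow> sphere 0 1"
  shows "f \<in> N \<rightarrow>\<^sub>M circle_haar"
proof -
  have "f \<in> N \<rightarrow>\<^sub>M borel_of circle_topology"
    unfolding borel_of_def
  proof (rule measurable_measure_of)
    show "{U. openin circle_topology U} \<subseteq> Pow (topspace circle_topology)" by (auto dest: openin_subset)
    show "f \<in> space N \<rightarrow> topspace circle_topology" using s by (simp add: circle_topology_props)
    fix U assume "U \<in> {U. openin circle_topology U}"
    then obtain V where V: "open V" "U = sphere 0 1 \<inter> V"
      by (auto simp: circle_topology_def openin_open)
    have "f -` U \<inter> space N = f -` V \<inter> space N" using s V(2) by auto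
    also have "\<dots> \<in> sets N" using V(1) by (intro measurable_sets[OF f]) simp
    finally show "f -` U \<inter> space N \<in> sets N" .
  qed
  then show ?thesis by (simp add: measurable_cong_sets[OF refl sets_circle_haar])
qed

lemma haar_group_circle: "haar_group circle_group circle_topology circle_haar"
  unfolding haar_group_def haar_group_axioms_def
proof (intro conjI)
  show cg: "comm_group circle_group"
  proof (rule comm_groupI)
    fix x assume "x \<in> carrier circle_group"
    then have "cmod x = 1" "x \<noteq> 0" by (auto simp: circle_group_def)
    then show "\<exists>y\<in>carrier circle_group. y \<otimes>\<^bsub>circle_group\<^esub> x = \<one>\<^bsub>circle_group\<^esub>"
      by (intro bexI[of _ "inverse x"]) (auto simp: circle_group_def norm_inverse)
  qed (auto simp: circle_group_def norm_mult)
  show "haar_measure circle_group circle_topology circle_haar" by (rule haar_measure_circle)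
  show "sigma_finite_measure circle_haar" by (rule sigma_finite_circle_haar)
  note [measurable] = measurable_compose[OF _ measurable_circle_haar_borel]
  show "(\<lambda>(x, y). x \<otimes>\<^bsub>circle_group\<^esub> y) \<in> circle_haar \<Otimes>\<^sub>M circle_haar \<rightarrow>\<^sub>M circle_haar"
    by (rule measurable_to_circle_haar)
       (auto simp: circle_group_def case_prod_beta' space_pair_measure space_circle_haar norm_mult)
  have "(\<lambda>z. inverse z) \<in> circle_haar \<rightarrow>\<^sub>M circle_haar"
    by (rule measurable_to_circle_haar) (auto simp: space_circle_haar norm_inverse)
  then show "m_inv circle_group \<in> circle_haar \<rightarrow>\<^sub>M circle_haar"
  proof (rule measurable_cong[THEN iffD1, rotated])
    fix z assume "z \<in> space circle_haar"
    then have "cmod z = 1" "z \<noteq> 0" by (auto simp: space_circle_haar)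
    then show "inverse z = inv\<^bsub>circle_group\<^esub> z"
      by (intro group.inv_equality[symmetric])
         (use cg in \<open>auto simp: circle_group_def space_circle_haar comm_group_def norm_inverse\<close>)
  qed
qed

text \<open>\<open>Arg\<close> is continuous off the nonpositive real axis; on the axis it is pi,
  except for the value 0 at 0.\<close>

lemma borel_measurable_Arg [measurable]: "Arg \<in> borel_measurable borel"
proof -
  have [measurable]: "- \<real>\<^sub>\<le>\<^sub>0 \<in> sets (borel :: complex measure)"
    by (intro borel_open) (simp add: open_Compl)
  have "(\<lambda>z. indicator (- \<real>\<^sub>\<le>\<^sub>0) z *\<^sub>R Arg z) \<in> borel_measurable borel"
    by (rule borel_measurable_continuous_on_indicator[OF _ continuous_on_Arg]) measurable
  moreover have "(\<lambda>z. indicator (- (- \<real>\<^sub>\<le>\<^sub>0) - {0}) z * pi) \<in> borel_measurable (borel :: complex measure)"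
    by measurable
  ultimately have "(\<lambda>z. indicator (- \<real>\<^sub>\<le>\<^sub>0) z *\<^sub>R Arg z + indicator (- (- \<real>\<^sub>\<le>\<^sub>0) - {0}) z * pi) \<in> borel_measurable borel"
    by (rule borel_measurable_add)
  also have "(\<lambda>z. indicator (- \<real>\<^sub>\<le>\<^sub>0) z *\<^sub>R Arg z + indicator (- (- \<real>\<^sub>\<le>\<^sub>0) - {0}) z * pi) = Arg"
  proof
    fix z :: complex
    have "Arg z = pi" if "z \<in> \<real>\<^sub>\<le>\<^sub>0" "z \<noteq> 0"
      using that by (auto simp: Arg_eq_pi complex_nonpos_Reals_iff complex_eq_iff)
    then show "indicator (- \<real>\<^sub>\<le>\<^sub>0) z *\<^sub>R Arg z + indicator (- (- \<real>\<^sub>\<le>\<^sub>0) - {0}) z * pi = Arg z"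
      by (cases "z = 0") (auto simp: indicator_def Arg_zero)
  qed
  finally show ?thesis .
qed

text \<open>\<open>circle_haar\<close> is defined by the period [0, 1), while \<open>Arg\<close>
  takes values in (- pi, pi]. Moving (1/2, 1) by one period matches the measure to the range of the
  section.\<close>

lemma emeasure_circle_haar_symmetric:
  assumes A: "A \<in> sets (borel_of circle_topology)"
  shows "emeasure circle_haar A = emeasure lborel {t. - 1 / 2 < t \<and> t \<le> 1 / 2 \<and> cis (2 * pi * t) \<in> A}"
proof -
  define f :: "real \<Rightarrow> ennreal" where "f t = indicator A (cis (2 * pi * t))" for t
  have f [measurable]: "f \<in> borel_measurable borel"
    unfolding f_def using A by measurable
  have period: "f (1 + t) = f t" for t
  proof -
    have "cis (2 * pi * (1 + t)) = cis (2 * pi) * cis (2 * pi * t)"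
      by (simp only: cis_mult) (simp add: algebra_simps)
    then show ?thesis by (simp add: f_def)
  qed
  have "emeasure circle_haar A = (\<integral>\<^sup>+t. f t * indicator {0..<1} t \<partial>lborel)"
    unfolding f_def by (rule emeasure_circle_haar[OF A])
  also have "\<dots> = (\<integral>\<^sup>+t. f t * indicator {0..1/2} t + f t * indicator {1/2<..<1} t \<partial>lborel)"
    by (intro nn_integral_cong) (auto simp: indicator_def)
  also have "\<dots> = (\<integral>\<^sup>+t. f t * indicator {0..1/2} t \<partial>lborel) + (\<integral>\<^sup>+t. f t * indicator {1/2<..<1} t \<partial>lborel)"
    by (intro nn_integral_add) auto
  also have "(\<integral>\<^sup>+t. f t * indicator {1/2<..<1} t \<partial>lborel) = (\<integral>\<^sup>+t. f t * indicator {1/2<..<1} t \<partial>distr lborel borel ((+) 1))"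
    unfolding lborel_distr_plus ..
  also have "\<dots> = (\<integral>\<^sup>+t. f (1 + t) * indicator {1/2<..<1} (1 + t) \<partial>lborel)"
    by (subst nn_integral_distr) auto
  also have "\<dots> = (\<integral>\<^sup>+t. f t * indicator {-1/2<..<0} t \<partial>lborel)"
    by (intro nn_integral_cong) (auto simp: period indicator_def)
  also have "(\<integral>\<^sup>+t. f t * indicator {0..1/2} t \<partial>lborel) + (\<integral>\<^sup>+t. f t * indicator {-1/2<..<0} t \<partial>lborel) =
      (\<integral>\<^sup>+t. f t * indicator {0..1/2} t + f t * indicator {-1/2<..<0} t \<partial>lborel)"
    by (intro nn_integral_add[symmetric]) auto
  also have "\<dots> = (\<integral>\<^sup>+t. indicator {t. - 1 / 2 < t \<and> t \<le> 1 / 2 \<and> cis (2 * pi * t) \<in> A} t \<partial>lborel)"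
    by (intro nn_integral_cong) (auto simp: f_def indicator_def)
  also have "\<dots> = emeasure lborel {t. - 1 / 2 < t \<and> t \<le> 1 / 2 \<and> cis (2 * pi * t) \<in> A}"
  proof (rule nn_integral_indicator)
    have "{t \<in> space lborel. - 1 / 2 < t \<and> t \<le> 1 / 2 \<and> cis (2 * pi * t) \<in> A} \<in> sets lborel"
      using A by measurable
    then show "{t. - 1 / 2 < t \<and> t \<le> 1 / 2 \<and> cis (2 * pi * t) \<in> A} \<in> sets lborel" by simp
  qed
  finally show ?thesis .
qed

lemma haar_group_torus: "haar_group (torus_group k) (torus_topology k) (torus_haar k)"
  unfolding torus_group_def torus_topology_def torus_haar_def
  by (intro haar_group_PiM haar_group_circle circle_topology_props) simp

lemma second_countable_torus: "second_countable (torus_topology k)"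
  unfolding torus_topology_def by (intro second_countable_power circle_topology_props) simp

lemma Hausdorff_torus: "Hausdorff_space (torus_topology k)"
  by (simp add: torus_topology_def Hausdorff_space_product_topology circle_topology_props)

lemma haar_group_euclidean_torus:
  "haar_group (euclidean_torus_group n m) (euclidean_torus_topology n m) (euclidean_torus_haar n m)"
  unfolding euclidean_torus_group_def euclidean_torus_topology_def euclidean_torus_haar_def
  by (intro haar_group_pair haar_group_PiM haar_group_real haar_group_torus second_countable_torus
      Hausdorff_torus second_countable_power second_countable_euclidean)
     (auto simp: Hausdorff_space_product_topology)

lemma second_countable_euclidean_torus: "second_countable (euclidean_torus_topology n m)"
  unfolding euclidean_torus_topology_def
  by (intro second_countable_prod_topology second_countable_power second_countable_euclidean second_countable_torus) simp

section \<open>The section by principal arguments and its fundamental domain\<close>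

definition torus_section :: "nat \<Rightarrow> nat \<Rightarrow> (nat \<Rightarrow> complex) \<Rightarrow> (nat \<Rightarrow> real) \<times> (nat \<Rightarrow> complex)" where
  "torus_section n m w = (\<lambda>i\<in>{..<n}. Arg (w i) / (2 * pi), \<lambda>i\<in>{..<m}. w (n + i))"

text \<open>With 1/8 as half the side, sums of three coordinates stay below 3/8 in modulus, hence
  inside (-1/2, 1/2]. The circle coordinates are unrestricted, as the quotient map merely relabels
  them.\<close>

definition small_cube :: "nat \<Rightarrow> nat \<Rightarrow> ((nat \<Rightarrow> real) \<times> (nat \<Rightarrow> complex)) set" where
  "small_cube n m = ({..<n} \<rightarrow>\<^sub>E {- 1 / 8<..<1 / 8}) \<times> space (torus_haar m)"

lemma space_euclidean_torus_haar:
  "space (euclidean_torus_haar n m) = ({..<n} \<rightarrow>\<^sub>E UNIV) \<times> ({..<m} \<rightarrow>\<^sub>E sphere 0 1)"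
  by (simp add: euclidean_torus_haar_def torus_haar_def space_pair_measure space_PiM space_circle_haar)

text \<open>The half-open interval reflects the range (- pi, pi] of \<open>Arg\<close>; the circle
  coordinates always return unchanged.\<close>

lemma torus_section_fixed_iff:
  assumes "p \<in> space (euclidean_torus_haar n m)"
  shows "torus_section n m (torus_quotient_map n m p) = p \<longleftrightarrow> (\<forall>i<n. - 1 / 2 < fst p i \<and> fst p i \<le> 1 / 2)"
proof -
  obtain x z where p: "p = (x, z)" by (cases p)
  have x: "x \<in> extensional {..<n}" and z: "z \<in> extensional {..<m}"
    using assms by (auto simp: p space_euclidean_torus_haar PiE_iff)
  have arg: "Arg (cis (2 * pi * t)) / (2 * pi) = t \<longleftrightarrow> - 1 / 2 < t \<and> t \<le> 1 / 2" for t
  proof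
    assume "Arg (cis (2 * pi * t)) / (2 * pi) = t"
    then have "2 * pi * t = Arg (cis (2 * pi * t))" by (simp add: field_simps)
    then have "- pi < 2 * pi * t" "2 * pi * t \<le> pi"
      using mpi_less_Arg[of "cis (2 * pi * t)"] Arg_le_pi[of "cis (2 * pi * t)"] by linarith+
    then have "pi * (- 1) < pi * (2 * t)" "pi * (2 * t) \<le> pi * 1" by (simp_all add: mult_ac)
    then show "- 1 / 2 < t \<and> t \<le> 1 / 2" by (simp only: mult_less_cancel_left_pos mult_le_cancel_left_pos pi_gt_zero) simp
  next
    assume t: "- 1 / 2 < t \<and> t \<le> 1 / 2"
    have "pi * (- 1) < pi * (2 * t)" "pi * (2 * t) \<le> pi * 1"
      unfolding mult_less_cancel_left_pos[OF pi_gt_zero] mult_le_cancel_left_pos[OF pi_gt_zero] using t by auto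
    then have "Arg (cis (2 * pi * t)) = 2 * pi * t" by (intro Arg_cis) (auto simp: mult_ac)
    then show "Arg (cis (2 * pi * t)) / (2 * pi) = t" by simp
  qed
  have "torus_section n m (torus_quotient_map n m p) =
      (\<lambda>i\<in>{..<n}. Arg (cis (2 * pi * x i)) / (2 * pi), \<lambda>i\<in>{..<m}. z i)"
    by (auto simp: torus_section_def torus_quotient_map_def p fun_eq_iff)
  moreover have "(\<lambda>i\<in>{..<m}. z i) = z" using z by (simp add: extensional_restrict)
  moreover have "(\<lambda>i\<in>{..<n}. Arg (cis (2 * pi * x i)) / (2 * pi)) = x \<longleftrightarrow> (\<forall>i<n. Arg (cis (2 * pi * x i)) / (2 * pi) = x i)"
    using x by (auto simp: fun_eq_iff extensional_def)
  ultimately show ?thesis by (simp add: p arg)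
qed

lemma measurable_torus_quotient_map:
  "torus_quotient_map n m \<in> euclidean_torus_haar n m \<rightarrow>\<^sub>M torus_haar (n + m)"
  unfolding torus_quotient_map_def torus_haar_def case_prod_beta'
proof (rule measurable_restrict)
  fix i assume i: "i \<in> {..<n + m}"
  show "(\<lambda>p. if i < n then cis (2 * pi * fst p i) else snd p (i - n)) \<in> euclidean_torus_haar n m \<rightarrow>\<^sub>M circle_haar"
  proof (cases "i < n")
    case True
    have "(\<lambda>t. cis (2 * pi * t)) \<in> lborel \<rightarrow>\<^sub>M circle_haar"
      using measurable_cis_circle by (simp add: measurable_cong_sets[OF refl sets_circle_haar])
    moreover have "(\<lambda>p. fst p i) \<in> euclidean_torus_haar n m \<rightarrow>\<^sub>M lborel"
      unfolding euclidean_torus_haar_def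
      by (rule measurable_compose[OF measurable_fst measurable_component_singleton]) (use True in simp)
    ultimately have "(\<lambda>p. cis (2 * pi * fst p i)) \<in> euclidean_torus_haar n m \<rightarrow>\<^sub>M circle_haar"
      by (rule measurable_compose[rotated])
    then show ?thesis using True by simp
  next
    case False
    have "(\<lambda>p. snd p (i - n)) \<in> euclidean_torus_haar n m \<rightarrow>\<^sub>M circle_haar"
      unfolding euclidean_torus_haar_def torus_haar_def
      by (rule measurable_compose[OF measurable_snd measurable_component_singleton]) (use False i in auto)
    then show ?thesis using False by simp
  qed
qed

lemma measurable_torus_section:
  "torus_section n m \<in> torus_haar (n + m) \<rightarrow>\<^sub>M euclidean_torus_haar n m"
proof -
  have comp: "(\<lambda>w. w i) \<in> torus_haar (n + m) \<rightarrow>\<^sub>M circle_haar" if "i < n + m" for i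
    unfolding torus_haar_def by (rule measurable_component_singleton) (use that in simp)
  have "(\<lambda>w. \<lambda>i\<in>{..<n}. Arg (w i) / (2 * pi)) \<in> torus_haar (n + m) \<rightarrow>\<^sub>M PiM {..<n} (\<lambda>_. lborel)"
  proof (rule measurable_restrict)
    fix i assume "i \<in> {..<n}"
    then have [measurable]: "(\<lambda>w. w i) \<in> borel_measurable (torus_haar (n + m))"
      by (intro measurable_compose[OF comp measurable_circle_haar_borel]) simp
    show "(\<lambda>w. Arg (w i) / (2 * pi)) \<in> torus_haar (n + m) \<rightarrow>\<^sub>M lborel" by simp
  qed
  moreover have "(\<lambda>w. \<lambda>i\<in>{..<m}. w (n + i)) \<in> torus_haar (n + m) \<rightarrow>\<^sub>M torus_haar m"
    unfolding torus_haar_def[of m] by (rule measurable_restrict) (simp add: comp)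
  ultimately show ?thesis
    unfolding torus_section_def[abs_def] euclidean_torus_haar_def by (rule measurable_Pair)
qed

lemma prod_lessThan_add:
  fixes f :: "nat \<Rightarrow> 'a :: comm_monoid_mult"
  shows "(\<Prod>i<n + m. f i) = (\<Prod>i<n. f i) * (\<Prod>i<m. f (n + i))"
  by (induction m) (simp_all add: mult.assoc)

lemma emeasure_torus_haar_space: "emeasure (torus_haar k) (space (torus_haar k)) = 1"
proof -
  interpret product_sigma_finite "\<lambda>_::nat. circle_haar"
    by (simp add: product_sigma_finite_def sigma_finite_circle_haar)
  have "emeasure circle_haar (space circle_haar) = emeasure lborel {t. - 1 / 2 < t \<and> t \<le> 1 / 2 \<and> cis (2 * pi * t) \<in> space circle_haar}"
    using sets.top[of circle_haar] unfolding sets_circle_haar by (rule emeasure_circle_haar_symmetric)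
  also have "{t. - 1 / 2 < t \<and> t \<le> 1 / 2 \<and> cis (2 * pi * t) \<in> space circle_haar} = {- 1 / 2 <.. 1 / 2 :: real}"
    by (auto simp: space_circle_haar)
  finally have "emeasure circle_haar (space circle_haar) = 1" by simp
  then show ?thesis
    unfolding torus_haar_def space_PiM by (subst emeasure_PiM) auto
qed

text \<open>Product measures are determined by boxes, and inside the fundamental domain the preimage
  of a box is again a box. Its mass factors, and each real coordinate is handled by
  \<open>emeasure_circle_haar_symmetric\<close>.\<close>

lemma torus_haar_quotient:
  assumes Q: "{p \<in> space (euclidean_torus_haar n m). torus_section n m (torus_quotient_map n m p) = p} \<in> sets (euclidean_torus_haar n m)"
    (is "?Q \<in> _")
  shows "distr (density (euclidean_torus_haar n m) (indicator ?Q)) (torus_haar (n + m)) (torus_quotient_map n m) = torus_haar (n + m)"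
    (is "?P = _")
  unfolding torus_haar_def[of "n + m"]
proof -
  interpret C: product_sigma_finite "\<lambda>_::nat. circle_haar"
    by (simp add: product_sigma_finite_def sigma_finite_circle_haar)
  interpret R: product_sigma_finite "\<lambda>_::nat. lborel :: real measure"
    by (simp add: product_sigma_finite_def sigma_finite_lborel)
  interpret T: sigma_finite_measure "torus_haar m"
    unfolding torus_haar_def by (rule C.sigma_finite) simp
  have q: "torus_quotient_map n m \<in> density (euclidean_torus_haar n m) (indicator ?Q) \<rightarrow>\<^sub>M torus_haar (n + m)"
    using measurable_torus_quotient_map by simp
  show "distr (density (euclidean_torus_haar n m) (indicator ?Q)) (PiM {..<n + m} (\<lambda>_. circle_haar)) (torus_quotient_map n m) =
      PiM {..<n + m} (\<lambda>_. circle_haar)"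
  proof (rule C.PiM_eqI)
    fix A assume A: "\<And>i. i \<in> {..<n + m} \<Longrightarrow> A i \<in> sets circle_haar"
    let ?I = "\<lambda>i. {t. - 1 / 2 < t \<and> t \<le> 1 / 2 \<and> cis (2 * pi * t) \<in> A i}"
    have I: "?I i \<in> sets lborel" if "i < n" for i
    proof -
      have [measurable]: "A i \<in> sets (borel_of circle_topology)" using A[of i] that by (simp add: sets_circle_haar)
      have "{t \<in> space lborel. - 1 / 2 < t \<and> t \<le> 1 / 2 \<and> cis (2 * pi * t) \<in> A i} \<in> sets lborel" by measurable
      then show ?thesis by simp
    qed
    have sub: "A i \<subseteq> sphere 0 1" if "i < n + m" for i
      using sets.sets_into_space[OF A[of i]] that by (simp add: space_circle_haar)
    have PA: "Pi\<^sub>E {..<n + m} A \<in> sets (torus_haar (n + m))"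
      unfolding torus_haar_def by (rule sets_PiM_I_finite) (use A in auto)
    have "?Q \<inter> (torus_quotient_map n m -` Pi\<^sub>E {..<n + m} A \<inter> space (euclidean_torus_haar n m)) =
        Pi\<^sub>E {..<n} ?I \<times> Pi\<^sub>E {..<m} (\<lambda>i. A (n + i))"
    proof (rule Set.set_eqI)
      fix p :: "(nat \<Rightarrow> real) \<times> (nat \<Rightarrow> complex)"
      obtain x z where p: "p = (x, z)" by (cases p)
      have "torus_quotient_map n m p \<in> Pi\<^sub>E {..<n + m} A \<longleftrightarrow> (\<forall>i<n. cis (2 * pi * x i) \<in> A i) \<and> (\<forall>i<m. z i \<in> A (n + i))"
      proof
        assume h: "torus_quotient_map n m p \<in> Pi\<^sub>E {..<n + m} A"
        have "cis (2 * pi * x i) \<in> A i" if "i < n" for i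
          using PiE_mem[OF h, of i] that by (simp add: torus_quotient_map_def p)
        moreover have "z i \<in> A (n + i)" if "i < m" for i
          using PiE_mem[OF h, of "n + i"] that by (simp add: torus_quotient_map_def p)
        ultimately show "(\<forall>i<n. cis (2 * pi * x i) \<in> A i) \<and> (\<forall>i<m. z i \<in> A (n + i))" by blast
      next
        assume h: "(\<forall>i<n. cis (2 * pi * x i) \<in> A i) \<and> (\<forall>i<m. z i \<in> A (n + i))"
        \<comment> \<open>Circle coordinates are indexed from 0 in the domain but from
          \<open>n\<close> in the target.\<close>
        have "z (i - n) \<in> A i" if "\<not> i < n" "i < n + m" for i
          using spec[OF conjunct2[OF h], of "i - n"] that by auto
        then show "torus_quotient_map n m p \<in> Pi\<^sub>E {..<n + m} A"
          using h by (auto simp: torus_quotient_map_def p)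
      qed
      moreover have "z i \<in> sphere 0 1" if "z i \<in> A (n + i)" "i < m" for i using that sub[of "n + i"] by auto
      ultimately show "p \<in> ?Q \<inter> (torus_quotient_map n m -` Pi\<^sub>E {..<n + m} A \<inter> space (euclidean_torus_haar n m)) \<longleftrightarrow>
          p \<in> Pi\<^sub>E {..<n} ?I \<times> Pi\<^sub>E {..<m} (\<lambda>i. A (n + i))"
        using torus_section_fixed_iff[of p n m]
        by (auto simp: p space_euclidean_torus_haar PiE_iff)
    qed
    then have "emeasure ?P (Pi\<^sub>E {..<n + m} A) = emeasure (euclidean_torus_haar n m) (Pi\<^sub>E {..<n} ?I \<times> Pi\<^sub>E {..<m} (\<lambda>i. A (n + i)))"
      using measurable_sets[OF measurable_torus_quotient_map PA]
      by (simp add: emeasure_distr[OF q PA] emeasure_restricted[OF Q])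
    also have "\<dots> = emeasure (PiM {..<n} (\<lambda>_. lborel)) (Pi\<^sub>E {..<n} ?I) * emeasure (torus_haar m) (Pi\<^sub>E {..<m} (\<lambda>i. A (n + i)))"
      unfolding euclidean_torus_haar_def
      by (rule T.emeasure_pair_measure_Times) (use I A in \<open>auto simp: torus_haar_def intro!: sets_PiM_I_finite\<close>)
    also have "emeasure (PiM {..<n} (\<lambda>_. lborel)) (Pi\<^sub>E {..<n} ?I) = (\<Prod>i<n. emeasure lborel (?I i))"
      by (rule R.emeasure_PiM) (use I in auto)
    also have "\<dots> = (\<Prod>i<n. emeasure circle_haar (A i))"
      using A by (intro prod.cong refl emeasure_circle_haar_symmetric[symmetric]) (auto simp: sets_circle_haar)
    also have "emeasure (torus_haar m) (Pi\<^sub>E {..<m} (\<lambda>i. A (n + i))) = (\<Prod>i<m. emeasure circle_haar (A (n + i)))"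
      unfolding torus_haar_def by (rule C.emeasure_PiM) (use A in auto)
    also have "(\<Prod>i<n. emeasure circle_haar (A i)) * (\<Prod>i<m. emeasure circle_haar (A (n + i))) = (\<Prod>i<n + m. emeasure circle_haar (A i))"
      by (rule prod_lessThan_add[symmetric])
    finally show "emeasure (distr (density (euclidean_torus_haar n m) (indicator ?Q)) (PiM {..<n + m} (\<lambda>_. circle_haar)) (torus_quotient_map n m)) (Pi\<^sub>E {..<n + m} A) =
        (\<Prod>i<n + m. emeasure circle_haar (A i))"
      by (simp add: torus_haar_def)
  qed simp_all
qed

lemma emeasure_small_cube:
  "small_cube n m \<in> sets (euclidean_torus_haar n m)" "emeasure (euclidean_torus_haar n m) (small_cube n m) \<noteq> 0"
proof -
  interpret C: product_sigma_finite "\<lambda>_::nat. circle_haar"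
    by (simp add: product_sigma_finite_def sigma_finite_circle_haar)
  interpret R: product_sigma_finite "\<lambda>_::nat. lborel :: real measure"
    by (simp add: product_sigma_finite_def sigma_finite_lborel)
  interpret T: sigma_finite_measure "torus_haar m"
    unfolding torus_haar_def by (rule C.sigma_finite) simp
  have c: "{..<n} \<rightarrow>\<^sub>E {- 1 / 8<..<1 / 8 :: real} \<in> sets (PiM {..<n} (\<lambda>_. lborel))"
    by (rule sets_PiM_I_finite) auto
  show "small_cube n m \<in> sets (euclidean_torus_haar n m)"
    unfolding small_cube_def euclidean_torus_haar_def by (intro pair_measureI c sets.top)
  have "emeasure (euclidean_torus_haar n m) (small_cube n m) =
      emeasure (PiM {..<n} (\<lambda>_. lborel)) ({..<n} \<rightarrow>\<^sub>E {- 1 / 8<..<1 / 8 :: real}) * emeasure (torus_haar m) (space (torus_haar m))"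
    unfolding small_cube_def euclidean_torus_haar_def by (intro T.emeasure_pair_measure_Times c sets.top)
  also have "\<dots> = (\<Prod>i<n. ennreal (1 / 4))"
    by (subst R.emeasure_PiM) (auto simp: emeasure_torus_haar_space)
  finally show "emeasure (euclidean_torus_haar n m) (small_cube n m) \<noteq> 0" by simp
qed

lemma haar_section_torus:
  "haar_section (euclidean_torus_group n m) (euclidean_torus_topology n m) (euclidean_torus_haar n m)
     (torus_group (n + m)) (torus_topology (n + m)) (torus_haar (n + m))
     (torus_quotient_map n m) (torus_section n m) (small_cube n m)"
proof -
  let ?G = "euclidean_torus_group n m" and ?H = "torus_group (n + m)"
  interpret A: haar_group ?G "euclidean_torus_topology n m" "euclidean_torus_haar n m"
    by (rule haar_group_euclidean_torus)
  interpret B: haar_group ?H "torus_topology (n + m)" "torus_haar (n + m)"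
    by (rule haar_group_torus)
  interpret RG: haar_group real_group euclideanreal lborel by (rule haar_group_real)
  interpret TG: haar_group "torus_group m" "torus_topology m" "torus_haar m" by (rule haar_group_torus)
  note carrier = A.space_h[symmetric] space_euclidean_torus_haar
  have mult: "fst (x \<otimes>\<^bsub>?G\<^esub> y) i = fst x i + fst y i" if "i < n" for x y i
    using that by (simp add: euclidean_torus_group_def mult_DirProd' real_group_def)
  have rg: "group real_group" by (rule RG.is_group)
  have real_inv: "inv\<^bsub>real_group\<^esub> t = - t" for t
    by (rule RG.inv_equality) (simp_all add: real_group_def)
  have inv: "fst (inv\<^bsub>?G\<^esub> x) i = - fst x i" if "x \<in> carrier ?G" "i < n" for x i
  proof -
    let ?R = "product_group {..<n} (\<lambda>_. real_group)"
    have x: "fst x \<in> carrier ?R" "snd x \<in> carrier (torus_group m)"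
      using that(1) unfolding euclidean_torus_group_def carrier_DirProd mem_Times_iff by (rule conjunct1, rule conjunct2)
    have R: "group ?R" by (rule product_group) (rule rg)
    have "inv\<^bsub>?G\<^esub> x = (inv\<^bsub>?R\<^esub> fst x, inv\<^bsub>torus_group m\<^esub> snd x)"
      unfolding euclidean_torus_group_def using inv_DirProd[OF R TG.is_group x] by (simp only: prod.collapse)
    moreover have "inv\<^bsub>?R\<^esub> fst x = (\<lambda>i\<in>{..<n}. inv\<^bsub>real_group\<^esub> fst x i)"
      by (rule inv_product_group) (use x(1) rg in \<open>simp_all only: carrier_product_group\<close>)
    ultimately show ?thesis using that(2) by (simp only: fst_conv restrict_apply lessThan_iff if_True real_inv)
  qed
  have torus_space: "space (torus_haar m) = {..<m} \<rightarrow>\<^sub>E sphere 0 1"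
    by (simp add: torus_haar_def space_PiM space_circle_haar)
  have W: "x \<in> small_cube n m \<longleftrightarrow> x \<in> carrier ?G \<and> (\<forall>i<n. \<bar>fst x i\<bar> < 1 / 8)" for x
  proof -
    have "\<bar>t\<bar> < 1 / 8 \<longleftrightarrow> t \<in> {- 1 / 8<..<1 / 8}" for t :: real
      unfolding greaterThanLessThan_iff by linarith
    then show ?thesis
      unfolding small_cube_def carrier torus_space mem_Times_iff by (auto simp only: PiE_iff lessThan_iff UNIV_I)
  qed
  have Q: "{p \<in> space (euclidean_torus_haar n m). torus_section n m (torus_quotient_map n m p) = p} \<in> sets (euclidean_torus_haar n m)"
  proof -
    \<comment> \<open>Measurability of the fundamental domain comes from its description as a
      box.\<close>
    have "{p \<in> space (euclidean_torus_haar n m). torus_section n m (torus_quotient_map n m p) = p} =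
        ({..<n} \<rightarrow>\<^sub>E {- 1 / 2<..1 / 2}) \<times> space (torus_haar m)"
    proof (rule Set.set_eqI)
      fix p
      have "p \<in> space (euclidean_torus_haar n m) \<and> torus_section n m (torus_quotient_map n m p) = p \<longleftrightarrow>
          p \<in> space (euclidean_torus_haar n m) \<and> (\<forall>i<n. fst p i \<in> {- 1 / 2<..1 / 2})"
        using torus_section_fixed_iff[of p n m] unfolding greaterThanAtMost_iff by blast
      then show "p \<in> {p \<in> space (euclidean_torus_haar n m). torus_section n m (torus_quotient_map n m p) = p} \<longleftrightarrow>
          p \<in> ({..<n} \<rightarrow>\<^sub>E {- 1 / 2<..1 / 2}) \<times> space (torus_haar m)"
        unfolding space_euclidean_torus_haar torus_space mem_Times_iff mem_Collect_eq
        by (auto simp only: PiE_iff lessThan_iff UNIV_I)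
    qed
    also have "\<dots> \<in> sets (euclidean_torus_haar n m)"
      unfolding euclidean_torus_haar_def by (intro pair_measureI sets.top sets_PiM_I_finite) auto
    finally show ?thesis .
  qed
  show ?thesis
  proof unfold_locales
    show "torus_quotient_map n m \<in> hom ?G ?H" by (rule torus_quotient_map_hom)
    show "torus_quotient_map n m \<in> euclidean_torus_haar n m \<rightarrow>\<^sub>M torus_haar (n + m)"
      by (rule measurable_torus_quotient_map)
    show "torus_section n m \<in> torus_haar (n + m) \<rightarrow>\<^sub>M euclidean_torus_haar n m"
      by (rule measurable_torus_section)
    show "torus_quotient_map n m (torus_section n m w) = w" if "w \<in> carrier ?H" for w
    proof -
      have w: "w \<in> {..<n + m} \<rightarrow>\<^sub>E sphere 0 1" using that by (simp add: torus_group_def circle_group_def)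
      have "cis (Arg (w i)) = w i" if "i < n" for i
      proof -
        have "cmod (w i) = 1" using PiE_mem[OF w, of i] that by simp
        then show ?thesis by (subst cis_Arg) (auto simp: sgn_div_norm)
      qed
      then show ?thesis
        using w by (auto simp: torus_quotient_map_def torus_section_def fun_eq_iff PiE_iff extensional_def)
    qed
    show "countable (kernel ?G ?H (torus_quotient_map n m))"
      unfolding torus_quotient_map_kernel by (intro countable_SIGMA countable_PiE countable_int) auto
    show "emeasure (torus_haar (n + m)) (space (torus_haar (n + m))) = 1"
      by (rule emeasure_torus_haar_space)
    show "\<one>\<^bsub>?G\<^esub> \<in> small_cube n m"
      unfolding W using A.one_closed by (auto simp: euclidean_torus_group_def real_group_def)
    show "inv\<^bsub>?G\<^esub> x \<in> small_cube n m" if "x \<in> small_cube n m" for x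
      using that unfolding W by (auto simp: inv)
    fix x y z assume xyz: "x \<in> small_cube n m" "y \<in> small_cube n m" "z \<in> small_cube n m"
    then have c: "x \<otimes>\<^bsub>?G\<^esub> y \<otimes>\<^bsub>?G\<^esub> z \<in> carrier ?G" unfolding W by auto
    have "- 1 / 2 < fst x i + fst y i + fst z i \<and> fst x i + fst y i + fst z i \<le> 1 / 2" if "i < n" for i
    proof -
      have "\<bar>fst x i\<bar> < 1 / 8" "\<bar>fst y i\<bar> < 1 / 8" "\<bar>fst z i\<bar> < 1 / 8" using xyz that unfolding W by auto
      then show ?thesis by linarith
    qed
    then show "torus_section n m (torus_quotient_map n m (x \<otimes>\<^bsub>?G\<^esub> y \<otimes>\<^bsub>?G\<^esub> z)) = x \<otimes>\<^bsub>?G\<^esub> y \<otimes>\<^bsub>?G\<^esub> z"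
      using c by (subst torus_section_fixed_iff) (auto simp: A.space_h mult)
  qed (fact Q torus_haar_quotient[OF Q] emeasure_small_cube)+
qed

lemma continuous_map_torus_quotient_map:
  "continuous_map (euclidean_torus_topology n m) (torus_topology (n + m)) (torus_quotient_map n m)"
  unfolding torus_topology_def[of "n + m"] continuous_map_componentwise
proof (intro conjI ballI)
  show "torus_quotient_map n m ` topspace (euclidean_torus_topology n m) \<subseteq> extensional {..<n + m}"
    by (auto simp: torus_quotient_map_def)
  fix i assume i: "i \<in> {..<n + m}"
  show "continuous_map (euclidean_torus_topology n m) circle_topology (\<lambda>p. torus_quotient_map n m p i)"
  proof (cases "i < n")
    case True
    have c: "continuous_map euclideanreal circle_topology (\<lambda>t. cis (2 * pi * t))"
      unfolding circle_topology_def
      by (auto simp: continuous_map_in_subtopology intro!: continuous_intros)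
    have "continuous_map (product_topology (\<lambda>_. euclideanreal) {..<n}) euclideanreal (\<lambda>x. x i)"
      by (rule continuous_map_product_projection) (use True in simp)
    from continuous_map_compose[OF continuous_map_compose[OF continuous_map_fst this] c]
    have "continuous_map (euclidean_torus_topology n m) circle_topology (\<lambda>p. cis (2 * pi * fst p i))"
      unfolding euclidean_torus_topology_def o_def .
    then show ?thesis using True i by (simp add: torus_quotient_map_def case_prod_beta')
  next
    case False
    have "continuous_map (torus_topology m) circle_topology (\<lambda>z. z (i - n))"
      unfolding torus_topology_def by (rule continuous_map_product_projection) (use False i in auto)
    from continuous_map_compose[OF continuous_map_snd this]
    have "continuous_map (euclidean_torus_topology n m) circle_topology (\<lambda>p. snd p (i - n))"
      unfolding euclidean_torus_topology_def o_def .
    then show ?thesis using False i by (simp add: torus_quotient_map_def case_prod_beta')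
  qed
qed

theorem corollary3p15:
  fixes n m :: nat and E :: "(nat \<Rightarrow> complex) set"
  assumes "closedin (torus_topology (n + m)) E"
  shows "M0_set (torus_group (n + m)) (torus_topology (n + m)) (torus_haar (n + m)) E \<longleftrightarrow>
         M0_set (euclidean_torus_group n m) (euclidean_torus_topology n m) (euclidean_torus_haar n m)
           {p \<in> carrier (euclidean_torus_group n m). torus_quotient_map n m p \<in> E}"
proof -
  interpret haar_section "euclidean_torus_group n m" "euclidean_torus_topology n m" "euclidean_torus_haar n m"
    "torus_group (n + m)" "torus_topology (n + m)" "torus_haar (n + m)"
    "torus_quotient_map n m" "torus_section n m" "small_cube n m"
    by (rule haar_section_torus)
  show ?thesis
  proof (rule M0_set_preimage_iff[OF second_countable_torus second_countable_euclidean_torus assms])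
    \<comment> \<open>Closedness is part of \<open>M0_set\<close>, so it has to be established for
      the preimage; it follows from continuity.\<close>
    show "closedin (euclidean_torus_topology n m) {p \<in> carrier (euclidean_torus_group n m). torus_quotient_map n m p \<in> E}"
      using closedin_continuous_map_preimage[OF continuous_map_torus_quotient_map assms]
      by (simp add: Gr.topspace_T)
  qed
qed

end
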